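(* Let $\mathcal H$ be a complex, separable, infinite-dimensional Hilbert space and let $n\ge 3$ be an integer. There exists a continuum $\{U_\alpha:\alpha\in\Omega\}$ of cyclic, non-atomic unitary operators on $\mathcal H$, no two of which are unitarily equivalent (that is, $U_\alpha\not\simeq U_\beta$ whenever $\alpha\neq\beta$), such that each $U_\alpha$ is $\textsc{j}_n^{[\textsc{u}]}$-stable, i.e. $U_\alpha\simeq J_n(U_\alpha)$.
   Context: For $T\in\mathcal B(\mathcal H)$ and $n\ge2$, $J_n(T)\in\mathcal B(\mathcal H^{(n)})$ (where $\mathcal H^{(n)}$ is the direct sum of $n$ copies of $\mathcal H$) is the $n\times n$ operator matrix with $I$ in each entry $(i,i+1)$, $1\le i\le n-1$, with $T$ in the entry $(n,1)$, and $0$ elsewhere. $X\simeq Y$ means unitary equivalence: $Y=V^*XV$ for some unitary $V$ between the underlying Hilbert spaces. An operator $T\in\mathcal B(\mathcal H)$ is cyclic if there is $0\ne x\in\mathcal H$ such that $\mathcal H$ is the closed linear span of $\{T^kx:k\ge0\}$. A unitary operator is non-atomic if its spectral measure has no atoms. A "continuum" of objects is a family whose index set $\Omega$ has the cardinality $2^{\aleph_0}$. *)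

theory Defs
  imports "HOL-Analysis.Analysis" "HOL-Library.Equipollence"
begin

text \<open>
  Complex inner product spaces. The class extends \<^class>\<open>real_inner\<close>, whose inner product is
  required to be the real part of the complex one, so that norm and topology are those induced by
  \<open>cinner\<close>. The complex inner product is linear in its first argument.
\<close>

class complex_inner = real_inner +
  fixes scaleC :: "complex \<Rightarrow> 'a \<Rightarrow> 'a" (infixr "*\<^sub>C" 75)
    and cinner :: "'a \<Rightarrow> 'a \<Rightarrow> complex"
  assumes scaleC_add_right: "a *\<^sub>C (x + y) = a *\<^sub>C x + a *\<^sub>C y"
    and scaleC_add_left: "(a + b) *\<^sub>C x = a *\<^sub>C x + b *\<^sub>C x"
    and scaleC_scaleC: "a *\<^sub>C b *\<^sub>C x = (a * b) *\<^sub>C x"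
    and scaleC_of_real: "complex_of_real r *\<^sub>C x = r *\<^sub>R x"
    and cinner_commute: "cinner x y = cnj (cinner y x)"
    and cinner_add_left: "cinner (x + y) z = cinner x z + cinner y z"
    and cinner_scaleC_left: "cinner (a *\<^sub>C x) y = a * cinner x y"
    and Re_cinner: "Re (cinner x y) = inner x y"

class complex_hilbert = complex_inner + complete_space

global_interpretation complex_vector: vector_space "scaleC :: complex \<Rightarrow> 'a \<Rightarrow> 'a::complex_inner"
  defines cspan = complex_vector.span
proof unfold_locales
  fix x :: 'a
  show "1 *\<^sub>C x = x"
    using scaleC_of_real[of 1 x] by simp
qed (simp_all add: scaleC_add_right scaleC_add_left scaleC_scaleC)

definition infinite_cdim :: "'a::complex_inner itself \<Rightarrow> bool" where
  "infinite_cdim _ \<longleftrightarrow> \<not> (\<exists>B::'a set. finite B \<and> cspan B = UNIV)"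

text \<open>The Hilbert space direct sum of \<open>CARD('n)\<close> copies of \<open>'a\<close> is \<open>'a ^ 'n\<close>.\<close>

instantiation vec :: (complex_inner, finite) complex_inner
begin

definition scaleC_vec :: "complex \<Rightarrow> 'a ^ 'b \<Rightarrow> 'a ^ 'b" where
  "scaleC_vec c x = (\<chi> i. c *\<^sub>C (x $ i))"

definition cinner_vec :: "'a ^ 'b \<Rightarrow> 'a ^ 'b \<Rightarrow> complex" where
  "cinner_vec x y = (\<Sum>i\<in>UNIV. cinner (x $ i) (y $ i))"

instance
proof
  fix x y :: "'a ^ 'b"
  show "cinner x y = cnj (cinner y x)"
    unfolding cinner_vec_def cnj_sum by (intro sum.cong refl cinner_commute)
qed (simp_all add: scaleC_vec_def cinner_vec_def vec_eq_iff scaleC_add_right scaleC_add_left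
      scaleC_scaleC scaleC_of_real cinner_add_left cinner_scaleC_left Re_cinner inner_vec_def
      sum.distrib sum_distrib_left)

end

instance vec :: (complex_hilbert, finite) complex_hilbert ..


definition bounded_clinear :: "('a::complex_inner \<Rightarrow> 'b::complex_inner) \<Rightarrow> bool" where
  "bounded_clinear T \<longleftrightarrow> bounded_linear T \<and> (\<forall>c x. T (c *\<^sub>C x) = c *\<^sub>C T x)"

definition is_cadjoint ::
    "('b::complex_inner \<Rightarrow> 'a::complex_inner) \<Rightarrow> ('a \<Rightarrow> 'b) \<Rightarrow> bool" where
  "is_cadjoint W V \<longleftrightarrow> (\<forall>x y. cinner (V x) y = cinner x (W y))"

definition cunitary :: "('a::complex_inner \<Rightarrow> 'b::complex_inner) \<Rightarrow> bool" where
  "cunitary V \<longleftrightarrow> bounded_clinear V \<and>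
     (\<exists>W. bounded_clinear W \<and> is_cadjoint W V \<and> W \<circ> V = id \<and> V \<circ> W = id)"

definition unitarily_equivalent ::
    "('a::complex_inner \<Rightarrow> 'a) \<Rightarrow> ('b::complex_inner \<Rightarrow> 'b) \<Rightarrow> bool" (infix "\<simeq>\<^sub>u" 50) where
  "X \<simeq>\<^sub>u Y \<longleftrightarrow> (\<exists>V W. cunitary V \<and> is_cadjoint W V \<and> Y = W \<circ> X \<circ> V)"

definition cyclic_operator :: "('a::complex_inner \<Rightarrow> 'a) \<Rightarrow> bool" where
  "cyclic_operator T \<longleftrightarrow> (\<exists>x. x \<noteq> 0 \<and> closure (cspan (range (\<lambda>k. (T ^^ k) x))) = UNIV)"

definition orthogonal_projection :: "('a::complex_inner \<Rightarrow> 'a) \<Rightarrow> bool" where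
  "orthogonal_projection P \<longleftrightarrow> bounded_clinear P \<and> P \<circ> P = P \<and> is_cadjoint P P"

text \<open>
  Projection-valued measures on a measurable space (of the argument \<open>M\<close> only the \<open>\<sigma>\<close>-algebra
  is relevant); countable additivity is with respect to the strong operator topology.
\<close>

definition spectral_measure :: "'x measure \<Rightarrow> ('x set \<Rightarrow> 'a::complex_inner \<Rightarrow> 'a) \<Rightarrow> bool" where
  "spectral_measure M E \<longleftrightarrow>
     (\<forall>A\<in>sets M. orthogonal_projection (E A)) \<and>
     E {} = (\<lambda>x. 0) \<and> E (space M) = id \<and>
     (\<forall>A\<in>sets M. \<forall>B\<in>sets M. E (A \<inter> B) = E A \<circ> E B) \<and>
     (\<forall>A :: nat \<Rightarrow> 'x set. range A \<subseteq> sets M \<longrightarrow> disjoint_family A \<longrightarrow>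
        (\<forall>x. (\<lambda>k. E (A k) x) sums E (\<Union>k. A k) x))"

definition scalar_spectral_measure ::
    "'x measure \<Rightarrow> ('x set \<Rightarrow> 'a::complex_inner \<Rightarrow> 'a) \<Rightarrow> 'a \<Rightarrow> 'x measure" where
  "scalar_spectral_measure M E x =
     measure_of (space M) (sets M) (\<lambda>A. ennreal (Re (cinner (E A x) x)))"

definition circle_borel :: "complex measure" where
  "circle_borel = restrict_space borel (sphere 0 1)"

text \<open>
  \<open>E\<close> is the spectral measure of the unitary operator \<open>U\<close>, that is, \<open>U = \<integral> z dE(z)\<close> over the unit
  circle. The integral is taken in the weak sense, \<open>\<langle>U x, x\<rangle> = \<integral> z d\<langle>E(z) x, x\<rangle>\<close> for all \<open>x\<close>, which
  determines all \<open>\<langle>U x, y\<rangle>\<close> by polarization.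
\<close>

definition has_spectral_measure ::
    "('a::complex_inner \<Rightarrow> 'a) \<Rightarrow> (complex set \<Rightarrow> 'a \<Rightarrow> 'a) \<Rightarrow> bool" where
  "has_spectral_measure U E \<longleftrightarrow> spectral_measure circle_borel E \<and>
     (\<forall>x. cinner (U x) x = (LINT z|scalar_spectral_measure circle_borel E x. z))"

definition spectral_atom :: "'x measure \<Rightarrow> ('x set \<Rightarrow> 'a::zero \<Rightarrow> 'a) \<Rightarrow> 'x set \<Rightarrow> bool" where
  "spectral_atom M E A \<longleftrightarrow> A \<in> sets M \<and> E A \<noteq> (\<lambda>x. 0) \<and>
     (\<forall>B\<in>sets M. B \<subseteq> A \<longrightarrow> E B = (\<lambda>x. 0) \<or> E B = E A)"

text \<open>
  By the spectral theorem a unitary operator on a Hilbert space has exactly one spectral measure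
  (up to the irrelevant values of \<open>E\<close> off the \<open>\<sigma>\<close>-algebra), hence the existential
  quantifier speaks about \<^emph>\<open>the\<close> spectral measure.
\<close>

definition non_atomic :: "('a::complex_inner \<Rightarrow> 'a) \<Rightarrow> bool" where
  "non_atomic U \<longleftrightarrow>
     (\<exists>E. has_spectral_measure U E \<and> \<not> (\<exists>A. spectral_atom circle_borel E A))"


text \<open>
  The direct sum is indexed by a finite linearly ordered type \<open>'n\<close>; \<open>index_pos i\<close> is the position
  of \<open>i\<close> in the increasing enumeration of \<open>'n\<close>, numbered \<open>1, \<dots>, CARD('n)\<close>. Every \<open>n \<ge> 1\<close> is
  \<open>CARD('n)\<close> for such a type.
\<close>

definition index_pos :: "'n::{finite,linorder} \<Rightarrow> nat" where
  "index_pos i = card {j. j \<le> i}"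

definition operator_matrix :: "('n::finite \<Rightarrow> 'n \<Rightarrow> 'a \<Rightarrow> 'a) \<Rightarrow> 'a::complex_inner ^ 'n \<Rightarrow> 'a ^ 'n" where
  "operator_matrix A x = (\<chi> i. \<Sum>j\<in>UNIV. A i j (x $ j))"

definition J_mat :: "('a \<Rightarrow> 'a) \<Rightarrow> 'a::complex_inner ^ 'n::{finite,linorder} \<Rightarrow> 'a ^ 'n::{finite,linorder}" where
  "J_mat T = operator_matrix (\<lambda>i j.
     if index_pos j = index_pos i + 1 then id
     else if index_pos i = CARD('n) \<and> index_pos j = 1 then T
     else (\<lambda>x. 0))"

text \<open>\<open>J\<^sub>n\<close>-stability for \<open>n = CARD('n)\<close>.\<close>

definition J_stable :: "'n::{finite,linorder} itself \<Rightarrow> ('a::complex_inner \<Rightarrow> 'a) \<Rightarrow> bool" where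
  "J_stable _ T \<longleftrightarrow> T \<simeq>\<^sub>u (J_mat T :: 'a ^ 'n::{finite,linorder} \<Rightarrow> 'a ^ 'n::{finite,linorder})"

end

theory Submission
  imports Defs "HOL-Complex_Analysis.Complex_Analysis"
begin

text \<open>
  Let \<open>p\<close> be a strictly positive probability vector on the \<open>n\<close> digits and let \<open>\<phi> y\<close> be the point of the
  circle whose argument, in base \<open>n\<close>, lists the digits of \<open>y \<in> [0,1)\<close> with respect to the partition
  into intervals of lengths \<open>p\<close>. Lebesgue measure makes these digits independent with law \<open>p\<close>, so
  the image of Lebesgue measure under \<open>\<phi>\<close> is a Bernoulli measure. The operator is multiplication
  by \<open>\<phi>\<close> on \<open>L\<^sup>2[0,1)\<close>.

  Stability: if \<open>T\<close> forgets the first digit, then \<open>\<phi> \<circ> T = \<phi>\<^sup>n\<close>, and the operators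
  \<open>S\<^sub>k f = cnj \<phi>\<^sup>k w (f \<circ> T)\<close> with \<open>w = 1 / sqrt (n p)\<close>, evaluated at the first digit, are isometries whose
  ranges decompose the space; \<open>U S\<^sub>k\<^sub>+\<^sub>1 = S\<^sub>k\<close> and \<open>U S\<^sub>0 = S\<^sub>n\<^sub>-\<^sub>1 U\<close>, which says that \<open>(S\<^sub>k)\<^sub>k\<close> intertwines \<open>J\<^sub>n(U)\<close> and \<open>U\<close>.

  Cyclicity: \<open>exp (- 1 / \<bar>1 - \<phi>\<bar>\<^sup>2)\<close> is a cyclic vector. By duality one shows that an \<open>F\<close> dominated
  by this weight with \<open>\<integral> \<phi>\<^sup>k F = 0\<close> for \<open>k \<ge> 0\<close> also has \<open>\<integral> cnj \<phi> F = 0\<close>, testing against dilations of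
  the inverse singular inner function \<open>exp (t ((1 + z) / (1 - z) - 1))\<close>, which is \<open>1\<close> at \<open>0\<close> and of
  modulus \<open>exp (- t)\<close> on the circle.

  Inequivalence: a unitary equivalence would make the Bernoulli measures of two probability vectors
  absolutely continuous with respect to one another, but the frequency of the digit \<open>0\<close> tells them
  apart.
\<close>

section \<open>Complex Hilbert spaces\<close>

text \<open>The n-th power of \<open>J_n(T)\<close> is a direct sum of n copies of T, so stability
  of multiplication by z on \<open>L^2(mu)\<close> asks that mu be equivalent to the sum of its
  images under the n branches of the n-th root. For a Bernoulli measure with positive weights the
  image belonging to digit d has constant density \<open>1 / p d\<close> with respect to mu on the
  arc of d; the square root of that density is, up to \<open>sqrt n\<close>, the factor w. Different
  values of \<open>p 0\<close> give mutually singular measures, which is the source of the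
  continuum. The measure is hidden in the function \<phi>, so that one identification of
  \<open>L^2[0,1)\<close> with the given Hilbert space serves every p.

  The obstacle is cyclicity, where only nonnegative powers of U are available. For uniform p the
  measure is Lebesgue measure and the vector 1 generates just the Hardy space, while for singular
  measures Szego's theorem makes 1 cyclic. A vector whose logarithm is not integrable for Lebesgue
  measure handles all p at once; the argument asks of the measure only that the point 1 is not
  charged.\<close>

lemma cinner_add_right: "cinner x (y + z) = cinner x y + cinner x (z::'a::complex_inner)"
  by (metis cinner_add_left cinner_commute complex_cnj_add)

lemma cinner_scaleC_right: "cinner x (a *\<^sub>C y) = cnj a * cinner x (y::'a::complex_inner)"
  by (metis cinner_commute cinner_scaleC_left complex_cnj_mult)

lemma scaleC_minus_one: "(- 1) *\<^sub>C x = - (x::'a::complex_inner)"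
  using scaleC_of_real[of "-1" x] by simp

lemma cinner_zero_left [simp]: "cinner 0 (y::'a::complex_inner) = 0"
  using cinner_add_left[of 0 0 y] by simp

lemma cinner_zero_right [simp]: "cinner (y::'a::complex_inner) 0 = 0"
  using cinner_add_right[of y 0 0] by simp

lemma cinner_minus_left [simp]: "cinner (- x) y = - cinner x (y::'a::complex_inner)"
  by (metis cinner_scaleC_left mult_minus1 scaleC_minus_one)

lemma cinner_minus_right [simp]: "cinner x (- y) = - cinner x (y::'a::complex_inner)"
  by (metis cinner_commute cinner_minus_left complex_cnj_minus)

lemma cinner_diff_left: "cinner (x - y) z = cinner x z - cinner y (z::'a::complex_inner)"
  using cinner_add_left[of x "- y" z] by simp

lemma cinner_diff_right: "cinner x (y - z) = cinner x y - cinner x (z::'a::complex_inner)"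
  using cinner_add_right[of x y "- z"] by simp

lemma cinner_sum_left: "cinner (sum f A) y = (\<Sum>i\<in>A. cinner (f i) (y::'a::complex_inner))"
  by (induction A rule: infinite_finite_induct) (auto simp: cinner_add_left)

lemma cinner_sum_right: "cinner y (sum f A) = (\<Sum>i\<in>A. cinner (y::'a::complex_inner) (f i))"
  by (induction A rule: infinite_finite_induct) (auto simp: cinner_add_right)

text \<open>\<open>Re_cinner\<close> ties only the real part to the norm; conjugate symmetry makes
  the diagonal values real.\<close>

lemma cinner_self: "cinner x x = of_real ((norm (x::'a::complex_inner))\<^sup>2)"
proof (rule complex_eqI)
  show "Re (cinner x x) = Re (of_real ((norm x)\<^sup>2))"
    by (simp add: Re_cinner power2_norm_eq_inner)
  have "cnj (cinner x x) = cinner x x"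
    by (metis cinner_commute)
  then show "Im (cinner x x) = Im (of_real ((norm x)\<^sup>2))"
    by (metis Im_complex_of_real complex_In_mult_cnj_zero complex_cnj_cancel_iff complex_is_Real_iff Reals_cnj_iff)
qed

lemma norm_scaleC: "norm (a *\<^sub>C x) = cmod a * norm (x::'a::complex_inner)"
proof -
  have "complex_of_real ((norm (a *\<^sub>C x))\<^sup>2) = of_real ((cmod a * norm x)\<^sup>2)"
    unfolding cinner_self[symmetric] cinner_scaleC_left cinner_scaleC_right
    unfolding cinner_self of_real_mult power_mult_distrib complex_norm_square
    by (simp only: mult_ac)
  then show ?thesis
    by (metis abs_of_nonneg mult_nonneg_nonneg norm_ge_zero of_real_eq_iff power2_eq_iff_nonneg)
qed

lemma cmod_cinner_le: "cmod (cinner x y) \<le> norm x * norm (y::'a::complex_inner)"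
proof (cases "cinner x y = 0")
  case False
  \<comment> \<open>Rotating x by this unimodular number makes the inner product real, so the real
    Cauchy-Schwarz inequality applies.\<close>
  define a where "a = cnj (cinner x y) / of_real (cmod (cinner x y))"
  have a: "cmod a = 1" using False by (simp add: a_def norm_divide)
  have "a * cinner x y = of_real (cmod (cinner x y))"
    using False unfolding a_def
    by (simp add: field_simps complex_norm_square[symmetric] power2_eq_square del: of_real_mult flip: of_real_mult)
  then have "cmod (cinner x y) = Re (cinner (a *\<^sub>C x) y)"
    by (simp add: cinner_scaleC_left)
  also have "\<dots> \<le> norm (a *\<^sub>C x) * norm y"
    by (simp add: Re_cinner norm_cauchy_schwarz)
  finally show ?thesis by (simp add: norm_scaleC a)
qed simp

lemma scaleC_scaleR: "a *\<^sub>C (r *\<^sub>R x) = r *\<^sub>R (a *\<^sub>C (x::'a::complex_inner))"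
  by (metis mult.commute scaleC_of_real scaleC_scaleC)

lemma bounded_linear_cinner_left: "bounded_linear (\<lambda>x. cinner x (y::'a::complex_inner))"
proof (rule bounded_linear_intro[where K="norm y"])
  fix r x show "cinner (r *\<^sub>R x) y = r *\<^sub>R cinner x y"
    by (metis cinner_scaleC_left scaleC_of_real scaleR_conv_of_real)
qed (auto simp: cinner_add_left cmod_cinner_le)

lemma norm_eq_cinner: "(norm (x::'a::complex_inner))\<^sup>2 = Re (cinner x x)"
  by (simp add: cinner_self)

lemma bounded_clinear_intro:
  fixes T :: "'a::complex_inner \<Rightarrow> 'b::complex_inner"
  assumes "\<And>x y. T (x + y) = T x + T y" "\<And>c x. T (c *\<^sub>C x) = c *\<^sub>C T x"
    and "\<And>x. norm (T x) \<le> K * norm x"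
  shows "bounded_clinear T"
  unfolding bounded_clinear_def
proof (intro conjI allI)
  show "bounded_linear T"
  proof (rule bounded_linear_intro[where K=K])
    fix r x show "T (r *\<^sub>R x) = r *\<^sub>R T x"
      using assms(2)[of "of_real r" x] by (simp add: scaleC_of_real)
  qed (use assms in \<open>auto simp: mult.commute\<close>)
qed (rule assms)

text \<open>An isometry that is onto is inverted by its adjoint. The facts about
  \<open>inv V\<close> are kept as conclusions because unitary equivalence asks for an explicit
  adjoint.\<close>

lemma cunitary_intro:
  fixes V :: "'a::complex_inner \<Rightarrow> 'b::complex_inner"
  assumes add: "\<And>x y. V (x + y) = V x + V y" and scale: "\<And>c x. V (c *\<^sub>C x) = c *\<^sub>C V x"
    and iso: "\<And>x y. cinner (V x) (V y) = cinner x y" and surj: "surj V"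
  shows "cunitary V" "is_cadjoint (inv V) V" "inv V \<circ> V = id" "V \<circ> inv V = id"
proof -
  have nrm: "norm (V x) = norm x" for x
    by (metis cinner_self iso norm_ge_zero of_real_eq_iff power2_eq_iff_nonneg)
  have "inj V"
  proof (rule injI)
    fix x y assume "V x = V y"
    moreover have "V (x - y) = V x - V y"
      using add[of "x - y" y] by simp
    ultimately show "x = y" using nrm[of "x - y"] by simp
  qed
  then show i: "inv V \<circ> V = id" and i': "V \<circ> inv V = id"
    using surj by (auto simp: inj_iff surj_iff)
  have VW: "V (inv V y) = y" for y using surj by (simp add: surj_f_inv_f)
  have WV: "inv V (V y) = y" for y using \<open>inj V\<close> by simp
  show ad: "is_cadjoint (inv V) V"
    unfolding is_cadjoint_def by (metis VW iso)
  have "bounded_clinear V"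
    by (rule bounded_clinear_intro[where K=1]) (auto simp: add scale nrm)
  moreover have "bounded_clinear (inv V)"
  proof (rule bounded_clinear_intro[where K=1])
    fix x y show "inv V (x + y) = inv V x + inv V y"
      using WV[of "inv V x + inv V y"] by (simp add: add VW)
    show "inv V (c *\<^sub>C x) = c *\<^sub>C inv V x" for c
      using WV[of "c *\<^sub>C inv V x"] by (simp add: scale VW)
    show "norm (inv V x) \<le> 1 * norm x"
      using nrm[of "inv V x"] by (simp add: VW)
  qed
  ultimately show "cunitary V"
    unfolding cunitary_def using ad i i' by blast
qed

text \<open>The vector h is the difference between x and its nearest point in K. A minimising
  sequence converges by the parallelogram law and completeness.\<close>

lemma exists_orthogonal_to_closed_subspace:
  fixes K :: "'a::complex_hilbert set"
  assumes K: "complex_vector.subspace K" "closed K" and x: "x \<notin> K"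
  shows "\<exists>h. h \<noteq> 0 \<and> (\<forall>k\<in>K. cinner k h = 0)"
proof -
  have K0: "0 \<in> K" and Kadd: "\<And>a b. a \<in> K \<Longrightarrow> b \<in> K \<Longrightarrow> a + b \<in> K"
    and KC: "\<And>c a. a \<in> K \<Longrightarrow> c *\<^sub>C a \<in> K"
    using K(1) by (auto simp: complex_vector.subspace_def)
  have KR: "r *\<^sub>R a \<in> K" if "a \<in> K" for r a
    using KC[OF that, of "of_real r"] by (simp add: scaleC_of_real)
  define d where "d = infdist x K"
  have d_le: "d \<le> norm (x - k)" if "k \<in> K" for k
    using infdist_le[OF that, of x] by (simp add: d_def dist_norm)
  have d0: "0 \<le> d" by (simp add: d_def infdist_nonneg)
  have "\<exists>k\<in>K. (norm (x - k))\<^sup>2 < d\<^sup>2 + 1 / Suc n" for n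
  proof -
    have "d < sqrt (d\<^sup>2 + 1 / Suc n)"
      by (rule real_less_rsqrt) simp
    moreover have "d = Inf (dist x ` K)"
      using K0 unfolding d_def by (intro infdist_notempty) auto
    ultimately have "\<exists>k\<in>K. dist x k < sqrt (d\<^sup>2 + 1 / Suc n)"
      using K0 cInf_lessD[of "dist x ` K" "sqrt (d\<^sup>2 + 1 / Suc n)"] by auto
    then obtain k where "k \<in> K" "norm (x - k) < sqrt (d\<^sup>2 + 1 / Suc n)"
      by (auto simp: dist_norm)
    then show ?thesis
      using d0 by (intro bexI[of _ k]) (auto simp: real_less_rsqrt dest: power_strict_mono[of _ _ 2])
  qed
  then obtain k where kK: "\<And>n. k n \<in> K" and k: "\<And>n. (norm (x - k n))\<^sup>2 < d\<^sup>2 + 1 / Suc n"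
    by metis
  \<comment> \<open>The midpoint of two members of K is again at distance at least d from x; the
    parallelogram law turns this into a bound on their distance.\<close>
  have par: "(norm (k n - k m))\<^sup>2 \<le> 2 / Suc n + 2 / Suc m" for n m
  proof -
    have eq: "(norm (k n - k m))\<^sup>2 = 2 * (norm (x - k n))\<^sup>2 + 2 * (norm (x - k m))\<^sup>2
        - 4 * (norm (x - (1/2) *\<^sub>R (k n + k m)))\<^sup>2"
      unfolding power2_norm_eq_inner
      by (simp add: inner_diff_left inner_diff_right inner_add_left inner_add_right inner_commute algebra_simps)
    have "(1/2) *\<^sub>R (k n + k m) \<in> K" using kK by (intro KR Kadd)
    then have "d\<^sup>2 \<le> (norm (x - (1/2) *\<^sub>R (k n + k m)))\<^sup>2"
      using d_le d0 by (intro power_mono) auto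
    with k[of n] k[of m] show ?thesis unfolding eq by (simp add: algebra_simps)
  qed
  have "Cauchy k"
  proof (rule metric_CauchyI)
    fix e :: real assume e: "0 < e"
    obtain N :: nat where N: "4 / e\<^sup>2 < Suc N"
      using reals_Archimedean2[of "4/e\<^sup>2"] by (metis less_Suc_eq of_nat_less_iff order_less_trans)
    have "dist (k m) (k n) < e" if "m \<ge> N" "n \<ge> N" for m n
    proof -
      have "1 / real (Suc m) \<le> 1 / Suc N" "1 / real (Suc n) \<le> 1 / Suc N"
        using that by (auto intro!: divide_left_mono)
      then have "(norm (k m - k n))\<^sup>2 \<le> 4 / Suc N"
        using par[of m n] by linarith
      also have "\<dots> < e\<^sup>2"
        using N e by (simp add: field_simps)
      finally show ?thesis
        using e by (simp add: dist_norm power2_less_imp_less)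
    qed
    then show "\<exists>M. \<forall>m\<ge>M. \<forall>n\<ge>M. dist (k m) (k n) < e" by blast
  qed
  then obtain l where l: "k \<longlonglongrightarrow> l"
    using Cauchy_convergent_iff convergent_def by blast
  then have lK: "l \<in> K" using K(2) kK closed_sequentially by blast
  define h where "h = x - l"
  have "(\<lambda>n. d\<^sup>2 + 1 / Suc n) \<longlonglongrightarrow> d\<^sup>2 + 0"
    by (intro tendsto_add tendsto_const LIMSEQ_Suc lim_1_over_n)
  moreover have "(\<lambda>n. (norm (x - k n))\<^sup>2) \<longlonglongrightarrow> (norm h)\<^sup>2"
    unfolding h_def by (intro tendsto_intros l)
  ultimately have "(norm h)\<^sup>2 \<le> d\<^sup>2 + 0"
    using k by (intro LIMSEQ_le[of _ _ "\<lambda>n. d\<^sup>2 + 1 / Suc n"]) (auto intro: less_imp_le)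
  then have hd: "norm h \<le> d" using d0 power2_le_imp_le by auto
  \<comment> \<open>If k' were not orthogonal to h, moving l by the optimal multiple s of k' would
    bring it closer to x than d.\<close>
  have re: "inner k' h = 0" if "k' \<in> K" for k'
  proof (rule ccontr)
    assume ne: "inner k' h \<noteq> 0"
    then have pos: "inner k' k' > 0" by auto
    define s where "s = inner k' h / inner k' k'"
    have "l + s *\<^sub>R k' \<in> K" using lK that KR Kadd by blast
    then have "norm h \<le> norm (h - s *\<^sub>R k')"
      using hd d_le[of "l + s *\<^sub>R k'"] by (simp add: h_def algebra_simps)
    then have "(norm h)\<^sup>2 \<le> (norm (h - s *\<^sub>R k'))\<^sup>2" by (intro power_mono) auto
    also have "\<dots> = (norm h)\<^sup>2 - 2 * s * inner k' h + s\<^sup>2 * inner k' k'"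
      unfolding power2_norm_eq_inner
      by (simp add: inner_diff_left inner_diff_right inner_commute algebra_simps power2_eq_square)
    also have "\<dots> = (norm h)\<^sup>2 - (inner k' h)\<^sup>2 / inner k' k'"
      using pos by (simp add: s_def power2_eq_square field_simps)
    finally show False using pos ne by (simp add: divide_le_0_iff)
  qed
  \<comment> \<open>K is stable under multiplication by \<i>, and this turns the imaginary part into
    a real part.\<close>
  have "cinner k' h = 0" if "k' \<in> K" for k'
  proof (rule complex_eqI)
    show "Re (cinner k' h) = Re 0" using re[OF that] by (simp add: Re_cinner)
    have "Re (\<i> * cinner k' h) = 0"
      using re[OF KC[OF that, of \<i>]] by (metis Re_cinner cinner_scaleC_left)
    then show "Im (cinner k' h) = Im 0" by simp
  qed
  moreover have "h \<noteq> 0" using x lK by (auto simp: h_def)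
  ultimately show ?thesis by blast
qed

section \<open>Orthonormal sequences and expansions\<close>

instance complex_hilbert \<subseteq> banach ..

definition corthonormal :: "'a::complex_inner set \<Rightarrow> bool" where
  "corthonormal B \<longleftrightarrow> (\<forall>x\<in>B. \<forall>y\<in>B. cinner x y = (if x = y then 1 else 0))"

definition complete_orthonormal :: "(nat \<Rightarrow> 'a::complex_inner) \<Rightarrow> bool" where
  "complete_orthonormal e \<longleftrightarrow> (\<forall>i j. cinner (e i) (e j) = (if i = j then 1 else 0)) \<and>
     (\<forall>x. (\<forall>k. cinner x (e k) = 0) \<longrightarrow> x = 0)"

text \<open>Two orthonormal vectors are at distance \<open>sqrt 2\<close>, so balls of radius 1/2
  around them cannot share a point of the dense set.\<close>

lemma countable_corthonormal:
  assumes "separable_space (euclidean :: 'a::complex_inner topology)" "corthonormal (B :: 'a set)"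
  shows "countable B"
proof -
  obtain C :: "'a set" where C: "countable C" "closure C = UNIV"
    using assms(1) by (auto simp: separable_space_def)
  have "\<exists>c\<in>C. dist c b < 1/2" for b
    using C(2) by (metis UNIV_I closure_approachable half_gt_zero zero_less_one)
  then obtain f where f: "\<And>b. f b \<in> C" "\<And>b. dist (f b) b < 1/2" by metis
  have "inj_on f B"
  proof (rule inj_onI, rule ccontr)
    fix x y assume xy: "x \<in> B" "y \<in> B" "f x = f y" "x \<noteq> y"
    have "(norm (x - y))\<^sup>2 = Re (cinner x x - cinner x y - cinner y x + cinner y y)"
      by (simp add: norm_eq_cinner cinner_diff_left cinner_diff_right)
    also have "\<dots> = 2" using xy assms(2) by (auto simp: corthonormal_def)
    finally have "(norm (x - y))\<^sup>2 > 1\<^sup>2" by simp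
    then have "norm (x - y) > 1" by (rule power2_less_imp_less) simp
    moreover have "dist x y < 1"
      using f(2)[of x] f(2)[of y] xy(3) dist_triangle2[of x y "f x"] by (simp add: dist_commute)
    ultimately show False by (simp add: dist_norm)
  qed
  then show ?thesis
    using C(1) f(1) by (metis countable_subset countable_image_inj_on image_subsetI)
qed

text \<open>Zorn's lemma gives a maximal orthonormal set, and maximality leaves no nonzero vector
  orthogonal to it. It is infinite because a finite one would span the space, and countable by
  separability.\<close>

lemma exists_complete_orthonormal:
  assumes sep: "separable_space (euclidean :: 'a::complex_hilbert topology)"
    and inf: "infinite_cdim TYPE('a)"
  shows "\<exists>e :: nat \<Rightarrow> 'a. complete_orthonormal e"
proof -
  have "\<exists>B\<in>Collect corthonormal. \<forall>X\<in>Collect corthonormal. B \<subseteq> X \<longrightarrow> X = (B :: 'a set)"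
  proof (rule subset_Zorn')
    fix \<C> :: "'a set set" assume ch: "subset.chain (Collect corthonormal) \<C>"
    show "\<Union>\<C> \<in> Collect corthonormal"
      unfolding corthonormal_def mem_Collect_eq
    proof (intro ballI)
      fix x y assume "x \<in> \<Union>\<C>" "y \<in> \<Union>\<C>"
      then obtain X Y where XY: "X \<in> \<C>" "Y \<in> \<C>" "x \<in> X" "y \<in> Y" by blast
      then have "X \<subseteq> Y \<or> Y \<subseteq> X" using ch by (meson subset_chain_def)
      moreover have "corthonormal X" "corthonormal Y"
        using XY ch by (auto simp: subset_chain_def)
      ultimately show "cinner x y = (if x = y then 1 else 0)"
        using XY unfolding corthonormal_def by (meson subsetD)
    qed
  qed
  then obtain B :: "'a set" where B: "corthonormal B"
    and max: "\<And>X. corthonormal X \<Longrightarrow> B \<subseteq> X \<Longrightarrow> X = B" by auto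
  have total: "x = 0" if x: "\<And>b. b \<in> B \<Longrightarrow> cinner x b = 0" for x
  proof (rule ccontr)
    assume "x \<noteq> 0"
    define y where "y = (1 / of_real (norm x)) *\<^sub>C x"
    have y: "cinner y b = 0" "cinner b y = 0" if "b \<in> B" for b
      using x[OF that] cinner_commute[of b x]
      by (auto simp: y_def cinner_scaleC_left cinner_scaleC_right)
    have "cinner y y = 1"
      using \<open>x \<noteq> 0\<close> unfolding cinner_self by (simp add: y_def norm_scaleC norm_divide)
    then have "corthonormal (insert y B)"
      using B y unfolding corthonormal_def by auto
    then have "y \<in> B" using max[of "insert y B"] by auto
    then show False using y(1)[of y] \<open>cinner y y = 1\<close> by simp
  qed
  have "infinite B"
  proof
    assume fin: "finite B"
    have "x \<in> cspan B" for x
    proof -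
      let ?s = "\<Sum>b\<in>B. cinner x b *\<^sub>C b"
      have "x - ?s = 0"
      proof (rule total)
        fix b assume b: "b \<in> B"
        have "cinner ?s b = (\<Sum>c\<in>B. if c = b then cinner x b else 0)"
          unfolding cinner_sum_left using B b
          by (intro sum.cong) (auto simp: cinner_scaleC_left corthonormal_def)
        then show "cinner (x - ?s) b = 0"
          using fin b by (simp add: cinner_diff_left)
      qed
      moreover have "?s \<in> cspan B"
        by (intro complex_vector.span_sum complex_vector.span_scale complex_vector.span_base)
      ultimately show ?thesis by simp
    qed
    then show False using inf fin by (auto simp: infinite_cdim_def)
  qed
  moreover have "countable B" using countable_corthonormal[OF sep B] .
  ultimately obtain e :: "nat \<Rightarrow> 'a" where e: "bij_betw e UNIV B"
    using bij_betw_from_nat_into by blast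
  have "complete_orthonormal e"
    unfolding complete_orthonormal_def
  proof (intro conjI allI impI)
    fix i j show "cinner (e i) (e j) = (if i = j then 1 else 0)"
      using B e unfolding corthonormal_def by (metis UNIV_I bij_betw_def inj_eq rangeI)
  next
    fix x assume "\<forall>k. cinner x (e k) = 0"
    then show "x = 0" using e by (intro total) (auto simp: bij_betw_def)
  qed
  then show ?thesis by blast
qed

context
  fixes e :: "nat \<Rightarrow> 'a::complex_hilbert"
  assumes e: "complete_orthonormal e"
begin

lemma cinner_complete_orthonormal: "cinner (e i) (e j) = (if i = j then 1 else 0)"
  using e by (simp add: complete_orthonormal_def)

lemma complete_orthonormal_eqI:
  assumes "\<And>k. cinner x (e k) = cinner y (e k)" shows "x = y"
proof -
  have "\<forall>k. cinner (x - y) (e k) = 0"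
    using assms by (simp add: cinner_diff_left)
  then have "x - y = 0"
    using e unfolding complete_orthonormal_def by blast
  then show ?thesis by simp
qed

lemma norm_orthonormal_sum:
  assumes "finite A"
  shows "(norm (\<Sum>k\<in>A. c k *\<^sub>C e k))\<^sup>2 = (\<Sum>k\<in>A. (cmod (c k))\<^sup>2)"
proof -
  have "cinner (\<Sum>k\<in>A. c k *\<^sub>C e k) (\<Sum>k\<in>A. c k *\<^sub>C e k)
      = (\<Sum>i\<in>A. \<Sum>j\<in>A. if i = j then c i * cnj (c j) else 0)"
    unfolding cinner_sum_left cinner_sum_right
    by (intro sum.cong) (auto simp: cinner_scaleC_left cinner_scaleC_right cinner_complete_orthonormal)
  also have "\<dots> = of_real (\<Sum>k\<in>A. (cmod (c k))\<^sup>2)"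
    using assms by (simp add: complex_norm_square del: of_real_power)
  finally show ?thesis unfolding cinner_self of_real_eq_iff .
qed

lemma orthonormal_summable:
  assumes "summable (\<lambda>k. (cmod (c k))\<^sup>2)"
  shows "summable (\<lambda>k. c k *\<^sub>C e k)"
  unfolding summable_Cauchy
proof (intro allI impI)
  fix \<epsilon> :: real assume "0 < \<epsilon>"
  then obtain N where N: "\<And>m n. m \<ge> N \<Longrightarrow> norm (\<Sum>k=m..<n. (cmod (c k))\<^sup>2) < \<epsilon>\<^sup>2"
    using assms unfolding summable_Cauchy by (meson zero_less_power)
  have "norm (\<Sum>k=m..<n. c k *\<^sub>C e k) < \<epsilon>" if "m \<ge> N" for m n
  proof (rule power2_less_imp_less)
    show "(norm (\<Sum>k=m..<n. c k *\<^sub>C e k))\<^sup>2 < \<epsilon>\<^sup>2"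
      using N[OF that, of n] by (simp add: norm_orthonormal_sum sum_nonneg)
  qed (use \<open>0 < \<epsilon>\<close> in simp)
  then show "\<exists>N. \<forall>m\<ge>N. \<forall>n. norm (\<Sum>k=m..<n. c k *\<^sub>C e k) < \<epsilon>" by blast
qed

lemma cinner_orthonormal_suminf:
  assumes "summable (\<lambda>k. (cmod (c k))\<^sup>2)"
  shows "cinner (\<Sum>k. c k *\<^sub>C e k) (e j) = c j"
proof -
  have "(\<lambda>k. cinner (c k *\<^sub>C e k) (e j)) sums cinner (\<Sum>k. c k *\<^sub>C e k) (e j)"
    by (intro bounded_linear.sums[OF bounded_linear_cinner_left] summable_sums
        orthonormal_summable assms)
  moreover have "(\<lambda>k. cinner (c k *\<^sub>C e k) (e j)) = (\<lambda>k. if k = j then c k else 0)"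
    by (auto simp: cinner_scaleC_left cinner_complete_orthonormal)
  ultimately show ?thesis
    by (metis sums_single sums_unique2)
qed

lemma bessel_cinner:
  assumes "finite A"
  shows "(\<Sum>k\<in>A. (cmod (cinner x (e k)))\<^sup>2) \<le> (norm x)\<^sup>2"
proof -
  let ?s = "\<Sum>k\<in>A. cinner x (e k) *\<^sub>C e k"
  have "cinner x ?s = of_real (\<Sum>k\<in>A. (cmod (cinner x (e k)))\<^sup>2)"
    by (simp add: cinner_sum_right cinner_scaleC_right complex_norm_square mult.commute
        del: of_real_power)
  moreover have "cinner ?s ?s = of_real (\<Sum>k\<in>A. (cmod (cinner x (e k)))\<^sup>2)"
    unfolding cinner_self norm_orthonormal_sum[OF assms] ..
  moreover have "cinner ?s x = cnj (cinner x ?s)" by (rule cinner_commute)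
  ultimately have "(norm (x - ?s))\<^sup>2 = (norm x)\<^sup>2 - (\<Sum>k\<in>A. (cmod (cinner x (e k)))\<^sup>2)"
    by (simp add: norm_eq_cinner cinner_diff_left cinner_diff_right)
  then show ?thesis
    by (metis diff_ge_0_iff_ge zero_le_power2)
qed

lemma summable_cinner_orthonormal: "summable (\<lambda>k. (cmod (cinner x (e k)))\<^sup>2)"
  by (rule bounded_imp_summable[where B="(norm x)\<^sup>2"]) (use bessel_cinner[of "{..n}" x for n] in auto)

lemma orthonormal_expansion: "(\<lambda>k. cinner x (e k) *\<^sub>C e k) sums x"
proof -
  have "(\<Sum>k. cinner x (e k) *\<^sub>C e k) = x"
    by (rule complete_orthonormal_eqI)
       (simp add: cinner_orthonormal_suminf summable_cinner_orthonormal)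
  then show ?thesis
    using summable_sums[OF orthonormal_summable[OF summable_cinner_orthonormal]] by metis
qed

end

section \<open>Fourier coefficients of measures on the circle\<close>

lemma integrable_bounded_on_circle:
  fixes f :: "complex \<Rightarrow> complex"
  assumes "finite_measure M" "sets M = sets borel" "AE z in M. cmod z = 1"
    and "f \<in> borel_measurable borel" "\<And>z. cmod z = 1 \<Longrightarrow> cmod (f z) \<le> B"
  shows "integrable M f"
proof (rule finite_measure.integrable_const_bound[OF assms(1), where B=B])
  show "AE x in M. cmod (f x) \<le> B"
    using assms(3) by eventually_elim (rule assms(5))
  show "f \<in> borel_measurable M"
    using assms(4) measurable_cong_sets[OF assms(2) refl] by blast
qed

context
  fixes M N :: "complex measure"
  assumes fin: "finite_measure M" "finite_measure N"
    and sets: "sets M = sets borel" "sets N = sets borel"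
    and circle: "AE z in M. cmod z = 1" "AE z in N. cmod z = 1"
    and moments: "\<And>k::nat. (\<integral>z. z ^ k \<partial>M) = (\<integral>z. z ^ k \<partial>N)"
begin

text \<open>The factors \<open>z ^ i * cnj z ^ j\<close> are built in so that the class is closed
  under multiplication by z and by \<open>cnj z\<close>; this is what lets an induction over
  polynomials in the two real coordinates go through. Boundedness on the circle supplies
  integrability.\<close>

definition same_moments :: "(complex \<Rightarrow> complex) \<Rightarrow> bool" where
  "same_moments f \<longleftrightarrow> f \<in> borel_measurable borel \<and> (\<exists>B. \<forall>z. cmod z = 1 \<longrightarrow> cmod (f z) \<le> B) \<and>
     (\<forall>i j. (\<integral>z. z ^ i * cnj z ^ j * f z \<partial>M) = (\<integral>z. z ^ i * cnj z ^ j * f z \<partial>N))"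

text \<open>Only powers with nonnegative exponent are assumed to have equal integrals. On the circle
  \<open>z ^ i * cnj z ^ j\<close> reduces to a power of z or of \<open>cnj z\<close>, and integrals
  of the latter are conjugates of integrals of the former.\<close>

lemma same_moments_one: "same_moments (\<lambda>z. 1)"
  unfolding same_moments_def
proof (intro conjI allI)
  fix i j :: nat
  have M': "z ^ i * cnj z ^ j * 1 = (if j \<le> i then z ^ (i - j) else cnj (z ^ (j - i)))"
    if "cmod z = 1" for z
  proof -
    have 1: "z * cnj z = 1" using that complex_norm_square[of z] by simp
    have "z ^ i * cnj z ^ j = z ^ (i - j) * (z * cnj z) ^ j" if "j \<le> i"
    proof -
      have "z ^ i = z ^ (i - j) * z ^ j"
        using that by (simp flip: power_add)
      then show ?thesis by (simp add: power_mult_distrib mult_ac)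
    qed
    moreover have "z ^ i * cnj z ^ j = cnj z ^ (j - i) * (z * cnj z) ^ i" if "\<not> j \<le> i"
    proof -
      have "cnj z ^ j = cnj z ^ (j - i) * cnj z ^ i"
        using that by (simp flip: power_add)
      then show ?thesis by (simp add: power_mult_distrib mult_ac)
    qed
    ultimately show ?thesis by (simp add: 1)
  qed
  have "(\<integral>z. z ^ i * cnj z ^ j * 1 \<partial>L) = (if j \<le> i then \<integral>z. z ^ (i - j) \<partial>L else cnj (\<integral>z. z ^ (j - i) \<partial>L))"
    if L: "sets L = sets borel" "AE z in L. cmod z = 1" for L
  proof -
    have [measurable]: "(\<lambda>z. z) \<in> L \<rightarrow>\<^sub>M borel" "cnj \<in> borel_measurable borel"
      using L(1) by (auto intro!: measurable_ident_sets borel_measurable_continuous_onI continuous_intros)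
    have "(\<integral>z. z ^ i * cnj z ^ j * 1 \<partial>L) = (\<integral>z. (if j \<le> i then z ^ (i - j) else cnj (z ^ (j - i))) \<partial>L)"
    proof (rule integral_cong_AE)
      show "AE z in L. z ^ i * cnj z ^ j * 1 = (if j \<le> i then z ^ (i - j) else cnj (z ^ (j - i)))"
        using L(2) by eventually_elim (rule M')
    qed measurable
    then show ?thesis by (auto simp: simp del: complex_cnj_power)
  qed
  then show "(\<integral>z. z ^ i * cnj z ^ j * 1 \<partial>M) = (\<integral>z. z ^ i * cnj z ^ j * 1 \<partial>N)"
    using sets circle moments by simp
qed auto

lemma same_moments_integrable:
  assumes "same_moments f"
  shows "integrable M (\<lambda>z. z ^ i * cnj z ^ j * f z)" "integrable N (\<lambda>z. z ^ i * cnj z ^ j * f z)"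
proof -
  obtain B where B: "\<And>z. cmod z = 1 \<Longrightarrow> cmod (f z) \<le> B" and [measurable]: "f \<in> borel_measurable borel"
    using assms by (auto simp: same_moments_def)
  have [measurable]: "cnj \<in> borel_measurable borel"
    by (intro borel_measurable_continuous_onI continuous_intros)
  have "cmod (z ^ i * cnj z ^ j * f z) \<le> B" if "cmod z = 1" for z
    using B[OF that] that by (simp add: norm_mult norm_power)
  then show "integrable M (\<lambda>z. z ^ i * cnj z ^ j * f z)" "integrable N (\<lambda>z. z ^ i * cnj z ^ j * f z)"
    using fin sets circle by (auto intro!: integrable_bounded_on_circle)
qed

lemma same_moments_add:
  assumes "same_moments f" "same_moments g" shows "same_moments (\<lambda>z. f z + g z)"
proof -
  obtain B C where "\<forall>z. cmod z = 1 \<longrightarrow> cmod (f z) \<le> B" "\<forall>z. cmod z = 1 \<longrightarrow> cmod (g z) \<le> C"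
    using assms by (auto simp: same_moments_def)
  then have "\<forall>z. cmod z = 1 \<longrightarrow> cmod (f z + g z) \<le> B + C"
    by (meson add_mono norm_triangle_ineq order_trans)
  then show ?thesis
    using assms by (auto simp: same_moments_def distrib_left same_moments_integrable)
qed

lemma same_moments_cmult:
  assumes "same_moments f" shows "same_moments (\<lambda>z. c * f z)"
proof -
  obtain B where "\<forall>z. cmod z = 1 \<longrightarrow> cmod (f z) \<le> B"
    using assms by (auto simp: same_moments_def)
  then have "\<forall>z. cmod z = 1 \<longrightarrow> cmod (c * f z) \<le> cmod c * B"
    by (simp add: norm_mult mult_left_mono)
  moreover have "(\<integral>z. z ^ i * cnj z ^ j * (c * f z) \<partial>L) = c * (\<integral>z. z ^ i * cnj z ^ j * f z \<partial>L)" for L i j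
    by (subst integral_mult_right_zero[symmetric]) (simp add: mult_ac)
  ultimately show ?thesis
    using assms unfolding same_moments_def by auto
qed

lemma same_moments_mult_id:
  assumes "same_moments f"
  shows "same_moments (\<lambda>z. z * f z)" "same_moments (\<lambda>z. cnj z * f z)"
proof -
  have [measurable]: "cnj \<in> borel_measurable borel"
    by (intro borel_measurable_continuous_onI continuous_intros)
  have 1: "z ^ i * cnj z ^ j * (z * f z) = z ^ Suc i * cnj z ^ j * f z"
    "z ^ i * cnj z ^ j * (cnj z * f z) = z ^ i * cnj z ^ Suc j * f z" for z i j
    by (simp_all add: mult_ac)
  obtain B where B: "\<forall>z. cmod z = 1 \<longrightarrow> cmod (f z) \<le> B"
    using assms by (auto simp: same_moments_def)
  then have "\<forall>z. cmod z = 1 \<longrightarrow> cmod (z * f z) \<le> B" "\<forall>z. cmod z = 1 \<longrightarrow> cmod (cnj z * f z) \<le> B"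
    by (auto simp: norm_mult)
  then show "same_moments (\<lambda>z. z * f z)" "same_moments (\<lambda>z. cnj z * f z)"
    using assms unfolding same_moments_def 1 by (auto simp del: power_Suc)
qed

lemma same_moments_real_polynomial:
  assumes "real_polynomial_function q"
  shows "same_moments f \<Longrightarrow> same_moments (\<lambda>z. of_real (q z) * f z)"
  using assms
proof (induction q arbitrary: f rule: real_polynomial_function.induct)
  case (linear q)
  note f = linear.prems
  interpret bounded_linear q by fact
  have q: "q z = Re z * q 1 + Im z * q \<i>" for z
  proof -
    have "z = Re z *\<^sub>R 1 + Im z *\<^sub>R \<i>"
      by (simp add: complex_eq_iff)
    then have "q z = q (Re z *\<^sub>R 1 + Im z *\<^sub>R \<i>)" by (rule arg_cong)
    then show ?thesis by (simp add: add scaleR)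
  qed
  \<comment> \<open>A real linear form on the plane is a complex combination of z and
    \<open>cnj z\<close>; these are its coefficients.\<close>
  define a b where "a = (of_real (q 1) - \<i> * of_real (q \<i>)) / 2" and "b = (of_real (q 1) + \<i> * of_real (q \<i>)) / 2"
  have "complex_of_real (q z) = a * z + b * cnj z" for z
    unfolding a_def b_def by (subst q) (simp add: complex_eq_iff field_simps)
  then have "(\<lambda>z. complex_of_real (q z) * f z) = (\<lambda>z. a * (z * f z) + b * (cnj z * f z))"
    by (simp add: algebra_simps)
  then show ?case
    using f by (simp add: same_moments_add same_moments_cmult same_moments_mult_id)
next
  case (const c)
  then show ?case by (rule same_moments_cmult)
next
  case (add p q)
  then show ?case by (simp add: distrib_right same_moments_add)
next
  case (mult p q)
  then show ?case by (simp add: mult.assoc)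
qed

text \<open>Polynomials in the real coordinates are uniformly dense on the circle by
  Stone-Weierstrass, and the approximation error is controlled by the total masses.\<close>

lemma circle_integral_continuous_eq:
  fixes h :: "complex \<Rightarrow> real"
  assumes h: "continuous_on UNIV h"
  shows "(\<integral>z. h z \<partial>M) = (\<integral>z. h z \<partial>N)"
proof (rule ccontr)
  interpret M: finite_measure M by (rule fin)
  interpret N: finite_measure N by (rule fin)
  let ?m = "measure M (space M) + measure N (space N) + 1"
  \<comment> \<open>Chosen so that an error of e on both measures adds up to less than the gap to be
    refuted; the summand 1 in the denominator makes this strict.\<close>
  define e where "e = \<bar>(\<integral>z. h z \<partial>M) - (\<integral>z. h z \<partial>N)\<bar> / ?m"
  assume "(\<integral>z. h z \<partial>M) \<noteq> (\<integral>z. h z \<partial>N)"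
  moreover have m: "0 < ?m"
    using measure_nonneg[of M "space M"] measure_nonneg[of N "space N"] by linarith
  ultimately have "0 < e" by (simp add: e_def)
  then obtain q where q: "real_polynomial_function q" and
    hq: "\<And>z. z \<in> sphere 0 1 \<Longrightarrow> \<bar>h z - q z\<bar> < e"
    using Stone_Weierstrass_real_polynomial_function[OF compact_sphere continuous_on_subset[OF h]] by blast
  have eq: "(\<integral>z. q z \<partial>M) = (\<integral>z. q z \<partial>N)"
  proof -
    have "same_moments (\<lambda>z. of_real (q z) * 1)"
      by (intro same_moments_real_polynomial q same_moments_one)
    then have "(\<integral>z. z ^ 0 * cnj z ^ 0 * (of_real (q z) * 1) \<partial>M) = (\<integral>z. z ^ 0 * cnj z ^ 0 * (of_real (q z) * 1) \<partial>N)"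
      unfolding same_moments_def by blast
    then have "complex_of_real (\<integral>z. q z \<partial>M) = of_real (\<integral>z. q z \<partial>N)" by simp
    then show ?thesis by simp
  qed
  have close: "\<bar>(\<integral>z. h z \<partial>L) - (\<integral>z. q z \<partial>L)\<bar> \<le> e * measure L (space L)"
    if L: "finite_measure L" "sets L = sets borel" "AE z in L. cmod z = 1" for L
  proof -
    interpret L: finite_measure L by (rule L)
    have int: "integrable L g" if "continuous_on UNIV g" for g :: "complex \<Rightarrow> real"
    proof -
      have "bounded (g ` sphere 0 1)"
        by (intro compact_imp_bounded compact_continuous_image continuous_on_subset[OF that]) auto
      then obtain B where B: "\<And>z. cmod z = 1 \<Longrightarrow> \<bar>g z\<bar> \<le> B"
        unfolding bounded_iff by (metis image_eqI mem_sphere_0 real_norm_def)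
      have "g \<in> borel_measurable L"
        using borel_measurable_continuous_onI[OF that] measurable_cong_sets[OF L(2) refl] by blast
      then show ?thesis
        using L(3) by (intro L.integrable_const_bound[where B=B]) (auto elim: eventually_mono intro: B)
    qed
    have qc: "continuous_on UNIV q"
      by (simp add: q continuous_at_imp_continuous_on continuous_real_polymonial_function)
    have "\<bar>(\<integral>z. h z \<partial>L) - (\<integral>z. q z \<partial>L)\<bar> = \<bar>\<integral>z. h z - q z \<partial>L\<bar>"
      using int[OF h] int[OF qc] by simp
    also have "\<dots> \<le> (\<integral>z. \<bar>h z - q z\<bar> \<partial>L)"
      by (rule integral_abs_bound)
    also have "\<dots> \<le> (\<integral>z. e \<partial>L)"
    proof (rule integral_mono_AE)
      show "AE z in L. \<bar>h z - q z\<bar> \<le> e"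
        using L(3) by eventually_elim (rule less_imp_le, rule hq, simp)
    qed (use int[OF h] int[OF qc] in auto)
    finally show ?thesis by (simp add: mult.commute)
  qed
  have "\<bar>(\<integral>z. h z \<partial>M) - (\<integral>z. h z \<partial>N)\<bar> \<le> e * measure M (space M) + e * measure N (space N)"
    using close[OF fin(1) sets(1) circle(1)] close[OF fin(2) sets(2) circle(2)] eq by linarith
  also have "\<dots> < e * ?m" using \<open>0 < e\<close> by (simp add: algebra_simps)
  also have "\<dots> = \<bar>(\<integral>z. h z \<partial>M) - (\<integral>z. h z \<partial>N)\<bar>"
    using m by (simp add: e_def)
  finally show False by simp
qed

text \<open>Closed sets are stable under intersection and generate the Borel sets, and the measure
  of a closed set is a limit of integrals of continuous functions.\<close>

lemma circle_measure_eqI: "M = N"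
proof -
  interpret M: finite_measure M by (rule fin)
  interpret N: finite_measure N by (rule fin)
  have cl: "measure M C = measure N C" if C: "closed C" for C
  proof (cases "C = {}")
    case False
    \<comment> \<open>Tent functions of slope j around C; they decrease to the indicator of C
      because C is closed.\<close>
    define h where "h j z = max 0 (1 - real j * infdist z C)" for j z
    have hc: "continuous_on UNIV (h j)" for j
      unfolding h_def by (intro continuous_intros)
    have lim: "(\<lambda>j. \<integral>z. h j z \<partial>L) \<longlonglongrightarrow> measure L C"
      if L: "finite_measure L" "sets L = sets borel" for L
    proof -
      interpret L: finite_measure L by (rule L)
      have Cm: "C \<in> sets L" using C L(2) by auto
      have "(\<lambda>j. \<integral>z. h j z \<partial>L) \<longlonglongrightarrow> (\<integral>z. indicator C z \<partial>L)"
      proof (rule integral_dominated_convergence[where w="\<lambda>_. 1"])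
        show "h j \<in> borel_measurable L" for j
          using borel_measurable_continuous_onI[OF hc] measurable_cong_sets[OF L(2) refl] by blast
        show "AE z in L. (\<lambda>j. h j z) \<longlonglongrightarrow> indicator C z"
        proof (rule AE_I2)
          fix z
          show "(\<lambda>j. h j z) \<longlonglongrightarrow> indicator C z"
          proof (cases "z \<in> C")
            case True then show ?thesis by (simp add: h_def)
          next
            case z: False
            then have d: "infdist z C > 0"
              using C False infdist_pos_not_in_closed by blast
            have "\<forall>\<^sub>F j in sequentially. 1 / infdist z C \<le> real j"
              using filterlim_real_sequentially by (simp add: filterlim_at_top)
            then have "\<forall>\<^sub>F j in sequentially. h j z = 0"
              by eventually_elim (use d in \<open>auto simp: h_def field_simps max_def\<close>)
            then show ?thesis using z by (simp add: tendsto_eventually)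
          qed
        qed
        show "AE z in L. norm (h j z) \<le> 1" for j
          by (auto simp: h_def infdist_nonneg)
      qed (use Cm in auto)
      then show ?thesis using Cm by simp
    qed
    show ?thesis
      using lim[OF fin(1) sets(1)] lim[OF fin(2) sets(2)] circle_integral_continuous_eq[OF hc]
      by (simp add: LIMSEQ_unique)
  qed simp
  show ?thesis
  proof (rule measure_eqI_generator_eq[where \<Omega>=UNIV and E="Collect closed" and A="\<lambda>_. UNIV"])
    show "Int_stable (Collect closed :: complex set set)" by (auto simp: Int_stable_def)
    show "emeasure M X = emeasure N X" if "X \<in> Collect closed" for X
      using cl that by (simp add: M.emeasure_eq_measure N.emeasure_eq_measure)
    have "sets (borel :: complex measure) = sigma_sets UNIV (Collect closed)"
      by (simp add: borel_eq_closed)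
    then show "sets M = sigma_sets UNIV (Collect closed)" "sets N = sigma_sets UNIV (Collect closed)"
      using sets by auto
  qed auto
qed

end

lemma integral_distr_density:
  fixes f :: "'c \<Rightarrow> 'd::{banach, second_countable_topology}"
  assumes [measurable]: "\<phi> \<in> M \<rightarrow>\<^sub>M N" "f \<in> borel_measurable N"
    and g: "integrable M g" "\<And>x. 0 \<le> g x"
  shows "(\<integral>z. f z \<partial>distr (density M (\<lambda>x. ennreal (g x))) N \<phi>) = (\<integral>x. g x *\<^sub>R f (\<phi> x) \<partial>M)"
proof -
  have [measurable]: "g \<in> borel_measurable M" using g by auto
  show ?thesis by (subst integral_distr) (auto simp: integral_density g)
qed

lemma distr_density_circle:
  assumes [measurable]: "\<phi> \<in> borel_measurable M" and \<phi>: "\<And>x. x \<in> space M \<Longrightarrow> cmod (\<phi> x) = 1"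
    and g: "integrable M g" "\<And>x. 0 \<le> g x"
  shows "finite_measure (distr (density M (\<lambda>x. ennreal (g x))) borel \<phi>)"
    and "AE z in distr (density M (\<lambda>x. ennreal (g x))) borel \<phi>. cmod z = 1"
proof -
  have [measurable]: "g \<in> borel_measurable M" using g by auto
  have "emeasure (density M (\<lambda>x. ennreal (g x))) (space M) = (\<integral>\<^sup>+x. ennreal (g x) \<partial>M)"
    by (subst emeasure_density) (auto intro!: nn_integral_cong)
  also have "\<dots> \<noteq> \<infinity>"
    using g by (subst nn_integral_eq_integral) auto
  finally have "finite_measure (density M (\<lambda>x. ennreal (g x)))"
    by (intro finite_measureI) simp
  then show "finite_measure (distr (density M (\<lambda>x. ennreal (g x))) borel \<phi>)"
    by (rule finite_measure.finite_measure_distr) simp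
  show "AE z in distr (density M (\<lambda>x. ennreal (g x))) borel \<phi>. cmod z = 1"
    by (subst AE_distr_iff) (auto simp: AE_density \<phi>)
qed

text \<open>The positive and negative parts of h are densities of two measures whose images on the
  circle have the same moments and hence coincide. For real h the coefficients of negative index are
  conjugates of those assumed to vanish.\<close>

lemma circle_fourier_unique_real:
  fixes h :: "'b \<Rightarrow> real"
  assumes [measurable]: "\<phi> \<in> borel_measurable M" and \<phi>: "\<And>x. x \<in> space M \<Longrightarrow> cmod (\<phi> x) = 1"
    and h: "integrable M h"
    and coeff: "\<And>k::nat. (\<integral>x. \<phi> x ^ k * of_real (h x) \<partial>M) = 0"
    and C: "C \<in> sets borel"
  shows "(\<integral>x. indicator C (\<phi> x) * h x \<partial>M) = 0"
proof -
  have [measurable]: "h \<in> borel_measurable M" using h by auto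
  define L where "L g = distr (density M (\<lambda>x. ennreal (g x))) borel \<phi>" for g
  let ?p = "\<lambda>x. max 0 (h x)" and ?n = "\<lambda>x. max 0 (- h x)"
  have pn: "integrable M ?p" "integrable M ?n" using h by auto
  have fin: "finite_measure (L g)" "AE z in L g. cmod z = 1"
    if g: "integrable M g" "\<And>x. 0 \<le> g x" for g
    using that \<phi> unfolding L_def by (intro distr_density_circle; simp)+
  have mom: "(\<integral>z. z ^ k \<partial>L ?p) = (\<integral>z. z ^ k \<partial>L ?n)" for k :: nat
  proof -
    have i: "integrable M (\<lambda>x. g x *\<^sub>R \<phi> x ^ k)" if g: "integrable M g" for g
      by (rule Bochner_Integration.integrable_bound[OF g])
         (use g \<phi> in \<open>auto simp: norm_power\<close>)
    have "(\<integral>x. ?p x *\<^sub>R \<phi> x ^ k \<partial>M) - (\<integral>x. ?n x *\<^sub>R \<phi> x ^ k \<partial>M) = (\<integral>x. ?p x *\<^sub>R \<phi> x ^ k - ?n x *\<^sub>R \<phi> x ^ k \<partial>M)"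
      by (rule Bochner_Integration.integral_diff[symmetric]; intro i pn)
    also have "\<dots> = (\<integral>x. \<phi> x ^ k * of_real (h x) \<partial>M)"
      by (intro Bochner_Integration.integral_cong) (auto simp: max_def scaleR_conv_of_real mult.commute)
    finally show ?thesis
      using coeff[of k] pn by (simp add: L_def integral_distr_density)
  qed
  have "L ?p = L ?n"
    by (rule circle_measure_eqI)
       (use mom fin[OF pn(1)] fin[OF pn(2)] in \<open>auto simp: L_def\<close>)
  then have "(\<integral>z. (indicator C z :: real) \<partial>L ?p) = (\<integral>z. indicator C z \<partial>L ?n)" by (rule arg_cong)
  moreover have "(\<integral>z. (indicator C z :: real) \<partial>L g) = (\<integral>x. g x * indicator C (\<phi> x) \<partial>M)"
    if "integrable M g" "\<And>x. 0 \<le> g x" for g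
    using that C unfolding L_def by (subst integral_distr_density) auto
  ultimately have "(\<integral>x. ?p x * indicator C (\<phi> x) \<partial>M) - (\<integral>x. ?n x * indicator C (\<phi> x) \<partial>M) = 0"
    using pn by simp
  moreover have "(\<integral>x. ?p x * indicator C (\<phi> x) \<partial>M) - (\<integral>x. ?n x * indicator C (\<phi> x) \<partial>M)
      = (\<integral>x. ?p x * indicator C (\<phi> x) - ?n x * indicator C (\<phi> x) \<partial>M)"
    using C by (intro Bochner_Integration.integral_diff[symmetric] Bochner_Integration.integrable_bound[OF pn(1)]
        Bochner_Integration.integrable_bound[OF pn(2)]) (auto split: split_indicator)
  moreover have "\<dots> = (\<integral>x. indicator C (\<phi> x) * h x \<partial>M)"
    by (intro Bochner_Integration.integral_cong) (auto split: split_indicator)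
  ultimately show ?thesis by simp
qed

text \<open>Conjugating the coefficients of negative index gives the coefficients of
  \<open>cnj h\<close>; combining both families yields those of the real and imaginary parts of
  h.\<close>

lemma circle_fourier_unique:
  fixes h :: "'b \<Rightarrow> complex"
  assumes [measurable]: "\<phi> \<in> borel_measurable M" and \<phi>: "\<And>x. x \<in> space M \<Longrightarrow> cmod (\<phi> x) = 1"
    and h: "integrable M h"
    and coeff: "\<And>k::nat. (\<integral>x. \<phi> x ^ k * h x \<partial>M) = 0" "\<And>k::nat. (\<integral>x. cnj (\<phi> x) ^ k * h x \<partial>M) = 0"
    and C: "C \<in> sets borel"
  shows "(\<integral>x. indicator C (\<phi> x) * h x \<partial>M) = 0"
proof -
  have [measurable]: "h \<in> borel_measurable M" using h by auto
  have [measurable]: "cnj \<in> borel_measurable borel"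
    by (intro borel_measurable_continuous_onI continuous_intros)
  have i: "integrable M (\<lambda>x. u x * h x)" "integrable M (\<lambda>x. u x * cnj (h x))"
    if "u \<in> borel_measurable M" "\<And>x. x \<in> space M \<Longrightarrow> cmod (u x) \<le> 1" for u
    using that by (auto intro!: Bochner_Integration.integrable_bound[OF h] AE_I2
        simp: norm_mult mult_left_le_one_le)
  have cn: "(\<integral>x. \<phi> x ^ k * cnj (h x) \<partial>M) = 0" for k
  proof -
    have "(\<integral>x. \<phi> x ^ k * cnj (h x) \<partial>M) = (\<integral>x. cnj (cnj (\<phi> x) ^ k * h x) \<partial>M)" by simp
    also have "\<dots> = cnj (\<integral>x. cnj (\<phi> x) ^ k * h x \<partial>M)"
      by (rule Bochner_Integration.integral_cnj)
    finally show ?thesis by (simp add: coeff)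
  qed
  have ik: "integrable M (\<lambda>x. \<phi> x ^ k * h x)" "integrable M (\<lambda>x. \<phi> x ^ k * cnj (h x))" for k
    by (intro i; auto simp: norm_power \<phi>)+
  have "(\<integral>x. \<phi> x ^ k * of_real (Re (h x)) \<partial>M) = (\<integral>x. (1/2) * (\<phi> x ^ k * h x + \<phi> x ^ k * cnj (h x)) \<partial>M)" for k
    by (intro Bochner_Integration.integral_cong) (auto simp: complex_eq_iff field_simps)
  then have re: "(\<integral>x. \<phi> x ^ k * of_real (Re (h x)) \<partial>M) = 0" for k
    by (simp add: ik coeff cn del: times_divide_eq_left)
  have "(\<integral>x. \<phi> x ^ k * of_real (Im (h x)) \<partial>M) = (\<integral>x. (- \<i>/2) * (\<phi> x ^ k * h x - \<phi> x ^ k * cnj (h x)) \<partial>M)" for k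
    by (intro Bochner_Integration.integral_cong) (auto simp: complex_eq_iff field_simps)
  then have im: "(\<integral>x. \<phi> x ^ k * of_real (Im (h x)) \<partial>M) = 0" for k
    by (simp add: ik coeff cn del: times_divide_eq_left)
  have R: "(\<integral>x. indicator C (\<phi> x) * Re (h x) \<partial>M) = 0" "(\<integral>x. indicator C (\<phi> x) * Im (h x) \<partial>M) = 0"
    by (intro circle_fourier_unique_real; use \<phi> h C re im in auto)+
  have ii: "integrable M (\<lambda>x. indicator C (\<phi> x) * h x)"
    using C by (intro i) (auto split: split_indicator)
  have "Re (indicator C (\<phi> x) * h x) = indicator C (\<phi> x) * Re (h x)"
    "Im (indicator C (\<phi> x) * h x) = indicator C (\<phi> x) * Im (h x)" for x
    by (auto split: split_indicator)
  then show ?thesis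
    using R integral_Re[OF ii] integral_Im[OF ii] by (simp add: complex_eq_iff)
qed

section \<open>Square integrable functions on the unit interval\<close>

definition leb01 :: "real measure" where
  "leb01 = restrict_space lborel {0..<1}"

lemma space_leb01 [simp]: "space leb01 = {0..<1}"
  by (simp add: leb01_def)

lemma sets_leb01: "sets leb01 = sets (restrict_space borel {0..<1})"
  unfolding leb01_def by (rule sets_restrict_space_cong) simp

lemma measurable_leb01:
  "f \<in> M \<rightarrow>\<^sub>M N \<Longrightarrow> sets M = sets borel \<Longrightarrow> f \<in> leb01 \<rightarrow>\<^sub>M N"
  unfolding measurable_cong_sets[OF sets_leb01 refl]
  by (rule measurable_restrict_space1) (simp cong: measurable_cong_sets)

lemma borel_measurable_leb01 [measurable (raw)]:
  "f \<in> borel \<rightarrow>\<^sub>M N \<Longrightarrow> f \<in> leb01 \<rightarrow>\<^sub>M N"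
  by (rule measurable_leb01) auto

lemma finite_measure_leb01: "finite_measure leb01"
  and measure_leb01 [simp]: "measure leb01 {0..<1} = 1"
proof -
  have "emeasure leb01 {0..<1} = 1"
    by (simp add: leb01_def emeasure_restrict_space)
  then show "finite_measure leb01" "measure leb01 {0..<1} = 1"
    by (auto intro!: finite_measureI simp: measure_def)
qed

interpretation leb01: finite_measure leb01
  by (rule finite_measure_leb01)

lemma integral_leb01_const [simp]:
  "(\<integral>x. (c :: 'a::{banach, second_countable_topology}) \<partial>leb01) = c"
  by (simp add: measure_leb01)

lemma integral_leb01:
  fixes f :: "real \<Rightarrow> 'a::{banach, second_countable_topology}"
  shows "(\<integral>x. f x \<partial>leb01) = (\<integral>x. indicator {0..<1} x *\<^sub>R f x \<partial>lborel)"
  unfolding leb01_def by (rule integral_restrict_space) simp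

lemma AE_leb01_neq: "AE x in leb01. x \<noteq> a"
proof -
  have "AE x in lborel. x \<noteq> a"
    by (rule AE_lborel_singleton)
  then show ?thesis
    unfolding leb01_def by (subst AE_restrict_space_iff) auto
qed

lemma cis_2pi_inj:
  assumes "cis (2 * pi * s) = cis (2 * pi * t)" "s \<in> {0..<1}" "t \<in> {0..<1}"
  shows "s = t"
proof -
  have "\<bar>s - t\<bar> < 1" using assms by auto
  then have "\<bar>2 * pi * s - 2 * pi * t\<bar> < 2 * pi"
    unfolding right_diff_distrib[symmetric] abs_mult by simp
  then have "\<bar>Im (\<i> * complex_of_real (2 * pi * s)) - Im (\<i> * complex_of_real (2 * pi * t))\<bar> < 2 * pi"
    by (simp only: Im_i_times Re_complex_of_real)
  moreover have "exp (\<i> * complex_of_real (2 * pi * s)) = exp (\<i> * complex_of_real (2 * pi * t))"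
    using assms(1) unfolding cis_conv_exp .
  ultimately have "\<i> * complex_of_real (2 * pi * s) = \<i> * complex_of_real (2 * pi * t)"
    by (rule exp_complex_eqI)
  then show ?thesis by simp
qed

text \<open>Arcs beginning at the point 1 play the role of half-lines: they are closed, and an
  increasing parametrisation by [0,1) turns \<open>x \<le> a\<close> into membership in an
  arc.\<close>

definition circle_arc :: "real \<Rightarrow> complex set" where
  "circle_arc a = (\<lambda>t. cis (2 * pi * t)) ` {0..a}"

lemma closed_arc: "closed (circle_arc a)"
  unfolding circle_arc_def
  by (intro compact_imp_closed compact_continuous_image continuous_intros) auto

lemma cis_in_arc_iff:
  assumes "t \<in> {0..<1}" "a < 1"
  shows "cis (2 * pi * t) \<in> circle_arc a \<longleftrightarrow> t \<le> a"
proof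
  assume "cis (2 * pi * t) \<in> circle_arc a"
  then obtain s where s: "cis (2 * pi * t) = cis (2 * pi * s)" "0 \<le> s" "s \<le> a"
    by (auto simp: circle_arc_def)
  then have "t = s" using assms by (intro cis_2pi_inj) auto
  then show "t \<le> a" using s by simp
qed (use assms in \<open>auto simp: circle_arc_def\<close>)

lemma strict_mono_measurable:
  assumes "strict_mono_on {0..<1} (\<psi> :: real \<Rightarrow> real)"
  shows "\<psi> \<in> borel_measurable leb01"
  using borel_measurable_mono_on_fnc[OF strict_mono_on_imp_mono_on[OF assms]]
    measurable_cong_sets[OF sets_leb01 refl] by blast

lemma measurable_cis [measurable]: "cis \<in> borel_measurable borel"
  by (intro borel_measurable_continuous_onI continuous_intros)

lemma measurable_cnj [measurable]: "cnj \<in> borel_measurable borel"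
  by (intro borel_measurable_continuous_onI continuous_intros)

text \<open>Half-lines form an intersection-stable generator of the Borel sets, so a Dynkin argument
  extends the vanishing of the integral to all Borel sets.\<close>

lemma integral_indicator_zero_imp_AE:
  fixes h :: "real \<Rightarrow> complex"
  assumes h: "integrable leb01 h"
    and zero: "\<And>a. (\<integral>x. indicator {..a} x *\<^sub>R h x \<partial>leb01) = 0"
  shows "AE x in leb01. h x = 0"
proof (rule leb01.density_zero[OF h])
  have hi: "integrable leb01 (\<lambda>x. indicator A x *\<^sub>R h x)" if "A \<in> sets borel" for A
    using that h by (intro Bochner_Integration.integrable_bound[OF h]) (auto split: split_indicator)
  have borel: "(\<integral>x. indicator A x *\<^sub>R h x \<partial>leb01) = 0" if "A \<in> sets borel" for A
  proof -
    have tot: "(\<integral>x. h x \<partial>leb01) = 0"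
    proof -
      have "(\<integral>x. h x \<partial>leb01) = (\<integral>x. indicator {..1} x *\<^sub>R h x \<partial>leb01)"
        by (intro Bochner_Integration.integral_cong) auto
      then show ?thesis by (simp add: zero)
    qed
    have "Int_stable (range atMost :: real set set)" by (auto simp: Int_stable_def)
    moreover have "range atMost \<subseteq> Pow (UNIV :: real set)" by simp
    moreover have "A \<in> sigma_sets UNIV (range atMost)"
      using that by (simp add: borel_eq_atMost)
    ultimately show ?thesis
    proof (induction rule: sigma_sets_induct_disjoint)
      case (compl A)
      then have A: "A \<in> sets borel" by (simp add: borel_eq_atMost)
      have "(\<integral>x. indicator (UNIV - A) x *\<^sub>R h x \<partial>leb01) = (\<integral>x. h x - indicator A x *\<^sub>R h x \<partial>leb01)"
        by (intro Bochner_Integration.integral_cong) (auto split: split_indicator)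
      then show ?case using compl tot h hi[OF A] by simp
    next
      case (union A)
      then have A: "A i \<in> sets borel" for i by (auto simp: borel_eq_atMost)
      \<comment> \<open>Cutting the sets to [0,1) makes them measurable for \<open>leb01\<close>, as
        countable additivity requires.\<close>
      let ?A = "\<lambda>i. {0..<1} \<inter> A i"
      have "(\<integral>x. indicator (\<Union>i. A i) x *\<^sub>R h x \<partial>leb01) = (LINT x:(\<Union>i. ?A i)|leb01. h x)"
        unfolding set_lebesgue_integral_def
        by (intro Bochner_Integration.integral_cong) (auto split: split_indicator)
      also have "\<dots> = (\<Sum>i. LINT x:?A i|leb01. h x)"
      proof (rule lebesgue_integral_countable_add)
        show "?A i \<in> sets leb01" for i
          unfolding sets_leb01 sets_restrict_space using A by blast
        show "?A i \<inter> ?A j = {}" if "i \<noteq> j" for i j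
          using union(1) that by (auto simp: disjoint_family_on_def)
        have "{0..<1} \<inter> (\<Union>i. A i) \<in> sets borel" using A by auto
        from hi[OF this] show "set_integrable leb01 (\<Union>i. ?A i) h"
          by (simp add: set_integrable_def)
      qed
      also have "(\<lambda>i. LINT x:?A i|leb01. h x) = (\<lambda>i. 0)"
      proof
        fix i
        have "(LINT x:?A i|leb01. h x) = (\<integral>x. indicator (A i) x *\<^sub>R h x \<partial>leb01)"
          unfolding set_lebesgue_integral_def
          by (intro Bochner_Integration.integral_cong) (auto split: split_indicator)
        then show "(LINT x:?A i|leb01. h x) = 0" using union by simp
      qed
      finally show ?case by simp
    qed (use zero in auto)
  qed
  show "set_lebesgue_integral leb01 A h = 0" if "A \<in> sets leb01" for A
  proof -
    have "A \<in> sets borel" using that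
      unfolding sets_leb01 by (subst (asm) sets_restrict_space_iff) auto
    then show ?thesis using borel by (simp add: set_lebesgue_integral_def)
  qed
qed

text \<open>The circle only sees h through the sigma-algebra generated by \<psi>. Strict
  monotonicity makes this the full Borel algebra, since every initial segment of [0,1) is the
  preimage of an arc.\<close>

lemma strict_mono_fourier_unique:
  fixes h :: "real \<Rightarrow> complex"
  assumes \<psi>: "strict_mono_on {0..<1} \<psi>" "\<And>x. x \<in> {0..<1} \<Longrightarrow> \<psi> x \<in> {0..<1}"
    and h: "integrable leb01 h"
    and coeff: "\<And>k::nat. (\<integral>x. cis (2 * pi * \<psi> x) ^ k * h x \<partial>leb01) = 0"
      "\<And>k::nat. (\<integral>x. cnj (cis (2 * pi * \<psi> x)) ^ k * h x \<partial>leb01) = 0"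
  shows "AE x in leb01. h x = 0"
proof (rule integral_indicator_zero_imp_AE[OF h])
  fix a :: real
  note [measurable] = strict_mono_measurable[OF \<psi>(1)]
  \<comment> \<open>Outside [0,1) the value \<open>\<psi> a\<close> says nothing, so the arc is
    replaced by the empty set on the left and by the whole plane on the right.\<close>
  define C where "C = (if a < 0 then {} else if a < 1 then circle_arc (\<psi> a) else UNIV)"
  have "C \<in> sets borel" unfolding C_def by (auto simp: closed_arc)
  then have "(\<integral>x. indicator C (cis (2 * pi * \<psi> x)) * h x \<partial>leb01) = 0"
    by (intro circle_fourier_unique h coeff) auto
  moreover have "cis (2 * pi * \<psi> x) \<in> C \<longleftrightarrow> x \<le> a" if x: "x \<in> {0..<1}" for x
  proof (cases "a \<in> {0..<1}")
    case True
    then have "cis (2 * pi * \<psi> x) \<in> C \<longleftrightarrow> \<psi> x \<le> \<psi> a"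
      using \<psi>(2)[OF x] \<psi>(2)[OF True] by (simp add: C_def cis_in_arc_iff)
    then show ?thesis using \<psi>(1) x True by (simp add: strict_mono_on_less_eq)
  qed (use x in \<open>auto simp: C_def\<close>)
  ultimately show "(\<integral>x. indicator {..a} x *\<^sub>R h x \<partial>leb01) = 0"
    by (subst (asm) Bochner_Integration.integral_cong[where g="\<lambda>x. indicator {..a} x *\<^sub>R h x", OF refl])
       (auto simp: indicator_def)
qed

text \<open>Functions are kept as representatives; equality up to null sets is absorbed later by the
  map G into the Hilbert space.\<close>

definition sqint :: "(real \<Rightarrow> complex) \<Rightarrow> bool" where
  "sqint f \<longleftrightarrow> f \<in> borel_measurable leb01 \<and> integrable leb01 (\<lambda>x. (cmod (f x))\<^sup>2)"

lemma sqint_measurable: "sqint f \<Longrightarrow> f \<in> borel_measurable leb01"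
  by (simp add: sqint_def)

lemma sqint_mult_integrable:
  assumes "sqint f" "sqint g" shows "integrable leb01 (\<lambda>x. f x * g x)"
proof (rule Bochner_Integration.integrable_bound)
  show "integrable leb01 (\<lambda>x. (cmod (f x))\<^sup>2 + (cmod (g x))\<^sup>2)"
    using assms by (simp add: sqint_def)
  show "(\<lambda>x. f x * g x) \<in> borel_measurable leb01"
    using assms by (auto simp: sqint_def)
  have "a * b \<le> a\<^sup>2 + b\<^sup>2" for a b :: real
  proof -
    have "2 * (a * b) \<le> a\<^sup>2 + b\<^sup>2" using sum_squares_bound[of a b] by simp
    moreover have "0 \<le> a\<^sup>2 + b\<^sup>2" by simp
    ultimately show ?thesis by linarith
  qed
  then show "AE x in leb01. cmod (f x * g x) \<le> norm ((cmod (f x))\<^sup>2 + (cmod (g x))\<^sup>2)"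
    by (auto simp: norm_mult)
qed

lemma sqint_bounded_mult:
  assumes "sqint f" "m \<in> borel_measurable leb01" "\<And>x. x \<in> {0..<1} \<Longrightarrow> cmod (m x) \<le> B"
  shows "sqint (\<lambda>x. m x * f x)"
  unfolding sqint_def
proof
  have [measurable]: "f \<in> borel_measurable leb01" "m \<in> borel_measurable leb01"
    using assms by (auto simp: sqint_def)
  show "(\<lambda>x. m x * f x) \<in> borel_measurable leb01" by measurable
  show "integrable leb01 (\<lambda>x. (cmod (m x * f x))\<^sup>2)"
  proof (rule Bochner_Integration.integrable_bound)
    show "integrable leb01 (\<lambda>x. B\<^sup>2 * (cmod (f x))\<^sup>2)"
      using assms by (simp add: sqint_def)
    show "AE x in leb01. norm ((cmod (m x * f x))\<^sup>2) \<le> norm (B\<^sup>2 * (cmod (f x))\<^sup>2)"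
      using assms(3) by (auto simp: norm_mult power_mult_distrib intro!: mult_right_mono power_mono)
  qed measurable
qed

lemma sqint_bounded:
  assumes "m \<in> borel_measurable leb01" "\<And>x. x \<in> {0..<1} \<Longrightarrow> cmod (m x) \<le> B"
  shows "sqint m"
  using sqint_bounded_mult[of "\<lambda>_. 1" m B] assms by (simp add: sqint_def)

lemma sqint_add:
  assumes "sqint f" "sqint g" shows "sqint (\<lambda>x. f x + g x)"
  unfolding sqint_def
proof
  have [measurable]: "f \<in> borel_measurable leb01" "g \<in> borel_measurable leb01"
    using assms by (auto simp: sqint_def)
  show "(\<lambda>x. f x + g x) \<in> borel_measurable leb01" by measurable
  show "integrable leb01 (\<lambda>x. (cmod (f x + g x))\<^sup>2)"
  proof (rule Bochner_Integration.integrable_bound)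
    show "integrable leb01 (\<lambda>x. 2 * (cmod (f x))\<^sup>2 + 2 * (cmod (g x))\<^sup>2)"
      using assms by (simp add: sqint_def)
    have "(cmod (u + v))\<^sup>2 \<le> 2 * (cmod u)\<^sup>2 + 2 * (cmod v)\<^sup>2" for u v
    proof -
      have "(cmod (u + v))\<^sup>2 \<le> (cmod u + cmod v)\<^sup>2"
        by (intro power_mono norm_triangle_ineq) auto
      also have "\<dots> \<le> 2 * (cmod u)\<^sup>2 + 2 * (cmod v)\<^sup>2"
        using sum_squares_bound[of "cmod u" "cmod v"] by (simp add: power2_sum)
      finally show ?thesis .
    qed
    then show "AE x in leb01. norm ((cmod (f x + g x))\<^sup>2) \<le> norm (2 * (cmod (f x))\<^sup>2 + 2 * (cmod (g x))\<^sup>2)"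
      by auto
  qed measurable
qed

lemma sqint_cmult: "sqint f \<Longrightarrow> sqint (\<lambda>x. c * f x)"
  by (rule sqint_bounded_mult[where B="cmod c"]) auto

lemma sqint_cnj: "sqint f \<Longrightarrow> sqint (\<lambda>x. cnj (f x))"
  by (auto simp: sqint_def)

lemma sqint_diff: "sqint f \<Longrightarrow> sqint g \<Longrightarrow> sqint (\<lambda>x. f x - g x)"
  using sqint_add[of f "\<lambda>x. -1 * g x"] sqint_cmult[of g "-1"] by simp

lemma sqint_sum: "(\<And>i. i \<in> A \<Longrightarrow> sqint (f i)) \<Longrightarrow> sqint (\<lambda>x. \<Sum>i\<in>A. f i x)"
proof (induction A rule: infinite_finite_induct)
  case (insert i A)
  then show ?case by (simp add: sqint_add)
qed (auto simp: sqint_def)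

lemma sqint_integrable: "sqint f \<Longrightarrow> integrable leb01 f"
  using sqint_mult_integrable[of f "\<lambda>_. 1"] by (simp add: sqint_def)

lemma sqint_cong_AE:
  assumes "sqint f" "g \<in> borel_measurable leb01" "AE x in leb01. f x = g x"
  shows "sqint g"
proof -
  have [measurable]: "f \<in> borel_measurable leb01" "g \<in> borel_measurable leb01"
    using assms by (auto simp: sqint_def)
  have "integrable leb01 (\<lambda>x. (cmod (f x))\<^sup>2) \<longleftrightarrow> integrable leb01 (\<lambda>x. (cmod (g x))\<^sup>2)"
    using assms(3) by (intro integrable_cong_AE) auto
  then show ?thesis using assms by (simp add: sqint_def)
qed

text \<open>The sum of the series has finite integral by monotone convergence, hence is finite
  almost everywhere. Used for the completeness of the space and for the law of large
  numbers.\<close>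

lemma AE_summable_of_summable_integral:
  fixes u :: "nat \<Rightarrow> 'b \<Rightarrow> real"
  assumes int: "\<And>k. integrable M (u k)" and nonneg: "\<And>k x. 0 \<le> u k x"
    and le: "\<And>k. (\<integral>x. u k x \<partial>M) \<le> a k" and a: "summable a"
  shows "AE x in M. summable (\<lambda>k. u k x)"
proof -
  have [measurable]: "u k \<in> borel_measurable M" for k using int by auto
  have a0: "0 \<le> a k" for k
    using le[of k] Bochner_Integration.integral_nonneg[of M "u k"] nonneg by fastforce
  have "(\<integral>\<^sup>+x. (\<Sum>k. ennreal (u k x)) \<partial>M) = (\<Sum>k. \<integral>\<^sup>+x. ennreal (u k x) \<partial>M)"
    by (rule nn_integral_suminf) measurable
  also have "\<dots> \<le> (\<Sum>k. ennreal (a k))"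
  proof (rule suminf_le)
    fix k
    have "(\<integral>\<^sup>+x. ennreal (u k x) \<partial>M) = ennreal (\<integral>x. u k x \<partial>M)"
      using int nonneg by (intro nn_integral_eq_integral) auto
    then show "(\<integral>\<^sup>+x. ennreal (u k x) \<partial>M) \<le> ennreal (a k)"
      using le[of k] by (simp add: ennreal_leI)
  qed auto
  also have "\<dots> = ennreal (\<Sum>k. a k)"
    using a a0 by (intro suminf_ennreal2) auto
  finally have "(\<integral>\<^sup>+x. (\<Sum>k. ennreal (u k x)) \<partial>M) \<noteq> \<infinity>"
    by (metis ennreal_neq_top infinity_ennreal_def neq_top_trans)
  then have "AE x in M. (\<Sum>k. ennreal (u k x)) \<noteq> \<infinity>"
    by (intro nn_integral_PInf_AE) measurable
  then show ?thesis
    by eventually_elim (use nonneg in \<open>auto intro!: summable_suminf_not_top\<close>)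
qed

text \<open>The limit is obtained pointwise almost everywhere along a rapidly converging subsequence.\<close>

lemma sqint_complete:
  fixes f :: "nat \<Rightarrow> real \<Rightarrow> complex"
  assumes f: "\<And>n. sqint (f n)"
    and cauchy: "\<And>\<epsilon>. 0 < \<epsilon> \<Longrightarrow> \<exists>N. \<forall>m\<ge>N. \<forall>n\<ge>N. (\<integral>x. (cmod (f m x - f n x))\<^sup>2 \<partial>leb01) < \<epsilon>"
  shows "\<exists>g. sqint g \<and> (\<lambda>n. \<integral>x. (cmod (f n x - g x))\<^sup>2 \<partial>leb01) \<longlonglongrightarrow> 0"
proof -
  have [measurable]: "f n \<in> borel_measurable leb01" for n
    using f by (simp add: sqint_def)
  have int: "integrable leb01 (\<lambda>x. (cmod (f m x - f n x))\<^sup>2)" for m n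
    using sqint_diff[OF f f, of m n] by (simp add: sqint_def)
  have "\<exists>N. \<forall>m\<ge>N. \<forall>n\<ge>N. (\<integral>x. (cmod (f m x - f n x))\<^sup>2 \<partial>leb01) < (1/4) ^ k" for k :: nat
    by (rule cauchy) simp
  then obtain N where N: "\<And>k m n. N k \<le> m \<Longrightarrow> N k \<le> n \<Longrightarrow> (\<integral>x. (cmod (f m x - f n x))\<^sup>2 \<partial>leb01) < (1/4) ^ k"
    by metis
  \<comment> \<open>Summing all earlier thresholds makes the subsequence monotone and at least
    \<open>N k\<close> at stage k, and the summand k makes it tend to infinity.\<close>
  define r where "r k = k + (\<Sum>i\<le>k. N i)" for k
  have rN: "N k \<le> r k" "k \<le> r k" "r k \<le> r (Suc k)" for k
    using member_le_sum[of k "{..k}" N] by (auto simp: r_def)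
  define d where "d k x = f (r (Suc k)) x - f (r k) x" for k x
  have [measurable]: "d k \<in> borel_measurable leb01" for k
    unfolding d_def by measurable
  have sd: "sqint (d k)" for k unfolding d_def by (intro sqint_diff f)
  have dI: "(\<integral>x. cmod (d k x) \<partial>leb01) \<le> (1/2) ^ k" for k
  proof -
    \<comment> \<open>The weight \<open>2 ^ k\<close> balances the elementary inequality so that a
      bound \<open>(1/4) ^ k\<close> on the square integral becomes a bound \<open>(1/2) ^ k\<close>
      on the integral.\<close>
    have "(\<integral>x. cmod (d k x) \<partial>leb01) \<le> (\<integral>x. 2 ^ k / 2 * (cmod (d k x))\<^sup>2 + (1/2) ^ k / 2 \<partial>leb01)"
    proof (rule integral_mono)
      show "integrable leb01 (\<lambda>x. cmod (d k x))"
        using sqint_integrable[OF sd] by auto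
      show "integrable leb01 (\<lambda>x. 2 ^ k / 2 * (cmod (d k x))\<^sup>2 + (1/2) ^ k / 2)"
        using sd by (auto simp: sqint_def)
      fix x
      have "0 \<le> (2 ^ k * cmod (d k x) - 1)\<^sup>2" by simp
      then show "cmod (d k x) \<le> 2 ^ k / 2 * (cmod (d k x))\<^sup>2 + (1/2) ^ k / 2"
        by (simp add: power2_diff field_simps power2_eq_square)
    qed
    also have "\<dots> = 2 ^ k / 2 * (\<integral>x. (cmod (d k x))\<^sup>2 \<partial>leb01) + (1/2) ^ k / 2"
      using sd by (subst Bochner_Integration.integral_add) (auto simp: sqint_def)
    also have "\<dots> \<le> 2 ^ k / 2 * (1/4) ^ k + (1/2) ^ k / 2"
    proof (intro add_right_mono mult_left_mono)
      show "(\<integral>x. (cmod (d k x))\<^sup>2 \<partial>leb01) \<le> (1/4) ^ k"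
        unfolding d_def using rN(1,3)[of k] by (intro less_imp_le[OF N]) auto
    qed simp
    also have "\<dots> = (1/2) ^ k"
      by (simp add: field_simps flip: power_mult_distrib)
    finally show ?thesis .
  qed
  have "AE x in leb01. summable (\<lambda>k. cmod (d k x))"
    by (rule AE_summable_of_summable_integral[where a="\<lambda>k. (1/2) ^ k"])
       (use dI sqint_integrable[OF sd] in \<open>auto intro: summable_geometric\<close>)
  then have conv: "AE x in leb01. convergent (\<lambda>k. f (r k) x)"
  proof eventually_elim
    case (elim x)
    then have "summable (\<lambda>k. d k x)" by (rule summable_norm_cancel)
    then have "convergent (\<lambda>n. \<Sum>k<n. d k x)"
      by (simp add: summable_iff_convergent)
    then have "convergent (\<lambda>n. (\<Sum>k<n. d k x) + f (r 0) x)"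
      by (intro convergent_add convergent_const)
    moreover have "(\<Sum>k<n. d k x) + f (r 0) x = f (r n) x" for n
      using sum_lessThan_telescope[of "\<lambda>k. f (r k) x" n] by (simp add: d_def)
    ultimately show ?case by simp
  qed
  define g where "g x = lim (\<lambda>k. f (r k) x)" for x
  have [measurable]: "g \<in> borel_measurable leb01"
    unfolding g_def by measurable
  \<comment> \<open>Fatou's lemma along the subsequence carries the Cauchy bound over to the limit,
    and yields square integrability of the difference at the same time.\<close>
  have bound: "sqint (\<lambda>x. f m x - g x) \<and> (\<integral>x. (cmod (f m x - g x))\<^sup>2 \<partial>leb01) \<le> \<epsilon>"
    if \<epsilon>: "0 < \<epsilon>" and M: "\<And>m n. M \<le> m \<Longrightarrow> M \<le> n \<Longrightarrow> (\<integral>x. (cmod (f m x - f n x))\<^sup>2 \<partial>leb01) < \<epsilon>"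
      and m: "M \<le> m" for \<epsilon> M m
  proof -
    have "(\<integral>\<^sup>+x. ennreal ((cmod (f m x - g x))\<^sup>2) \<partial>leb01)
       = (\<integral>\<^sup>+x. liminf (\<lambda>k. ennreal ((cmod (f m x - f (r k) x))\<^sup>2)) \<partial>leb01)"
    proof (rule nn_integral_cong_AE, use conv in eventually_elim)
      case (elim x)
      then have "(\<lambda>k. f (r k) x) \<longlonglongrightarrow> g x" by (simp add: g_def convergent_LIMSEQ_iff)
      then have "(\<lambda>k. ennreal ((cmod (f m x - f (r k) x))\<^sup>2)) \<longlonglongrightarrow> ennreal ((cmod (f m x - g x))\<^sup>2)"
        by (intro tendsto_intros)
      then show ?case by (rule lim_imp_Liminf[OF trivial_limit_sequentially, symmetric])
    qed
    also have "\<dots> \<le> liminf (\<lambda>k. \<integral>\<^sup>+x. ennreal ((cmod (f m x - f (r k) x))\<^sup>2) \<partial>leb01)"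
      by (rule nn_integral_liminf) measurable
    also have "\<dots> \<le> limsup (\<lambda>k. \<integral>\<^sup>+x. ennreal ((cmod (f m x - f (r k) x))\<^sup>2) \<partial>leb01)"
      by (rule Liminf_le_Limsup) simp
    also have "\<dots> \<le> ennreal \<epsilon>"
    proof (rule Limsup_bounded, rule eventually_sequentiallyI[of M])
      fix k assume "M \<le> k"
      then have "M \<le> r k" using rN(2) order_trans by blast
      then have "(\<integral>x. (cmod (f m x - f (r k) x))\<^sup>2 \<partial>leb01) \<le> \<epsilon>"
        using M[OF m, of "r k"] by simp
      then show "(\<integral>\<^sup>+x. ennreal ((cmod (f m x - f (r k) x))\<^sup>2) \<partial>leb01) \<le> ennreal \<epsilon>"
        using int by (subst nn_integral_eq_integral) (auto intro: ennreal_leI)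
    qed
    finally have le: "(\<integral>\<^sup>+x. ennreal ((cmod (f m x - g x))\<^sup>2) \<partial>leb01) \<le> ennreal \<epsilon>" .
    have "(\<integral>\<^sup>+x. ennreal ((cmod (f m x - g x))\<^sup>2) \<partial>leb01) < \<infinity>"
      using le by (metis ennreal_less_top infinity_ennreal_def order_le_less_trans)
    then have i: "integrable leb01 (\<lambda>x. (cmod (f m x - g x))\<^sup>2)"
      by (intro integrableI_nonneg) auto
    then have "ennreal (\<integral>x. (cmod (f m x - g x))\<^sup>2 \<partial>leb01) \<le> ennreal \<epsilon>"
      using le by (subst (asm) nn_integral_eq_integral) auto
    then show ?thesis using i \<epsilon> by (simp add: sqint_def ennreal_le_iff)
  qed
  have "sqint g"
  proof -
    have "sqint (\<lambda>x. f (N 0) x - g x)"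
      using bound[of "(1/4) ^ 0" "N 0" "N 0"] N[of 0] by simp
    from sqint_diff[OF f this, of "N 0"] show ?thesis by simp
  qed
  moreover have "(\<lambda>n. \<integral>x. (cmod (f n x - g x))\<^sup>2 \<partial>leb01) \<longlonglongrightarrow> 0"
  proof (rule LIMSEQ_I)
    fix \<epsilon> :: real assume \<epsilon>: "0 < \<epsilon>"
    then obtain M where M: "\<And>m n. M \<le> m \<Longrightarrow> M \<le> n \<Longrightarrow> (\<integral>x. (cmod (f m x - f n x))\<^sup>2 \<partial>leb01) < \<epsilon> / 2"
      using cauchy[of "\<epsilon> / 2"] by auto
    have "norm ((\<integral>x. (cmod (f n x - g x))\<^sup>2 \<partial>leb01) - 0) < \<epsilon>" if "M \<le> n" for n
      using bound[of "\<epsilon> / 2" M n] M that \<epsilon> by auto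
    then show "\<exists>no. \<forall>n\<ge>no. norm ((\<integral>x. (cmod (f n x - g x))\<^sup>2 \<partial>leb01) - 0) < \<epsilon>" by blast
  qed
  ultimately show ?thesis by blast
qed

section \<open>Fourier series\<close>

text \<open>The integer frequencies are enumerated by \<open>int_decode\<close>, so that the basis
  is a sequence over nat like the orthonormal sequences in the Hilbert space.\<close>

definition fourier_basis :: "nat \<Rightarrow> real \<Rightarrow> complex" where
  "fourier_basis k y = cis (2 * pi * y * of_int (int_decode k))"

lemma fourier_basis_measurable [measurable]: "fourier_basis k \<in> borel_measurable leb01"
  unfolding fourier_basis_def by measurable

lemma sqint_fourier_basis: "sqint (fourier_basis k)"
  by (rule sqint_bounded[where B=1]) (auto simp: fourier_basis_def)

lemma integral_cis_unit:
  fixes m :: int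
  shows "(\<integral>y. cis (2 * pi * y * of_int m) \<partial>leb01) = (if m = 0 then 1 else 0)"
proof (cases "m = 0")
  case False
  define c where "c = 2 * pi * real_of_int m"
  have c: "c \<noteq> 0" using False by (simp add: c_def)
  have eq: "cis (2 * pi * y * of_int m) = cis (c * y)" for y
    by (simp add: c_def mult_ac)
  have "(\<integral>y. cis (c * y) \<partial>leb01) = (\<integral>y. indicator {0..1} y *\<^sub>R cis (c * y) \<partial>lborel)"
    unfolding integral_leb01
    by (rule integral_cong_AE) (use AE_lborel_singleton[of 1] in \<open>auto elim!: eventually_mono split: split_indicator\<close>)
  also have "\<dots> = cis (c * 1) / (\<i> * c) - cis (c * 0) / (\<i> * c)"
  proof (rule integral_FTC_atLeastAtMost)
    fix y
    have "((\<lambda>y. exp (\<i> * of_real (c * y)) / (\<i> * c)) has_vector_derivative exp (\<i> * of_real (c * y))) (at y within {0..1})"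
      using c by (auto intro!: derivative_eq_intros has_vector_derivative_real_field simp: field_simps)
    then show "((\<lambda>y. cis (c * y) / (\<i> * c)) has_vector_derivative cis (c * y)) (at y within {0..1})"
      by (simp only: cis_conv_exp)
  qed (auto intro!: continuous_intros)
  also have "\<dots> = 0"
    unfolding c_def by (simp add: cis_multiple_2pi)
  finally show ?thesis using False by (simp add: eq)
qed simp

lemma fourier_basis_orthonormal:
  "(\<integral>y. fourier_basis j y * cnj (fourier_basis k y) \<partial>leb01) = (if j = k then 1 else 0)"
proof -
  have "fourier_basis j y * cnj (fourier_basis k y) = cis (2 * pi * y * of_int (int_decode j - int_decode k))" for y
    unfolding fourier_basis_def cis_cnj cis_mult by (simp add: algebra_simps)
  then show ?thesis
    using integral_cis_unit[of "int_decode j - int_decode k"] inj_int_decode[of UNIV]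
    by (auto simp: inj_eq)
qed

definition fourier_coeff :: "(real \<Rightarrow> complex) \<Rightarrow> nat \<Rightarrow> complex" where
  "fourier_coeff f k = (\<integral>y. f y * cnj (fourier_basis k y) \<partial>leb01)"

lemma fourier_coeff_integrable:
  "sqint f \<Longrightarrow> integrable leb01 (\<lambda>y. f y * cnj (fourier_basis k y))"
  by (intro sqint_mult_integrable sqint_cnj sqint_fourier_basis)

lemma fourier_coeff_add:
  "sqint f \<Longrightarrow> sqint g \<Longrightarrow> fourier_coeff (\<lambda>y. f y + g y) k = fourier_coeff f k + fourier_coeff g k"
  by (simp add: fourier_coeff_def distrib_right fourier_coeff_integrable)

lemma fourier_coeff_diff:
  "sqint f \<Longrightarrow> sqint g \<Longrightarrow> fourier_coeff (\<lambda>y. f y - g y) k = fourier_coeff f k - fourier_coeff g k"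
  by (simp add: fourier_coeff_def left_diff_distrib fourier_coeff_integrable)

lemma fourier_coeff_cmult: "fourier_coeff (\<lambda>y. c * f y) k = c * fourier_coeff f k"
  by (simp add: fourier_coeff_def mult.assoc)

text \<open>This is \<open>strict_mono_fourier_unique\<close> for the identity parametrisation of
  the circle.\<close>

lemma fourier_coeff_eq_zero_imp:
  assumes "sqint f" "\<And>k. fourier_coeff f k = 0"
  shows "AE y in leb01. f y = 0"
proof (rule strict_mono_fourier_unique[where \<psi>="\<lambda>y. y"])
  fix k :: nat
  have m: "(\<integral>y. cis (2 * pi * y * of_int m) * f y \<partial>leb01) = 0" for m :: int
  proof -
    have "(\<integral>y. cis (2 * pi * y * of_int m) * f y \<partial>leb01) = fourier_coeff f (int_encode (- m))"
      unfolding fourier_coeff_def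
      by (intro Bochner_Integration.integral_cong) (auto simp: fourier_basis_def cis_cnj mult.commute)
    then show ?thesis by (simp add: assms)
  qed
  show "(\<integral>x. cis (2 * pi * x) ^ k * f x \<partial>leb01) = 0"
  proof -
    have "cis (2 * pi * x) ^ k = cis (2 * pi * x * of_int (int k))" for x
      by (simp only: Complex.DeMoivre of_int_of_nat_eq mult_ac)
    then show ?thesis using m[of "int k"] by simp
  qed
  show "(\<integral>x. cnj (cis (2 * pi * x)) ^ k * f x \<partial>leb01) = 0"
  proof -
    have "cnj (cis (2 * pi * x)) ^ k = cis (2 * pi * x * of_int (- int k))" for x
      unfolding cis_cnj Complex.DeMoivre by (simp add: mult_ac)
    then show ?thesis using m[of "- int k"] by simp
  qed
qed (use assms in \<open>auto simp: strict_mono_on_def sqint_integrable\<close>)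

lemma sqint_fourier_sum: "sqint (\<lambda>y. \<Sum>k\<in>A. c k * fourier_basis k y)"
  by (intro sqint_sum sqint_cmult sqint_fourier_basis)

lemma fourier_coeff_fourier_sum:
  assumes "finite A"
  shows "fourier_coeff (\<lambda>y. \<Sum>j\<in>A. c j * fourier_basis j y) k = (if k \<in> A then c k else 0)"
proof -
  have "fourier_coeff (\<lambda>y. \<Sum>j\<in>A. c j * fourier_basis j y) k
      = (\<integral>y. (\<Sum>j\<in>A. c j * (fourier_basis j y * cnj (fourier_basis k y))) \<partial>leb01)"
    unfolding fourier_coeff_def
    by (intro Bochner_Integration.integral_cong) (auto simp: sum_distrib_right mult.assoc)
  also have "\<dots> = (\<Sum>j\<in>A. c j * (if j = k then 1 else 0))"
    using fourier_coeff_integrable[OF sqint_fourier_basis]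
    by (subst Bochner_Integration.integral_sum) (auto simp: fourier_basis_orthonormal)
  also have "\<dots> = (\<Sum>j\<in>A. if j = k then c k else 0)" by (intro sum.cong) auto
  finally show ?thesis using assms by simp
qed

text \<open>The partial sum is the orthogonal projection of f, so this is Pythagoras. The norm of a
  finite sum, Bessel's inequality, the bound on a single coefficient and the Parseval identity of
  \<open>riesz_fischer\<close> are all read off from it.\<close>

lemma norm_diff_fourier_sum:
  assumes f: "sqint f" and A: "finite A"
  shows "(\<integral>y. (cmod (f y - (\<Sum>k\<in>A. fourier_coeff f k * fourier_basis k y)))\<^sup>2 \<partial>leb01)
    = (\<integral>y. (cmod (f y))\<^sup>2 \<partial>leb01) - (\<Sum>k\<in>A. (cmod (fourier_coeff f k))\<^sup>2)"
proof -
  let ?c = "fourier_coeff f" and ?b = fourier_basis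
  let ?s = "\<lambda>y. \<Sum>k\<in>A. ?c k * ?b k y"
  have [simp]: "integrable leb01 (\<lambda>y. u y * cnj (v y))" if "sqint u" "sqint v" for u v
    using that by (intro sqint_mult_integrable sqint_cnj)
  have s: "sqint ?s" by (rule sqint_fourier_sum)
  have fs: "(\<integral>y. u y * cnj (?s y) \<partial>leb01) = (\<Sum>k\<in>A. cnj (?c k) * fourier_coeff u k)" if u: "sqint u" for u
  proof -
    have "(\<integral>y. u y * cnj (?s y) \<partial>leb01) = (\<integral>y. (\<Sum>k\<in>A. cnj (?c k) * (u y * cnj (?b k y))) \<partial>leb01)"
      by (simp add: sum_distrib_left mult_ac)
    also have "\<dots> = (\<Sum>k\<in>A. cnj (?c k) * fourier_coeff u k)"
      using u fourier_coeff_integrable[OF u] by (subst Bochner_Integration.integral_sum) (auto simp: fourier_coeff_def)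
    finally show ?thesis .
  qed
  have cs: "fourier_coeff ?s k = ?c k" if "k \<in> A" for k
    using that A by (simp add: fourier_coeff_fourier_sum)
  let ?S = "\<Sum>k\<in>A. (cmod (?c k))\<^sup>2"
  have 1: "(\<integral>y. f y * cnj (?s y) \<partial>leb01) = of_real ?S"
    unfolding fs[OF f] by (simp add: complex_norm_square mult.commute del: of_real_power)
  have 2: "(\<integral>y. ?s y * cnj (?s y) \<partial>leb01) = of_real ?S"
  proof -
    have "(\<Sum>k\<in>A. cnj (?c k) * fourier_coeff ?s k) = (\<Sum>k\<in>A. cnj (?c k) * ?c k)"
      by (intro sum.cong refl) (simp only: cs)
    then show ?thesis
      unfolding fs[OF s] by (simp add: complex_norm_square mult.commute del: of_real_power)
  qed
  have "(\<integral>y. ?s y * cnj (f y) \<partial>leb01) = (\<integral>y. cnj (f y * cnj (?s y)) \<partial>leb01)"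
    by (simp add: mult.commute)
  then have 3: "(\<integral>y. ?s y * cnj (f y) \<partial>leb01) = of_real ?S"
    unfolding Bochner_Integration.integral_cnj 1 by simp
  have sq: "complex_of_real (\<integral>y. (cmod (u y))\<^sup>2 \<partial>leb01) = (\<integral>y. u y * cnj (u y) \<partial>leb01)" for u
    by (simp add: complex_norm_square flip: integral_complex_of_real del: of_real_power)
  have "complex_of_real (\<integral>y. (cmod (f y - ?s y))\<^sup>2 \<partial>leb01)
      = (\<integral>y. f y * cnj (f y) - f y * cnj (?s y) - (?s y * cnj (f y) - ?s y * cnj (?s y)) \<partial>leb01)"
    unfolding sq by (intro Bochner_Integration.integral_cong) (auto simp: algebra_simps)
  also have "\<dots> = (\<integral>y. f y * cnj (f y) \<partial>leb01) - (\<integral>y. f y * cnj (?s y) \<partial>leb01)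
      - ((\<integral>y. ?s y * cnj (f y) \<partial>leb01) - (\<integral>y. ?s y * cnj (?s y) \<partial>leb01))"
    using f s by (simp only: Bochner_Integration.integral_diff Bochner_Integration.integrable_diff sqint_mult_integrable sqint_cnj)
  also have "\<dots> = of_real ((\<integral>y. (cmod (f y))\<^sup>2 \<partial>leb01) - ?S)"
    unfolding 1 2 3 sq[symmetric] by simp
  finally show ?thesis unfolding of_real_eq_iff .
qed

lemma norm_fourier_sum:
  assumes "finite A"
  shows "(\<integral>y. (cmod (\<Sum>k\<in>A. c k * fourier_basis k y))\<^sup>2 \<partial>leb01) = (\<Sum>k\<in>A. (cmod (c k))\<^sup>2)"
  using norm_diff_fourier_sum[OF sqint_fourier_sum assms, of c A]
  by (simp add: fourier_coeff_fourier_sum assms)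

lemma summable_fourier_coeff:
  assumes "sqint f" shows "summable (\<lambda>k. (cmod (fourier_coeff f k))\<^sup>2)"
proof (rule bounded_imp_summable)
  fix n
  have "0 \<le> (\<integral>y. (cmod (f y - (\<Sum>k\<in>{..n}. fourier_coeff f k * fourier_basis k y)))\<^sup>2 \<partial>leb01)"
    by (rule Bochner_Integration.integral_nonneg) simp
  then show "(\<Sum>k\<le>n. (cmod (fourier_coeff f k))\<^sup>2) \<le> (\<integral>y. (cmod (f y))\<^sup>2 \<partial>leb01)"
    unfolding norm_diff_fourier_sum[OF assms finite_atMost] by simp
qed simp

lemma fourier_coeff_bound:
  assumes "sqint f"
  shows "(cmod (fourier_coeff f k))\<^sup>2 \<le> (\<integral>y. (cmod (f y))\<^sup>2 \<partial>leb01)"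
proof -
  have "0 \<le> (\<integral>y. (cmod (f y - (\<Sum>k\<in>{k}. fourier_coeff f k * fourier_basis k y)))\<^sup>2 \<partial>leb01)"
    by (rule Bochner_Integration.integral_nonneg) simp
  then show ?thesis
    unfolding norm_diff_fourier_sum[OF assms finite.insertI[OF finite.emptyI]] by simp
qed

text \<open>The partial sums are Cauchy since their differences have the tail sums of c as norms;
  the limit keeps the coefficients because these depend continuously on the function.\<close>

lemma riesz_fischer:
  assumes c: "summable (\<lambda>k. (cmod (c k))\<^sup>2)"
  shows "\<exists>f. sqint f \<and> fourier_coeff f = c \<and> (\<integral>y. (cmod (f y))\<^sup>2 \<partial>leb01) = (\<Sum>k. (cmod (c k))\<^sup>2)"
proof -
  define s where "s n y = (\<Sum>k<n. c k * fourier_basis k y)" for n y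
  have s: "sqint (s n)" for n unfolding s_def by (rule sqint_fourier_sum)
  have diff: "(\<integral>y. (cmod (s m y - s n y))\<^sup>2 \<partial>leb01) = (\<Sum>k=n..<m. (cmod (c k))\<^sup>2)" if "n \<le> m" for m n
  proof -
    have "s m y - s n y = (\<Sum>k=n..<m. c k * fourier_basis k y)" for y
      unfolding s_def lessThan_atLeast0 using sum_diff_nat_ivl[of 0 n m] that by simp
    then show ?thesis by (simp add: norm_fourier_sum)
  qed
  have "\<exists>f. sqint f \<and> (\<lambda>n. \<integral>y. (cmod (s n y - f y))\<^sup>2 \<partial>leb01) \<longlonglongrightarrow> 0"
  proof (rule sqint_complete[OF s])
    fix \<epsilon> :: real assume "0 < \<epsilon>"
    then obtain N where N: "\<And>m n. N \<le> m \<Longrightarrow> norm (\<Sum>k=m..<n. (cmod (c k))\<^sup>2) < \<epsilon>"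
      using c unfolding summable_Cauchy by blast
    have "(\<integral>y. (cmod (s m y - s n y))\<^sup>2 \<partial>leb01) < \<epsilon>" if "N \<le> m" "N \<le> n" for m n
    proof (cases "n \<le> m")
      case True
      then show ?thesis using N[OF that(2), of m] by (simp add: diff)
    next
      case False
      then have "(\<integral>y. (cmod (s n y - s m y))\<^sup>2 \<partial>leb01) < \<epsilon>"
        using N[OF that(1), of n] by (simp add: diff)
      then show ?thesis by (simp add: norm_minus_commute)
    qed
    then show "\<exists>N. \<forall>m\<ge>N. \<forall>n\<ge>N. (\<integral>y. (cmod (s m y - s n y))\<^sup>2 \<partial>leb01) < \<epsilon>" by blast
  qed
  then obtain f where f: "sqint f" and lim: "(\<lambda>n. \<integral>y. (cmod (s n y - f y))\<^sup>2 \<partial>leb01) \<longlonglongrightarrow> 0"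
    by blast
  have coeff: "fourier_coeff f k = c k" for k
  proof -
    \<comment> \<open>A coefficient is bounded by the norm, so it is squeezed to zero along the
      convergent partial sums.\<close>
    have "(\<lambda>n. (cmod (fourier_coeff (\<lambda>y. s n y - f y) k))\<^sup>2) \<longlonglongrightarrow> 0"
      by (rule tendsto_sandwich[OF _ _ tendsto_const lim])
         (auto intro!: always_eventually fourier_coeff_bound sqint_diff s f)
    then have "(\<lambda>n. fourier_coeff (\<lambda>y. s n y - f y) k) \<longlonglongrightarrow> 0"
      by (simp add: tendsto_norm_zero_iff)
    moreover have "\<forall>\<^sub>F n in sequentially. fourier_coeff (\<lambda>y. s n y - f y) k = c k - fourier_coeff f k"
    proof (rule eventually_sequentiallyI[of "Suc k"])
      fix n assume "Suc k \<le> n"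
      then have "fourier_coeff (s n) k = c k"
        unfolding s_def by (subst fourier_coeff_fourier_sum) auto
      then show "fourier_coeff (\<lambda>y. s n y - f y) k = c k - fourier_coeff f k"
        by (simp add: fourier_coeff_diff s f)
    qed
    ultimately have "(\<lambda>n. c k - fourier_coeff f k) \<longlonglongrightarrow> 0"
      using tendsto_cong by fast
    then show ?thesis by (simp add: LIMSEQ_const_iff)
  qed
  have "(\<lambda>n. (\<integral>y. (cmod (f y))\<^sup>2 \<partial>leb01) - (\<Sum>k<n. (cmod (c k))\<^sup>2)) \<longlonglongrightarrow> 0"
    using lim norm_diff_fourier_sum[OF f, of "{..<n}" for n]
    by (simp add: s_def coeff norm_minus_commute)
  moreover have "(\<lambda>n. (\<integral>y. (cmod (f y))\<^sup>2 \<partial>leb01) - (\<Sum>k<n. (cmod (c k))\<^sup>2))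
      \<longlonglongrightarrow> (\<integral>y. (cmod (f y))\<^sup>2 \<partial>leb01) - (\<Sum>k. (cmod (c k))\<^sup>2)"
    by (intro tendsto_intros summable_LIMSEQ c)
  ultimately have "(\<integral>y. (cmod (f y))\<^sup>2 \<partial>leb01) = (\<Sum>k. (cmod (c k))\<^sup>2)"
    using LIMSEQ_unique by fastforce
  then show ?thesis using f coeff by blast
qed

text \<open>A map \<open>G\<close> that identifies \<open>L\<^sup>2[0,1)\<close>, presented by square integrable functions, with \<open>'a\<close>.\<close>

definition l2_model :: "((real \<Rightarrow> complex) \<Rightarrow> 'a::complex_inner) \<Rightarrow> bool" where
  "l2_model G \<longleftrightarrow>
     (\<forall>f g. sqint f \<longrightarrow> sqint g \<longrightarrow> G (\<lambda>y. f y + g y) = G f + G g) \<and>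
     (\<forall>c f. sqint f \<longrightarrow> G (\<lambda>y. c * f y) = c *\<^sub>C G f) \<and>
     (\<forall>f g. sqint f \<longrightarrow> sqint g \<longrightarrow> cinner (G f) (G g) = (\<integral>y. f y * cnj (g y) \<partial>leb01)) \<and>
     (\<forall>x. \<exists>f. sqint f \<and> G f = x)"

text \<open>A function is sent to the vector having its Fourier coefficients as coordinates in a
  complete orthonormal sequence. Linearity and surjectivity are checked on coordinates; the norm
  identity yields inner products by polarisation.\<close>

lemma exists_l2_model:
  assumes "separable_space (euclidean :: 'a::complex_hilbert topology)" "infinite_cdim TYPE('a)"
  shows "\<exists>G :: (real \<Rightarrow> complex) \<Rightarrow> 'a. l2_model G"
proof -
  obtain e :: "nat \<Rightarrow> 'a" where e: "complete_orthonormal e"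
    using exists_complete_orthonormal[OF assms] by blast
  define G :: "(real \<Rightarrow> complex) \<Rightarrow> 'a" where "G f = (\<Sum>k. fourier_coeff f k *\<^sub>C e k)" for f
  have Gc: "cinner (G f) (e k) = fourier_coeff f k" if "sqint f" for f k
    unfolding G_def by (rule cinner_orthonormal_suminf[OF e summable_fourier_coeff[OF that]])
  have Geq: "G f = x" if "sqint f" "\<And>k. fourier_coeff f k = cinner x (e k)" for f x
    by (rule complete_orthonormal_eqI[OF e]) (simp add: Gc that)
  have add: "G (\<lambda>y. f y + g y) = G f + G g" if "sqint f" "sqint g" for f g
    by (rule Geq) (auto simp: that sqint_add fourier_coeff_add cinner_add_left Gc)
  have scale: "G (\<lambda>y. c * f y) = c *\<^sub>C G f" if "sqint f" for c f
    by (rule Geq) (auto simp: that sqint_cmult fourier_coeff_cmult cinner_scaleC_left Gc)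
  have ex: "\<exists>f. sqint f \<and> G f = x \<and> (\<integral>y. (cmod (f y))\<^sup>2 \<partial>leb01) = (norm x)\<^sup>2" for x
  proof -
    have sm: "summable (\<lambda>k. (cmod (cinner x (e k)))\<^sup>2)" by (rule summable_cinner_orthonormal[OF e])
    then obtain f where f: "sqint f" "fourier_coeff f = (\<lambda>k. cinner x (e k))"
      "(\<integral>y. (cmod (f y))\<^sup>2 \<partial>leb01) = (\<Sum>k. (cmod (cinner x (e k)))\<^sup>2)"
      using riesz_fischer[of "\<lambda>k. cinner x (e k)"] by blast
    have "(\<lambda>n. (norm (\<Sum>k<n. cinner x (e k) *\<^sub>C e k))\<^sup>2) \<longlonglongrightarrow> (norm x)\<^sup>2"
      using orthonormal_expansion[OF e, of x] unfolding sums_def by (intro tendsto_intros)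
    then have "(\<lambda>n. \<Sum>k<n. (cmod (cinner x (e k)))\<^sup>2) \<longlonglongrightarrow> (norm x)\<^sup>2"
      by (simp add: norm_orthonormal_sum[OF e])
    then have "(\<Sum>k. (cmod (cinner x (e k)))\<^sup>2) = (norm x)\<^sup>2"
      using sums_unique by (force simp: sums_def)
    then show ?thesis using f Geq by auto
  qed
  have nrm: "(norm (G f))\<^sup>2 = (\<integral>y. (cmod (f y))\<^sup>2 \<partial>leb01)" if f: "sqint f" for f
  proof -
    \<comment> \<open>The representative g comes with the right norm by construction. It has the
      same Fourier coefficients as f, hence agrees with f almost everywhere.\<close>
    obtain g where g: "sqint g" "G g = G f" "(\<integral>y. (cmod (g y))\<^sup>2 \<partial>leb01) = (norm (G f))\<^sup>2"
      using ex by blast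
    have [measurable]: "f \<in> borel_measurable leb01" "g \<in> borel_measurable leb01"
      using f g by (auto simp: sqint_def)
    have "AE y in leb01. f y - g y = 0"
      using f g Gc by (intro fourier_coeff_eq_zero_imp) (auto simp: sqint_diff fourier_coeff_diff simp flip: Gc)
    then have "(\<integral>y. (cmod (f y))\<^sup>2 \<partial>leb01) = (\<integral>y. (cmod (g y))\<^sup>2 \<partial>leb01)"
      by (intro integral_cong_AE) (auto elim!: eventually_mono)
    then show ?thesis using g by simp
  qed
  \<comment> \<open>Polarisation: both squared norms of the sum are expanded and compared.\<close>
  have re: "Re (cinner (G f) (G g)) = Re (\<integral>y. f y * cnj (g y) \<partial>leb01)" if fg: "sqint f" "sqint g" for f g
  proof -
    have i: "integrable leb01 (\<lambda>y. f y * cnj (g y))"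
      using fg by (intro sqint_mult_integrable sqint_cnj)
    have pt: "(cmod (u + v))\<^sup>2 = (cmod u)\<^sup>2 + (cmod v)\<^sup>2 + 2 * Re (u * cnj v)" for u v
      unfolding cmod_power2 by (simp add: power2_eq_square algebra_simps)
    have "(norm (G f + G g))\<^sup>2 = (norm (G f))\<^sup>2 + (norm (G g))\<^sup>2 + 2 * Re (cinner (G f) (G g))"
      by (simp add: power2_norm_eq_inner inner_add_left inner_add_right inner_commute Re_cinner)
    moreover have "(norm (G f + G g))\<^sup>2 = (\<integral>y. (cmod (f y + g y))\<^sup>2 \<partial>leb01)"
      using fg by (simp add: nrm sqint_add flip: add)
    moreover have "\<dots> = (norm (G f))\<^sup>2 + (norm (G g))\<^sup>2 + 2 * (\<integral>y. Re (f y * cnj (g y)) \<partial>leb01)"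
    proof -
      have "(\<integral>y. (cmod (f y))\<^sup>2 + (cmod (g y))\<^sup>2 + 2 * R y \<partial>leb01)
          = (\<integral>y. (cmod (f y))\<^sup>2 \<partial>leb01) + (\<integral>y. (cmod (g y))\<^sup>2 \<partial>leb01) + 2 * (\<integral>y. R y \<partial>leb01)"
        if "integrable leb01 R" for R
        using that fg by (simp add: sqint_def)
      from this[OF integrable_Re[OF i]] show ?thesis
        unfolding pt nrm[OF fg(1)] nrm[OF fg(2)] .
    qed
    ultimately show ?thesis using integral_Re[OF i] by simp
  qed
  have ip: "cinner (G f) (G g) = (\<integral>y. f y * cnj (g y) \<partial>leb01)" if fg: "sqint f" "sqint g" for f g
  proof (rule complex_eqI)
    show "Re (cinner (G f) (G g)) = Re (\<integral>y. f y * cnj (g y) \<partial>leb01)" by (rule re[OF fg])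
    \<comment> \<open>Multiplying by \<open>- \<i>\<close> moves the imaginary part into the real
      part.\<close>
    have "Re (cinner (G (\<lambda>y. - \<i> * f y)) (G g)) = Re (\<integral>y. - \<i> * f y * cnj (g y) \<partial>leb01)"
      by (rule re) (use fg sqint_cmult[of f "- \<i>"] in auto)
    moreover have "(\<integral>y. - \<i> * f y * cnj (g y) \<partial>leb01) = - \<i> * (\<integral>y. f y * cnj (g y) \<partial>leb01)"
      by (subst integral_mult_right_zero[symmetric]) (simp add: mult.assoc)
    ultimately show "Im (cinner (G f) (G g)) = Im (\<integral>y. f y * cnj (g y) \<partial>leb01)"
      using scale[OF fg(1), of "- \<i>"] by (simp add: cinner_scaleC_left)
  qed
  show ?thesis
    unfolding l2_model_def using add scale ip ex by (intro exI[of _ G]) blast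
qed

section \<open>Self-similar digits\<close>

locale digit_system =
  fixes n :: nat and p :: "nat \<Rightarrow> real"
  assumes n: "2 \<le> n" and p_pos: "\<And>d. d < n \<Longrightarrow> 0 < p d" and p_sum: "(\<Sum>d<n. p d) = 1"
begin

definition cut :: "nat \<Rightarrow> real" where
  "cut d = (\<Sum>j<d. p j)"

definition digit :: "real \<Rightarrow> nat" where
  "digit y = (LEAST d. y < cut (Suc d))"

definition shift :: "real \<Rightarrow> real" where
  "shift y = (y - cut (digit y)) / p (digit y)"

text \<open>The inverse of \<open>shift\<close> on the interval of digit d.\<close>

definition branch :: "nat \<Rightarrow> real \<Rightarrow> real" where
  "branch d y = cut d + p d * y"

text \<open>\<open>code y\<close> is the number whose base \<open>n\<close> expansion lists the digits of \<open>y\<close> with respect to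
  the partition into intervals of lengths \<open>p 0, \<dots>, p (n - 1)\<close>.\<close>

definition code :: "real \<Rightarrow> real" where
  "code y = (\<Sum>k. real (digit ((shift ^^ k) y)) / real n ^ Suc k)"

definition phase :: "real \<Rightarrow> complex" where
  "phase y = cis (2 * pi * code y)"

lemma cut_0 [simp]: "cut 0 = 0" and cut_Suc: "cut (Suc d) = cut d + p d" and cut_n: "cut n = 1"
  by (simp_all add: cut_def p_sum)

lemma cut_mono: "d \<le> d' \<Longrightarrow> d' \<le> n \<Longrightarrow> cut d \<le> cut d'"
  unfolding cut_def by (intro sum_mono2) (auto intro!: less_imp_le[OF p_pos])

lemma digit_less:
  assumes "y \<in> {0..<1}"
  shows "digit y < n" "y < cut (Suc (digit y))" "cut (digit y) \<le> y"
proof -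
  have ex: "y < cut (Suc (n - 1))" using assms n by (simp add: cut_n)
  then show lt: "digit y < n"
    unfolding digit_def using n by (intro le_less_trans[OF Least_le[of "\<lambda>d. y < cut (Suc d)" "n - 1"]]) auto
  show "y < cut (Suc (digit y))" unfolding digit_def by (rule LeastI) (rule ex)
  show "cut (digit y) \<le> y"
  proof (cases "digit y")
    case (Suc d)
    then have "\<not> y < cut (Suc d)"
      unfolding digit_def by (intro not_less_Least) simp
    then show ?thesis using Suc by simp
  qed (use assms in simp)
qed

lemma digit_mono:
  assumes "y \<in> {0..<1}" "y' \<in> {0..<1}" "y \<le> y'"
  shows "digit y \<le> digit y'"
proof (rule ccontr)
  assume "\<not> digit y \<le> digit y'"
  then have "cut (Suc (digit y')) \<le> cut (digit y)"
    using digit_less(1)[OF assms(1)] by (intro cut_mono) auto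
  then show False using digit_less(2)[OF assms(2)] digit_less(3)[OF assms(1)] assms(3) by linarith
qed

lemma digit_eqI:
  assumes "d < n" "cut d \<le> y" "y < cut (Suc d)" "y \<in> {0..<1}"
  shows "digit y = d"
proof -
  have "digit y \<le> d" unfolding digit_def by (rule Least_le) (rule assms)
  moreover have "\<not> digit y < d"
    using cut_mono[of "Suc (digit y)" d] digit_less(2)[OF assms(4)] assms(1,2) by auto
  ultimately show ?thesis by simp
qed

lemma shift_in: assumes "y \<in> {0..<1}" shows "shift y \<in> {0..<1}"
  using digit_less[OF assms] p_pos[OF digit_less(1)[OF assms]]
  by (auto simp: shift_def cut_Suc field_simps)

lemma shift_funpow_in: "y \<in> {0..<1} \<Longrightarrow> (shift ^^ k) y \<in> {0..<1}"
  by (induction k) (auto simp: shift_in simp del: atLeastLessThan_iff)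

lemma branch_in:
  assumes "d < n" "y \<in> {0..<1}" shows "branch d y \<in> {0..<1}"
    and "cut d \<le> branch d y" "branch d y < cut (Suc d)"
proof -
  show 1: "cut d \<le> branch d y" and 2: "branch d y < cut (Suc d)"
    using assms p_pos[OF assms(1)] by (auto simp: branch_def cut_Suc)
  have "0 \<le> cut d" using cut_mono[of 0 d] assms by simp
  moreover have "cut (Suc d) \<le> 1" using cut_mono[of "Suc d" n] assms by (simp add: cut_n)
  ultimately show "branch d y \<in> {0..<1}" using 1 2 by auto
qed

lemma digit_branch: "d < n \<Longrightarrow> y \<in> {0..<1} \<Longrightarrow> digit (branch d y) = d"
  using branch_in[of d y] by (intro digit_eqI) auto

lemma shift_branch: "d < n \<Longrightarrow> y \<in> {0..<1} \<Longrightarrow> shift (branch d y) = y"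
  using p_pos[of d] by (simp add: shift_def digit_branch) (simp add: branch_def)

lemma branch_shift: "y \<in> {0..<1} \<Longrightarrow> branch (digit y) (shift y) = y"
  using p_pos[OF digit_less(1)[of y]] by (simp add: shift_def branch_def)

lemma code_term_bound:
  assumes "y \<in> {0..<1}"
  shows "real (digit ((shift ^^ k) y)) / real n ^ Suc k \<le> (real n - 1) / real n * (1 / real n) ^ k"
proof -
  have "real (digit ((shift ^^ k) y)) \<le> real n - 1"
    using digit_less(1)[OF shift_funpow_in[OF assms, of k]] by linarith
  then have "real (digit ((shift ^^ k) y)) / real n ^ Suc k \<le> (real n - 1) / real n ^ Suc k"
    by (rule divide_right_mono) simp
  then show ?thesis by (simp add: power_divide)
qed

lemma code_sums: "(\<lambda>k. (real n - 1) / real n * (1 / real n) ^ k) sums 1"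
proof -
  have "(\<lambda>k. (1 / real n) ^ k) sums (1 / (1 - 1 / real n))"
    using n by (intro geometric_sums) auto
  from sums_mult[OF this, of "(real n - 1) / real n"] show ?thesis
    using n by (simp add: field_simps)
qed

lemma code_summable:
  assumes "y \<in> {0..<1}"
  shows "summable (\<lambda>k. real (digit ((shift ^^ k) y)) / real n ^ Suc k)"
  by (rule summable_comparison_test'[OF sums_summable[OF code_sums], of 0])
     (use code_term_bound[OF assms] in auto)

lemma code_le_1: assumes "y \<in> {0..<1}" shows "code y \<le> 1"
proof -
  have "code y \<le> (\<Sum>k. (real n - 1) / real n * (1 / real n) ^ k)"
    unfolding code_def
    by (rule suminf_le[OF code_term_bound[OF assms] code_summable[OF assms] sums_summable[OF code_sums]])
  then show ?thesis by (simp only: sums_unique[OF code_sums, symmetric])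
qed

lemma code_nonneg: "y \<in> {0..<1} \<Longrightarrow> 0 \<le> code y"
  unfolding code_def by (rule suminf_nonneg[OF code_summable]) auto

lemma code_shift:
  assumes "y \<in> {0..<1}" shows "code y = (digit y + code (shift y)) / n"
proof -
  have "code y = digit y / n + (\<Sum>k. real (digit ((shift ^^ Suc k) y)) / real n ^ Suc (Suc k))"
    unfolding code_def by (subst suminf_split_head[OF code_summable[OF assms]]) simp
  also have "(\<lambda>k. real (digit ((shift ^^ Suc k) y)) / real n ^ Suc (Suc k))
      = (\<lambda>k. 1 / n * (real (digit ((shift ^^ k) (shift y))) / real n ^ Suc k))"
    by (simp add: funpow_swap1)
  also have "(\<Sum>k. 1 / n * (real (digit ((shift ^^ k) (shift y))) / real n ^ Suc k)) = 1 / n * code (shift y)"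
    unfolding code_def by (rule suminf_mult[OF code_summable[OF shift_in[OF assms]]])
  finally show ?thesis by (simp add: add_divide_distrib)
qed

lemma code_shift': "y \<in> {0..<1} \<Longrightarrow> n * code y = digit y + code (shift y)"
  using n by (simp add: code_shift)

text \<open>With at least two digits of positive weight, none has weight 1. The bound q is the
  common contraction factor of the branches: points sharing their first k digits are within
  \<open>q ^ k\<close> of each other.\<close>

lemma exists_p_bound: "\<exists>q. 0 \<le> q \<and> q < 1 \<and> (\<forall>d<n. p d \<le> q)"
proof (intro exI conjI allI impI)
  let ?q = "Max (p ` {..<n})"
  have "0 \<in> {..<n}" using n by simp
  then have ne: "p ` {..<n} \<noteq> {}" by blast
  show le: "p d \<le> ?q" if "d < n" for d using that by (intro Max_ge) auto
  have "0 < n" using n by simp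
  then show "0 \<le> ?q" using le[of 0] p_pos[of 0] by linarith
  have "p d < 1" if d: "d < n" for d
  proof -
    obtain d' where d': "d' < n" "d' \<noteq> d"
      using n by (metis One_nat_def Suc_1 Suc_le_lessD less_nat_zero_code nat_neq_iff order_less_trans zero_less_Suc)
    have "p d + p d' = sum p {d, d'}" using d' by simp
    also have "\<dots> \<le> (\<Sum>d<n. p d)" using d d' by (intro sum_mono2) (auto intro: less_imp_le p_pos)
    finally show ?thesis using p_pos[OF d'(1)] p_sum by simp
  qed
  then show "?q < 1" using ne by (subst Max_less_iff) auto
qed

lemma le_zero_of_le_power:
  assumes "0 \<le> q" "q < (1::real)" "\<And>k. x \<le> q ^ k" shows "x \<le> 0"
  using LIMSEQ_le_const[OF LIMSEQ_realpow_zero[OF assms(1,2)]] assms(3) by blast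

text \<open>The value 1 would force the largest digit at every place. Each such digit shrinks the
  distance from y to 1 by the factor q, so y would be 1, which the half-open interval
  excludes.\<close>

lemma code_less_1: assumes "y \<in> {0..<1}" shows "code y < 1"
proof (rule ccontr)
  obtain q where q: "0 \<le> q" "q < 1" "\<And>d. d < n \<Longrightarrow> p d \<le> q" using exists_p_bound by blast
  assume "\<not> code y < 1"
  then have "code y = 1" using code_le_1[OF assms] by simp
  have "1 - y \<le> q ^ k" for k
    using assms \<open>code y = 1\<close>
  proof (induction k arbitrary: y)
    case (Suc k)
    have "real n = digit y + code (shift y)" using code_shift'[OF Suc.prems(1)] Suc.prems(2) by simp
    moreover have "code (shift y) \<le> 1" by (rule code_le_1[OF shift_in[OF Suc.prems(1)]])
    moreover have "digit y < n" by (rule digit_less(1)[OF Suc.prems(1)])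
    ultimately have d: "Suc (digit y) = n" and c: "code (shift y) = 1" by linarith+
    then have "cut (digit y) = 1 - p (digit y)" using cut_Suc[of "digit y"] cut_n by simp
    then have "1 - y = p (digit y) * (1 - shift y)"
      using branch_shift[OF Suc.prems(1)] unfolding branch_def by (simp add: algebra_simps)
    also have "\<dots> \<le> q * q ^ k"
      using Suc.IH[OF shift_in[OF Suc.prems(1)] c] q(1) q(3)[OF \<open>digit y < n\<close>] shift_in[OF Suc.prems(1)]
      by (intro mult_mono) auto
    finally show ?case by simp
  qed auto
  then have "1 - y \<le> 0" by (rule le_zero_of_le_power[OF q(1,2)])
  then show False using assms by simp
qed

lemma code_in: "y \<in> {0..<1} \<Longrightarrow> code y \<in> {0..<1}"
  unfolding atLeastLessThan_iff[of "code y"] by (intro conjI code_nonneg code_less_1)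

text \<open>The error term lets the comparison be made digit by digit. At an equal first digit it is
  scaled by n and handed to the shifted points; at a larger first digit a difference of one
  outweighs whatever the remaining digits contribute.\<close>

lemma code_mono_aux:
  assumes "y \<in> {0..<1}" "y' \<in> {0..<1}" "y < y'"
  shows "code y \<le> code y' + (1/n) ^ k"
  using assms
proof (induction k arbitrary: y y')
  case 0
  then show ?case using code_le_1[of y] code_nonneg[of y'] by simp
next
  case (Suc k)
  note y = Suc.prems(1) and y' = Suc.prems(2)
  have dd: "digit y \<le> digit y'" using digit_mono[OF y y'] Suc.prems(3) by simp
  have "n * code y \<le> n * (code y' + (1/n) ^ Suc k)"
  proof (cases "digit y = digit y'")
    case True
    then have "shift y < shift y'"
      using Suc.prems(3) p_pos[OF digit_less(1)[OF y]] by (simp add: shift_def divide_strict_right_mono)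
    then have "code (shift y) \<le> code (shift y') + (1/n) ^ k"
      by (intro Suc.IH shift_in y y')
    then show ?thesis
      using code_shift'[OF y] code_shift'[OF y'] True n by (simp add: distrib_left)
  next
    case False
    then have "real (digit y) + 1 \<le> digit y'" using dd by linarith
    moreover have "0 \<le> real n * (1/n) ^ Suc k" by simp
    ultimately show ?thesis
      using code_shift'[OF y] code_shift'[OF y'] code_le_1[OF shift_in[OF y]] code_nonneg[OF shift_in[OF y']]
      unfolding distrib_left by linarith
  qed
  then show ?case using n by simp
qed

lemma code_strict_mono: "strict_mono_on {0..<1} code"
proof (rule strict_mono_onI)
  fix y y' :: real assume y: "y \<in> {0..<1}" and y': "y' \<in> {0..<1}" and lt: "y < y'"
  have "code y - code y' \<le> (1/n) ^ k" for k using code_mono_aux[OF y y' lt, of k] by simp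
  then have "code y - code y' \<le> 0"
    using n by (intro le_zero_of_le_power[where q="1/n"]) auto
  \<comment> \<open>Equal codes mean equal digits at every place, and contraction then forces the
    points to coincide.\<close>
  moreover have "code y \<noteq> code y'"
  proof
    assume eq: "code y = code y'"
    obtain q where q: "0 \<le> q" "q < 1" "\<And>d. d < n \<Longrightarrow> p d \<le> q" using exists_p_bound by blast
    have "y' - y \<le> q ^ k" for k
      using y y' lt eq
    proof (induction k arbitrary: y y')
      case (Suc k)
      note y = Suc.prems(1) and y' = Suc.prems(2)
      have "digit y \<le> digit y'" using digit_mono[OF y y'] Suc.prems(3) by simp
      moreover have e: "digit y + code (shift y) = digit y' + code (shift y')"
        using code_shift'[OF y] code_shift'[OF y'] Suc.prems(4) by simp
      \<comment> \<open>A code never reaches 1, so no carry can make up for different first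
        digits.\<close>
      then have "real (digit y') < digit y + 1"
        using code_less_1[OF shift_in[OF y]] code_nonneg[OF shift_in[OF y']] by linarith
      ultimately have d: "digit y' = digit y" by linarith
      have p: "0 < p (digit y)" by (rule p_pos[OF digit_less(1)[OF y]])
      have "shift y < shift y'"
        using Suc.prems(3) p d by (simp add: shift_def divide_strict_right_mono)
      then have IH: "shift y' - shift y \<le> q ^ k"
        using e d by (intro Suc.IH shift_in y y') auto
      have "y' - y = p (digit y) * (shift y' - shift y)"
        using p d by (simp add: shift_def field_simps)
      also have "\<dots> \<le> q * q ^ k"
        using IH q(1) q(3)[OF digit_less(1)[OF y]] \<open>shift y < shift y'\<close> by (intro mult_mono) auto
      finally show ?case by simp
    qed auto
    then have "y' - y \<le> 0" by (rule le_zero_of_le_power[OF q(1,2)])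
    then show False using lt by simp
  qed
  ultimately show "code y < code y'" by simp
qed

lemma code_branch: "d < n \<Longrightarrow> y \<in> {0..<1} \<Longrightarrow> code (branch d y) = (d + code y) / n"
  using code_shift[OF branch_in(1)] by (simp add: digit_branch shift_branch)

lemma norm_phase [simp]: "cmod (phase y) = 1"
  by (simp add: phase_def)

lemma phase_mult_cnj [simp]: "phase y * cnj (phase y) = 1" "cnj (phase y) * phase y = 1"
  using complex_norm_square[of "phase y"] by (simp_all add: mult.commute)

lemma phase_shift: assumes "y \<in> {0..<1}" shows "phase (shift y) = phase y ^ n"
proof -
  have "phase y ^ n = cis (2 * pi * (n * code y))"
    unfolding phase_def Complex.DeMoivre by (simp add: mult_ac)
  also have "\<dots> = cis (2 * pi * digit y) * phase (shift y)"
    unfolding code_shift'[OF assms] phase_def cis_mult by (simp add: distrib_left)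
  also have "cis (2 * pi * digit y) = 1"
    by (rule cis_multiple_2pi) simp
  finally show ?thesis by simp
qed

lemma phase_funpow_shift: "y \<in> {0..<1} \<Longrightarrow> phase ((shift ^^ k) y) = phase y ^ (n ^ k)"
proof (induction k)
  case (Suc k)
  then show ?case
    by (simp add: phase_shift shift_funpow_in mult.commute flip: power_mult del: atLeastLessThan_iff)
qed simp

lemma phase_branch:
  assumes "d < n" "y \<in> {0..<1}"
  shows "phase (branch d y) = cis (2 * pi * d / n) * cis (2 * pi * code y / n)"
  unfolding phase_def code_branch[OF assms] cis_mult by (simp add: distrib_left add_divide_distrib)

section \<open>Measurability and change of variables along the branches\<close>

lemma digit_measurable [measurable]: "digit \<in> borel \<rightarrow>\<^sub>M count_space UNIV"
  unfolding digit_def by measurable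

lemma shift_measurable_borel [measurable]: "shift \<in> borel \<rightarrow>\<^sub>M borel"
  unfolding shift_def by measurable

lemma branch_measurable_borel [measurable]: "branch d \<in> borel \<rightarrow>\<^sub>M borel"
  unfolding branch_def by measurable

lemma shift_measurable [measurable]: "shift \<in> leb01 \<rightarrow>\<^sub>M leb01"
  unfolding measurable_cong_sets[OF refl sets_leb01]
proof (rule measurable_restrict_space2)
  show "shift \<in> space leb01 \<rightarrow> {0..<1}" using shift_in by (simp add: Pi_iff)
qed measurable

lemma branch_measurable:
  assumes "d < n" shows "branch d \<in> leb01 \<rightarrow>\<^sub>M leb01"
  unfolding measurable_cong_sets[OF refl sets_leb01]
proof (rule measurable_restrict_space2)
  show "branch d \<in> space leb01 \<rightarrow> {0..<1}" using branch_in(1)[OF assms] by (simp add: Pi_iff)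
qed measurable

lemma code_measurable [measurable]: "code \<in> borel_measurable leb01"
  by (rule strict_mono_measurable[OF code_strict_mono])

lemma phase_measurable [measurable]: "phase \<in> borel_measurable leb01"
  unfolding phase_def by measurable

text \<open>The affine substitution \<open>branch d\<close> maps [0,1) onto the interval of digit d
  with Jacobian \<open>p d\<close>.\<close>

lemma integral_piece:
  fixes h :: "real \<Rightarrow> 'b::{banach, second_countable_topology}"
  assumes d: "d < n"
  shows "integrable lborel (\<lambda>x. indicator {cut d..<cut (Suc d)} x *\<^sub>R h x) \<longleftrightarrow> integrable leb01 (\<lambda>x. h (branch d x))"
    and "(\<integral>x. indicator {cut d..<cut (Suc d)} x *\<^sub>R h x \<partial>lborel) = p d *\<^sub>R (\<integral>x. h (branch d x) \<partial>leb01)"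
proof -
  have p: "0 < p d" using p_pos[OF d] .
  have ind: "indicator {cut d..<cut (Suc d)} (cut d + p d * x) = (indicator {0..<1} x :: real)" for x
    using p by (auto simp: cut_Suc indicator_def zero_le_mult_iff)
  let ?g = "\<lambda>x. indicator {cut d..<cut (Suc d)} x *\<^sub>R h x"
  have g: "?g (cut d + p d * x) = indicator {0..<1} x *\<^sub>R h (branch d x)" for x
    by (simp only: ind branch_def)
  have "integrable lborel ?g \<longleftrightarrow> integrable lborel (\<lambda>x. ?g (cut d + p d * x))"
    using p by (intro lborel_integrable_real_affine_iff[symmetric]) simp
  also have "\<dots> \<longleftrightarrow> integrable leb01 (\<lambda>x. h (branch d x))"
    unfolding g leb01_def by (rule integrable_restrict_space[symmetric]) simp
  finally show "integrable lborel ?g \<longleftrightarrow> integrable leb01 (\<lambda>x. h (branch d x))" .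
  have "(\<integral>x. ?g x \<partial>lborel) = \<bar>p d\<bar> *\<^sub>R (\<integral>x. ?g (cut d + p d * x) \<partial>lborel)"
    using p by (intro lborel_integral_real_affine) simp
  then show "(\<integral>x. ?g x \<partial>lborel) = p d *\<^sub>R (\<integral>x. h (branch d x) \<partial>leb01)"
    unfolding g integral_leb01 using p by simp
qed

lemma indicator_pieces: "(indicator {0..<1} x :: real) = (\<Sum>d<n. indicator {cut d..<cut (Suc d)} x)"
proof (cases "x \<in> {0..<1}")
  case True
  have "(\<Sum>d<n. indicator {cut d..<cut (Suc d)} x) = (\<Sum>d<n. if d = digit x then 1 else (0::real))"
  proof (intro sum.cong refl)
    fix d assume "d \<in> {..<n}"
    then have "x \<in> {cut d..<cut (Suc d)} \<longleftrightarrow> d = digit x"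
      using digit_less[OF True] digit_eqI[of d x] True by auto
    then show "indicator {cut d..<cut (Suc d)} x = (if d = digit x then 1 else (0::real))"
      by (simp add: indicator_def)
  qed
  then show ?thesis using digit_less[OF True] True by simp
next
  case False
  have "indicator {cut d..<cut (Suc d)} x = (0::real)" if "d < n" for d
    using False cut_mono[of 0 d] cut_mono[of "Suc d" n] that by (auto simp: cut_n)
  then show ?thesis using False by simp
qed

lemma integrable_iff_branch:
  fixes h :: "real \<Rightarrow> 'b::{banach, second_countable_topology}"
  shows "integrable leb01 h \<longleftrightarrow> (\<forall>d<n. integrable leb01 (\<lambda>x. h (branch d x)))"
proof
  assume "integrable leb01 h"
  then have h: "integrable lborel (\<lambda>x. indicator {0..<1} x *\<^sub>R h x)"
    by (simp add: leb01_def integrable_restrict_space)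
  show "\<forall>d<n. integrable leb01 (\<lambda>x. h (branch d x))"
  proof (intro allI impI)
    fix d assume d: "d < n"
    have "integrable lborel (\<lambda>x. indicator {cut d..<cut (Suc d)} x *\<^sub>R indicator {0..<1} x *\<^sub>R h x)"
      by (rule integrable_mult_indicator[OF _ h]) simp
    moreover have "indicator {cut d..<cut (Suc d)} x *\<^sub>R indicator {0..<1} x *\<^sub>R h x
        = indicator {cut d..<cut (Suc d)} x *\<^sub>R h x" for x
      using cut_mono[of 0 d] cut_mono[of "Suc d" n] d by (auto simp: cut_n indicator_def)
    ultimately have "integrable lborel (\<lambda>x. indicator {cut d..<cut (Suc d)} x *\<^sub>R h x)"
      by (simp only:)
    then show "integrable leb01 (\<lambda>x. h (branch d x))"
      using integral_piece(1)[OF d, of h] by blast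
  qed
next
  assume "\<forall>d<n. integrable leb01 (\<lambda>x. h (branch d x))"
  then have "integrable lborel (\<lambda>x. \<Sum>d<n. indicator {cut d..<cut (Suc d)} x *\<^sub>R h x)"
    by (intro Bochner_Integration.integrable_sum) (simp add: integral_piece(1))
  then show "integrable leb01 h"
    by (simp add: leb01_def integrable_restrict_space indicator_pieces scaleR_sum_left)
qed

lemma integral_self_similar:
  fixes h :: "real \<Rightarrow> 'b::{banach, second_countable_topology}"
  assumes "integrable leb01 h"
  shows "(\<integral>x. h x \<partial>leb01) = (\<Sum>d<n. p d *\<^sub>R (\<integral>x. h (branch d x) \<partial>leb01))"
proof -
  have "(\<integral>x. h x \<partial>leb01) = (\<integral>x. (\<Sum>d<n. indicator {cut d..<cut (Suc d)} x *\<^sub>R h x) \<partial>lborel)"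
    by (simp add: integral_leb01 indicator_pieces scaleR_sum_left)
  also have "\<dots> = (\<Sum>d<n. \<integral>x. indicator {cut d..<cut (Suc d)} x *\<^sub>R h x \<partial>lborel)"
    using assms by (intro Bochner_Integration.integral_sum) (simp add: integral_piece(1) integrable_iff_branch[of h])
  finally show ?thesis by (simp add: integral_piece(2))
qed

text \<open>On each branch the first digit is constant and \<open>shift\<close> is undone. In
  probabilistic terms, the first digit has law p and is independent of the shifted point, which is
  again uniformly distributed.\<close>

lemma integrable_digit_shift:
  fixes F :: "nat \<Rightarrow> real \<Rightarrow> 'b::{banach, second_countable_topology}"
  assumes "\<And>d. d < n \<Longrightarrow> integrable leb01 (F d)"
  shows "integrable leb01 (\<lambda>x. F (digit x) (shift x))"
    and "(\<integral>x. F (digit x) (shift x) \<partial>leb01) = (\<Sum>d<n. p d *\<^sub>R (\<integral>x. F d x \<partial>leb01))"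
proof -
  have eq: "integrable leb01 (\<lambda>x. F (digit (branch d x)) (shift (branch d x))) \<longleftrightarrow> integrable leb01 (F d)"
    "(\<integral>x. F (digit (branch d x)) (shift (branch d x)) \<partial>leb01) = (\<integral>x. F d x \<partial>leb01)"
    if "d < n" for d
    by (intro Bochner_Integration.integrable_cong Bochner_Integration.integral_cong;
        use that in \<open>simp add: digit_branch shift_branch\<close>)+
  show i: "integrable leb01 (\<lambda>x. F (digit x) (shift x))"
    using assms by (subst integrable_iff_branch) (simp add: eq)
  show "(\<integral>x. F (digit x) (shift x) \<partial>leb01) = (\<Sum>d<n. p d *\<^sub>R (\<integral>x. F d x \<partial>leb01))"
    unfolding integral_self_similar[OF i] by (intro sum.cong) (auto simp: eq)
qed

lemma integral_shift:
  fixes f :: "real \<Rightarrow> 'b::{banach, second_countable_topology}"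
  assumes "integrable leb01 f"
  shows "integrable leb01 (\<lambda>x. f (shift x))"
    and "(\<integral>x. f (shift x) \<partial>leb01) = (\<integral>x. f x \<partial>leb01)"
  using integrable_digit_shift[of "\<lambda>_. f"] assms p_sum by (simp_all flip: scaleR_sum_left)

lemma integral_funpow_shift:
  fixes f :: "real \<Rightarrow> 'b::{banach, second_countable_topology}"
  assumes "integrable leb01 f"
  shows "integrable leb01 (\<lambda>x. f ((shift ^^ k) x)) \<and>
    (\<integral>x. f ((shift ^^ k) x) \<partial>leb01) = (\<integral>x. f x \<partial>leb01)"
proof (induction k)
  case (Suc k)
  then show ?case
    using integral_shift[of "\<lambda>x. f ((shift ^^ k) x)"] by (simp add: funpow_swap1)
qed (use assms in simp)

section \<open>Law of large numbers for the digit 0\<close>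

definition deviation :: "real \<Rightarrow> real" where
  "deviation y = of_bool (digit y = 0) - p 0"

lemma deviation_bound: "\<bar>deviation y\<bar> \<le> 1"
proof -
  have "p 0 \<le> 1" using cut_mono[of 1 n] n by (simp add: cut_n cut_Suc[of 0, simplified])
  then show ?thesis using p_pos[of 0] n by (auto simp: deviation_def)
qed

lemma deviation_measurable [measurable]: "deviation \<in> borel \<rightarrow>\<^sub>M borel"
  unfolding deviation_def by measurable

lemma integrable_bounded_unit:
  fixes f :: "real \<Rightarrow> real"
  assumes "f \<in> borel_measurable leb01" "\<And>x. \<bar>f x\<bar> \<le> B"
  shows "integrable leb01 f"
  by (rule leb01.integrable_const_bound[where B=B]) (use assms in auto)

lemma funpow_shift_measurable [measurable]: "(shift ^^ k) \<in> leb01 \<rightarrow>\<^sub>M leb01"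
  by (induction k) (auto intro: measurable_comp)

lemma deviation_product_bound: "\<bar>deviation x * deviation y\<bar> \<le> 1"
  using mult_mono[OF deviation_bound[of x] deviation_bound[of y]] by (simp add: abs_mult)

text \<open>Invariance under \<open>shift\<close> reduces to j = 0. There the integral factors by
  independence of the first digit, and the centred first factor has mean zero.\<close>

lemma deviation_uncorrelated:
  assumes "j < k"
  shows "(\<integral>y. deviation ((shift ^^ j) y) * deviation ((shift ^^ k) y) \<partial>leb01) = 0"
proof -
  obtain i where k: "k = Suc i + j" using assms less_imp_Suc_add by (metis add.commute add_Suc_right)
  let ?f = "\<lambda>y. deviation y * deviation ((shift ^^ Suc i) y)"
  have i: "integrable leb01 ?f"
    by (rule integrable_bounded_unit[where B=1]) (simp_all only: deviation_product_bound, measurable)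
  have "(\<integral>y. deviation ((shift ^^ j) y) * deviation ((shift ^^ k) y) \<partial>leb01) = (\<integral>y. ?f ((shift ^^ j) y) \<partial>leb01)"
    unfolding k funpow_add comp_apply ..
  also have "\<dots> = (\<integral>y. ?f y \<partial>leb01)"
    using integral_funpow_shift[OF i] by blast
  also have "\<dots> = (\<integral>y. (of_bool (digit y = 0) - p 0) * deviation ((shift ^^ i) (shift y)) \<partial>leb01)"
    by (simp add: funpow_swap1 deviation_def[of "y" for y])
  also have "\<dots> = (\<Sum>d<n. p d *\<^sub>R (\<integral>y. (of_bool (d = 0) - p 0) * deviation ((shift ^^ i) y) \<partial>leb01))"
  proof (rule integrable_digit_shift(2)[where F="\<lambda>d y. (of_bool (d = 0) - p 0) * deviation ((shift ^^ i) y)"])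
    fix d
    show "integrable leb01 (\<lambda>y. (of_bool (d = 0) - p 0) * deviation ((shift ^^ i) y))"
      by (intro integrable_mult_right integrable_bounded_unit[where B=1]) (auto simp: deviation_bound)
  qed
  also have "\<dots> = (\<Sum>d<n. p d * (of_bool (d = 0) - p 0)) * (\<integral>y. deviation ((shift ^^ i) y) \<partial>leb01)"
    by (simp add: sum_distrib_right mult.assoc)
  also have "(\<Sum>d<n. p d * (of_bool (d = 0) - p 0)) = (\<Sum>d<n. p d * of_bool (d = 0)) - (\<Sum>d<n. p d) * p 0"
    by (simp add: right_diff_distrib sum_subtractf sum_distrib_right)
  also have "\<dots> = 0"
  proof -
    have "(\<Sum>d<n. p d * of_bool (d = 0)) = (\<Sum>d<n. if d = 0 then p 0 else 0)"
      by (intro sum.cong) auto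
    then show ?thesis using n by (simp add: p_sum)
  qed
  finally show ?thesis by simp
qed

text \<open>The mixed terms vanish, leaving N diagonal terms of size at most 1 over the denominator
  \<open>N ^ 2\<close>.\<close>

lemma deviation_average_variance:
  assumes "0 < N"
  shows "integrable leb01 (\<lambda>y. ((\<Sum>k<N. deviation ((shift ^^ k) y)) / real N)\<^sup>2)"
    and "(\<integral>y. ((\<Sum>k<N. deviation ((shift ^^ k) y)) / real N)\<^sup>2 \<partial>leb01) \<le> 1 / real N"
proof -
  let ?D = "\<lambda>k y. deviation ((shift ^^ k) y)"
  have i: "integrable leb01 (\<lambda>y. ?D j y * ?D k y)" for j k
    by (rule integrable_bounded_unit[where B=1]) (simp_all only: deviation_product_bound, measurable)
  have eq: "((\<Sum>k<N. ?D k y) / real N)\<^sup>2 = (\<Sum>j<N. \<Sum>k<N. ?D j y * ?D k y) / (real N)\<^sup>2" for y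
    by (simp add: power_divide power2_eq_square sum_product)
  show "integrable leb01 (\<lambda>y. ((\<Sum>k<N. ?D k y) / real N)\<^sup>2)"
    unfolding eq by (intro integrable_divide Bochner_Integration.integrable_sum i)
  have le: "(\<integral>y. ?D j y * ?D k y \<partial>leb01) \<le> (if j = k then 1 else 0)" for j k
  proof (cases j k rule: linorder_cases)
    case equal
    have "(\<integral>y. ?D j y * ?D k y \<partial>leb01) \<le> (\<integral>y. 1 \<partial>leb01)"
      by (rule integral_mono[OF i]) (use deviation_product_bound abs_le_iff in auto)
    then show ?thesis using equal by simp
  qed (use deviation_uncorrelated[of j k] deviation_uncorrelated[of k j] in \<open>auto simp: mult.commute\<close>)
  have "(\<integral>y. ((\<Sum>k<N. ?D k y) / real N)\<^sup>2 \<partial>leb01) = (\<Sum>j<N. \<Sum>k<N. \<integral>y. ?D j y * ?D k y \<partial>leb01) / (real N)\<^sup>2"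
    unfolding eq by (simp add: i)
  also have "\<dots> \<le> (\<Sum>j<N. \<Sum>k<N. if j = k then 1 else 0) / (real N)\<^sup>2"
    by (intro divide_right_mono sum_mono le) auto
  also have "\<dots> = 1 / real N"
    using assms by (simp add: power2_eq_square)
  finally show "(\<integral>y. ((\<Sum>k<N. ?D k y) / real N)\<^sup>2 \<partial>leb01) \<le> 1 / real N" .
qed

text \<open>Along N = \<open>2 ^ m\<close> the variances are summable, so the averages converge
  almost everywhere by summation alone. Convergence along this subsequence is enough to tell
  different values of \<open>p 0\<close> apart.\<close>

lemma AE_digit_frequency:
  "AE y in leb01. (\<lambda>m. (\<Sum>k<2^m. of_bool (digit ((shift ^^ k) y) = 0)) / 2^m) \<longlonglongrightarrow> p 0"
proof -
  have "AE y in leb01. summable (\<lambda>m. ((\<Sum>k<2^m. deviation ((shift ^^ k) y)) / real (2^m))\<^sup>2)"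
  proof (rule AE_summable_of_summable_integral)
    show "(\<integral>y. ((\<Sum>k<2^m. deviation ((shift ^^ k) y)) / real (2^m))\<^sup>2 \<partial>leb01) \<le> (1/2) ^ m" for m
      using deviation_average_variance(2)[of "2 ^ m"] by (simp add: power_divide)
    show "integrable leb01 (\<lambda>y. ((\<Sum>k<2^m. deviation ((shift ^^ k) y)) / real (2^m))\<^sup>2)" for m
      by (rule deviation_average_variance(1)) simp
  qed (auto intro: summable_geometric)
  then show ?thesis
  proof eventually_elim
    case (elim y)
    then have "(\<lambda>m. ((\<Sum>k<2^m. deviation ((shift ^^ k) y)) / real (2^m))\<^sup>2) \<longlonglongrightarrow> 0"
      by (rule summable_LIMSEQ_zero)
    then have "(\<lambda>m. (\<Sum>k<2^m. deviation ((shift ^^ k) y)) / real (2^m)) \<longlonglongrightarrow> 0"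
      using tendsto_real_sqrt by (fastforce simp: tendsto_rabs_zero_iff)
    then have "(\<lambda>m. (\<Sum>k<2^m. deviation ((shift ^^ k) y)) / real (2^m) + p 0) \<longlonglongrightarrow> 0 + p 0"
      by (intro tendsto_add tendsto_const)
    moreover have "(\<Sum>k<2^m. deviation ((shift ^^ k) y)) / real (2^m) + p 0
        = (\<Sum>k<2^m. of_bool (digit ((shift ^^ k) y) = 0)) / 2^m" for m
      by (simp add: deviation_def sum_subtractf diff_divide_distrib)
    ultimately show ?case by simp
  qed
qed

end

section \<open>Stability\<close>

definition measure_preserving_map :: "(real \<Rightarrow> real) \<Rightarrow> bool" where
  "measure_preserving_map s \<longleftrightarrow> s \<in> leb01 \<rightarrow>\<^sub>M leb01 \<and>
     (\<forall>f::real \<Rightarrow> real. integrable leb01 f \<longrightarrow> integrable leb01 (\<lambda>y. f (s y)) \<and>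
        (\<integral>y. f (s y) \<partial>leb01) = (\<integral>y. f y \<partial>leb01))"

definition bounded_multiplier :: "(real \<Rightarrow> complex) \<Rightarrow> bool" where
  "bounded_multiplier m \<longleftrightarrow> m \<in> borel_measurable leb01 \<and> (\<exists>B. \<forall>y\<in>{0..<1}. cmod (m y) \<le> B)"

lemma measure_preserving_id: "measure_preserving_map (\<lambda>y. y)"
  by (simp add: measure_preserving_map_def)

lemma sqint_comp:
  assumes "measure_preserving_map s" "sqint f"
  shows "sqint (\<lambda>y. f (s y))" "(\<integral>y. (cmod (f (s y)))\<^sup>2 \<partial>leb01) = (\<integral>y. (cmod (f y))\<^sup>2 \<partial>leb01)"
  using assms measurable_compose[of s leb01 leb01 f borel]
  by (auto simp: measure_preserving_map_def sqint_def)

lemma sqint_weighted_comp: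
  assumes "measure_preserving_map s" "bounded_multiplier m" "sqint f"
  shows "sqint (\<lambda>y. m y * f (s y))"
proof -
  obtain B where "m \<in> borel_measurable leb01" "\<And>y. y \<in> {0..<1} \<Longrightarrow> cmod (m y) \<le> B"
    using assms(2) unfolding bounded_multiplier_def by blast
  then show ?thesis by (rule sqint_bounded_mult[OF sqint_comp(1)[OF assms(1,3)]])
qed

locale l2_representation =
  fixes G :: "(real \<Rightarrow> complex) \<Rightarrow> 'a::complex_inner"
  assumes model: "l2_model G"
begin

lemma G_add: "sqint f \<Longrightarrow> sqint g \<Longrightarrow> G (\<lambda>y. f y + g y) = G f + G g"
  and G_scale: "sqint f \<Longrightarrow> G (\<lambda>y. c * f y) = c *\<^sub>C G f"
  and G_cinner: "sqint f \<Longrightarrow> sqint g \<Longrightarrow> cinner (G f) (G g) = (\<integral>y. f y * cnj (g y) \<partial>leb01)"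
  using model by (auto simp: l2_model_def)

lemma G_cases: obtains f where "sqint f" "x = G f"
  using model unfolding l2_model_def by metis

lemma G_diff: "sqint f \<Longrightarrow> sqint g \<Longrightarrow> G (\<lambda>y. f y - g y) = G f - G g"
  using G_add[of f "\<lambda>y. -1 * g y"] G_scale[of g "-1"] sqint_cmult[of g "-1"]
  by (simp add: scaleC_minus_one)

lemma G_norm: "sqint f \<Longrightarrow> (norm (G f))\<^sup>2 = (\<integral>y. (cmod (f y))\<^sup>2 \<partial>leb01)"
proof -
  assume f: "sqint f"
  have "complex_of_real ((norm (G f))\<^sup>2) = (\<integral>y. complex_of_real ((cmod (f y))\<^sup>2) \<partial>leb01)"
    unfolding cinner_self[symmetric] G_cinner[OF f f] by (simp only: complex_norm_square)
  then show ?thesis by (simp only: integral_complex_of_real of_real_eq_iff)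
qed

lemma G_cong_AE:
  assumes f: "sqint f" and g: "sqint g" and eq: "AE y in leb01. f y = g y"
  shows "G f = G g"
proof -
  have d: "sqint (\<lambda>y. f y - g y)" by (rule sqint_diff[OF f g])
  have "(norm (G (\<lambda>y. f y - g y)))\<^sup>2 = (\<integral>y. 0 \<partial>leb01)"
    unfolding G_norm[OF d] using eq d
    by (intro integral_cong_AE) (auto simp: sqint_def elim!: eventually_mono)
  then show ?thesis by (simp add: G_diff f g)
qed

lemma G_cong:
  assumes f: "sqint f" and eq: "\<And>y. y \<in> {0..<1} \<Longrightarrow> f y = g y"
  shows "sqint g" "G f = G g"
proof -
  have "g \<in> borel_measurable leb01"
    using sqint_measurable[OF f] measurable_cong[of leb01 f g borel] eq by simp
  then show "sqint g" using eq by (intro sqint_cong_AE[OF f]) auto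
  then show "G f = G g" using eq by (intro G_cong_AE f) auto
qed

lemma G_eq_iff: "sqint f \<Longrightarrow> sqint g \<Longrightarrow> G f = G g \<longleftrightarrow> (AE y in leb01. f y = g y)"
proof
  assume f: "sqint f" and g: "sqint g" and eq: "G f = G g"
  have d: "sqint (\<lambda>y. f y - g y)" by (rule sqint_diff[OF f g])
  have "(\<integral>y. (cmod (f y - g y))\<^sup>2 \<partial>leb01) = 0"
    using G_norm[OF d] by (simp add: G_diff f g eq)
  then have "AE y in leb01. (cmod (f y - g y))\<^sup>2 = 0"
    using d by (subst (asm) integral_nonneg_eq_0_iff_AE) (auto simp: sqint_def)
  then show "AE y in leb01. f y = g y" by eventually_elim simp
qed (rule G_cong_AE)

text \<open>One scheme for the operator U, the isometries \<open>S k\<close> and the spectral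
  projections. The vector x is translated to an arbitrary representative;
  \<open>weighted_comp_G\<close> shows that the choice has no effect.\<close>

definition weighted_comp :: "(real \<Rightarrow> complex) \<Rightarrow> (real \<Rightarrow> real) \<Rightarrow> 'a \<Rightarrow> 'a" where
  "weighted_comp m s x = G (\<lambda>y. m y * (SOME f. sqint f \<and> G f = x) (s y))"

context
  fixes m :: "real \<Rightarrow> complex" and s :: "real \<Rightarrow> real"
  assumes s: "measure_preserving_map s" and m: "bounded_multiplier m"
begin

lemma G_weighted_comp_bound:
  "\<exists>K. \<forall>f. sqint f \<longrightarrow> norm (G (\<lambda>y. m y * f (s y))) \<le> K * norm (G f)"
proof -
  obtain B where [measurable]: "m \<in> borel_measurable leb01" and B: "\<And>y. y \<in> {0..<1} \<Longrightarrow> cmod (m y) \<le> B"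
    using m unfolding bounded_multiplier_def by blast
  have B0: "0 \<le> B" using B[of 0] order_trans[OF norm_ge_zero] by auto
  have "norm (G (\<lambda>y. m y * f (s y))) \<le> B * norm (G f)" if f: "sqint f" for f
  proof (rule power2_le_imp_le)
    have "(norm (G (\<lambda>y. m y * f (s y))))\<^sup>2 = (\<integral>y. (cmod (m y * f (s y)))\<^sup>2 \<partial>leb01)"
      by (rule G_norm[OF sqint_weighted_comp[OF s m f]])
    also have "\<dots> \<le> (\<integral>y. B\<^sup>2 * (cmod (f (s y)))\<^sup>2 \<partial>leb01)"
    proof (rule integral_mono)
      show "integrable leb01 (\<lambda>y. (cmod (m y * f (s y)))\<^sup>2)"
        using sqint_weighted_comp[OF s m f] by (simp add: sqint_def)
      show "integrable leb01 (\<lambda>y. B\<^sup>2 * (cmod (f (s y)))\<^sup>2)"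
        using sqint_comp(1)[OF s f] by (simp add: sqint_def)
      show "(cmod (m y * f (s y)))\<^sup>2 \<le> B\<^sup>2 * (cmod (f (s y)))\<^sup>2" if "y \<in> space leb01" for y
        using B that by (auto simp: norm_mult power_mult_distrib intro!: mult_right_mono power_mono)
    qed
    also have "\<dots> = (B * norm (G f))\<^sup>2"
      by (simp add: sqint_comp(2)[OF s f] G_norm[OF f] power_mult_distrib)
    finally show "(norm (G (\<lambda>y. m y * f (s y))))\<^sup>2 \<le> (B * norm (G f))\<^sup>2" .
  qed (use B0 in simp)
  then show ?thesis by blast
qed

text \<open>Two representatives of the same vector differ by a function of norm zero, and the
  operator bound sends that difference to norm zero.\<close>

lemma weighted_comp_G: assumes f: "sqint f" shows "weighted_comp m s (G f) = G (\<lambda>y. m y * f (s y))"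
proof -
  define g where "g = (SOME g. sqint g \<and> G g = G f)"
  have "sqint g \<and> G g = G f" unfolding g_def by (rule someI[of _ f]) (simp add: f)
  then have g: "sqint g" "G g = G f" by auto
  obtain K where K: "\<And>f. sqint f \<Longrightarrow> norm (G (\<lambda>y. m y * f (s y))) \<le> K * norm (G f)"
    using G_weighted_comp_bound by blast
  have "norm (G (\<lambda>y. m y * g (s y)) - G (\<lambda>y. m y * f (s y))) = norm (G (\<lambda>y. m y * (g (s y) - f (s y))))"
    by (simp add: right_diff_distrib G_diff sqint_weighted_comp s m f g)
  also have "\<dots> \<le> K * norm (G (\<lambda>y. g y - f y))"
    by (rule K[OF sqint_diff[OF g(1) f]])
  also have "\<dots> = 0" by (simp add: G_diff f g)
  finally show ?thesis by (simp add: weighted_comp_def flip: g_def)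
qed

lemma weighted_comp_add: "weighted_comp m s (x + y) = weighted_comp m s x + weighted_comp m s y"
proof -
  obtain f g where fg: "sqint f" "x = G f" "sqint g" "y = G g" by (metis G_cases)
  then show ?thesis
    by (simp add: weighted_comp_G sqint_add distrib_left sqint_weighted_comp s m flip: G_add)
qed

lemma weighted_comp_scale: "weighted_comp m s (c *\<^sub>C x) = c *\<^sub>C weighted_comp m s x"
proof -
  obtain f where f: "sqint f" "x = G f" by (rule G_cases)
  then show ?thesis
    by (simp add: weighted_comp_G sqint_cmult sqint_weighted_comp s m mult.left_commute flip: G_scale)
qed

lemma weighted_comp_zero: "weighted_comp m s 0 = 0"
  using weighted_comp_add[of 0 0] by simp

lemma weighted_comp_sum: "weighted_comp m s (sum f A) = (\<Sum>i\<in>A. weighted_comp m s (f i))"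
  by (induction A rule: infinite_finite_induct) (auto simp: weighted_comp_add weighted_comp_zero)

lemma bounded_clinear_weighted_comp: "bounded_clinear (weighted_comp m s)"
proof -
  obtain K where K: "\<And>f. sqint f \<Longrightarrow> norm (G (\<lambda>y. m y * f (s y))) \<le> K * norm (G f)"
    using G_weighted_comp_bound by blast
  have "norm (weighted_comp m s x) \<le> K * norm x" for x
    using K by (cases x rule: G_cases) (simp add: weighted_comp_G)
  then show ?thesis
    by (intro bounded_clinear_intro) (auto simp: weighted_comp_add weighted_comp_scale)
qed

end

end

lemma sum_root_of_unity:
  fixes u :: complex
  assumes "u ^ n = 1" shows "(\<Sum>k<n. u ^ k) = (if u = 1 then of_nat n else 0)"
  using assms by (simp add: geometric_sum)

lemma bij_index_pos: "bij_betw index_pos (UNIV :: 'n::{finite,linorder} set) {1..CARD('n)}"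
proof -
  have lt: "index_pos i < index_pos j" if "i < j" for i j :: 'n
    unfolding index_pos_def
  proof (rule psubset_card_mono)
    have "j \<in> {k. k \<le> j}" "j \<notin> {k. k \<le> i}" using that by auto
    moreover have "{k. k \<le> i} \<subseteq> {k. k \<le> j}" using that by auto
    ultimately show "{k. k \<le> i} \<subset> {k. k \<le> j}" by blast
  qed simp
  then have inj: "inj (index_pos :: 'n \<Rightarrow> nat)"
    by (metis injI less_irrefl linorder_neqE)
  have "index_pos i \<in> {1..CARD('n)}" for i :: 'n
  proof -
    have "card {i} \<le> index_pos i" unfolding index_pos_def by (rule card_mono) auto
    moreover have "index_pos i \<le> CARD('n)" unfolding index_pos_def by (rule card_mono) auto
    ultimately show ?thesis by simp
  qed
  then have "range (index_pos :: 'n \<Rightarrow> nat) \<subseteq> {1..CARD('n)}" by blast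
  moreover have "card (range (index_pos :: 'n \<Rightarrow> nat)) = card {1..CARD('n)}"
    using inj by (simp add: card_image)
  ultimately have "range (index_pos :: 'n \<Rightarrow> nat) = {1..CARD('n)}"
    by (intro card_subset_eq) auto
  then show ?thesis using inj by (simp add: bij_betw_def)
qed

section \<open>The unitary operator U and the isometries \<open>S k\<close>\<close>

locale digit_model = digit_system n p + l2_representation G
  for n p and G :: "(real \<Rightarrow> complex) \<Rightarrow> 'a::complex_inner"
begin

lemma phase_inj:
  assumes "phase x = phase y" "x \<in> {0..<1}" "y \<in> {0..<1}" shows "x = y"
proof -
  have "code x = code y"
    using assms unfolding phase_def by (intro cis_2pi_inj code_in)
  then show ?thesis
    using strict_mono_on_eqD[OF code_strict_mono] assms by blast
qed

lemma bounded_multiplier_phase: "bounded_multiplier (\<lambda>y. phase y)" "bounded_multiplier (\<lambda>y. cnj (phase y))"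
  unfolding bounded_multiplier_def by (auto intro!: exI[of _ 1])

definition U :: "'a \<Rightarrow> 'a" where
  "U = weighted_comp phase (\<lambda>y. y)"

lemma U_G: "sqint f \<Longrightarrow> U (G f) = G (\<lambda>y. phase y * f y)"
  unfolding U_def using weighted_comp_G[OF measure_preserving_id bounded_multiplier_phase(1)] by simp

lemma U_add: "U (x + y) = U x + U y" and U_scale: "U (c *\<^sub>C x) = c *\<^sub>C U x"
  and U_sum: "U (sum f A) = (\<Sum>i\<in>A. U (f i))"
  unfolding U_def
  using weighted_comp_add weighted_comp_scale weighted_comp_sum measure_preserving_id bounded_multiplier_phase(1)
  by auto

lemma sqint_phase_mult:
  assumes "sqint f"
  shows "sqint (\<lambda>y. phase y * f y)" "sqint (\<lambda>y. cnj (phase y) * f y)"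
  using sqint_weighted_comp[OF measure_preserving_id _ assms] bounded_multiplier_phase by auto

lemma U_isometry: "cinner (U x) (U y) = cinner x y"
proof -
  obtain f g where fg: "sqint f" "x = G f" "sqint g" "y = G g" by (metis G_cases)
  have "phase y * f y * cnj (phase y * g y) = f y * cnj (g y)" for y
  proof -
    have "phase y * f y * cnj (phase y * g y) = (phase y * cnj (phase y)) * (f y * cnj (g y))"
      unfolding complex_cnj_mult by (simp only: mult_ac)
    then show ?thesis by simp
  qed
  then show ?thesis using fg by (simp only: U_G G_cinner sqint_phase_mult)
qed

lemma U_surj: "surj U"
proof (rule surjI)
  fix x show "U (G (\<lambda>y. cnj (phase y) * (SOME f. sqint f \<and> G f = x) y)) = x"
  proof -
    obtain g where g: "sqint g" "x = G g" by (rule G_cases)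
    define f where "f = (SOME f. sqint f \<and> G f = x)"
    have "sqint f \<and> G f = x" unfolding f_def by (rule someI[of _ g]) (simp add: g)
    then have f: "sqint f" "G f = x" by auto
    have "U (G (\<lambda>y. cnj (phase y) * f y)) = G (\<lambda>y. (phase y * cnj (phase y)) * f y)"
      unfolding U_G[OF sqint_phase_mult(2)[OF f(1)]] by (simp only: mult.assoc)
    then show ?thesis by (simp add: f flip: f_def)
  qed
qed

lemma cunitary_U: "cunitary U"
  by (rule cunitary_intro[OF U_add U_scale U_isometry U_surj])

text \<open>The square \<open>1 / (n * p d)\<close> cancels the Jacobian \<open>p d\<close> and
  gives every digit the same share 1/n of the norm. Orthogonality of the \<open>S k\<close> thereby
  becomes a plain sum over n-th roots of unity.\<close>

definition weight :: "nat \<Rightarrow> real" where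
  "weight d = 1 / sqrt (n * p d)"

lemma weight_square: "d < n \<Longrightarrow> n * p d * (weight d)\<^sup>2 = 1"
  using p_pos[of d] n by (simp add: weight_def power_divide)

lemma measure_preserving_shift: "measure_preserving_map shift"
  unfolding measure_preserving_map_def using integral_shift[where 'b=real] shift_measurable by blast

definition multiplier :: "nat \<Rightarrow> real \<Rightarrow> complex" where
  "multiplier k y = cnj (phase y) ^ k * of_real (weight (digit y))"

lemma bounded_multiplier_multiplier: "bounded_multiplier (multiplier k)"
  unfolding bounded_multiplier_def
proof (intro conjI exI ballI)
  show "multiplier k \<in> borel_measurable leb01"
    unfolding multiplier_def by measurable
  fix y :: real assume y: "y \<in> {0..<1}"
  have "cmod (multiplier k y) = \<bar>weight (digit y)\<bar>"
    by (simp add: multiplier_def norm_mult norm_power)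
  also have "\<dots> \<le> (\<Sum>d<n. \<bar>weight d\<bar>)"
    using digit_less(1)[OF y] by (intro member_le_sum) auto
  finally show "cmod (multiplier k y) \<le> (\<Sum>d<n. \<bar>weight d\<bar>)" .
qed

definition S :: "nat \<Rightarrow> 'a \<Rightarrow> 'a" where
  "S k = weighted_comp (multiplier k) shift"

lemma S_G: "sqint f \<Longrightarrow> S k (G f) = G (\<lambda>y. multiplier k y * f (shift y))"
  unfolding S_def by (rule weighted_comp_G[OF measure_preserving_shift bounded_multiplier_multiplier])

lemma sqint_S: "sqint f \<Longrightarrow> sqint (\<lambda>y. multiplier k y * f (shift y))"
  by (rule sqint_weighted_comp[OF measure_preserving_shift bounded_multiplier_multiplier])

lemma S_add: "S k (x + y) = S k x + S k y" and S_scale: "S k (c *\<^sub>C x) = c *\<^sub>C S k x"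
  unfolding S_def
  using weighted_comp_add weighted_comp_scale measure_preserving_shift bounded_multiplier_multiplier
  by auto

lemma U_S_Suc: "U (S (Suc k) x) = S k x"
proof -
  obtain f where f: "sqint f" "x = G f" by (rule G_cases)
  have "phase y * (multiplier (Suc k) y * f (shift y)) = multiplier k y * f (shift y)" for y
  proof -
    have "phase y * (multiplier (Suc k) y * f (shift y)) = (phase y * cnj (phase y)) * (multiplier k y * f (shift y))"
      unfolding multiplier_def power_Suc by (simp only: mult_ac)
    then show ?thesis by simp
  qed
  then show ?thesis by (simp only: f S_G U_G sqint_S)
qed

lemma U_S_0: "U (S 0 x) = S (n - 1) (U x)"
proof -
  obtain f where f: "sqint f" "x = G f" by (rule G_cases)
  have "phase y * (multiplier 0 y * f (shift y)) = multiplier (n - 1) y * (phase (shift y) * f (shift y))"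
    if y: "y \<in> {0..<1}" for y
  proof -
    have pn: "phase y ^ n = phase y ^ (n - 1) * phase y"
      using n power_minus_mult[of n "phase y"] by simp
    \<comment> \<open>Forgetting a digit raises the phase to the power n, so n - 1 conjugate factors
      leave exactly one phase.\<close>
    have "cnj (phase y) ^ (n - 1) * phase (shift y) = (cnj (phase y) * phase y) ^ (n - 1) * phase y"
      unfolding phase_shift[OF y] pn power_mult_distrib by (rule mult.assoc[symmetric])
    then have P: "cnj (phase y) ^ (n - 1) * phase (shift y) = phase y" by simp
    have "multiplier (n - 1) y * (phase (shift y) * f (shift y))
        = (cnj (phase y) ^ (n - 1) * phase (shift y)) * (of_real (weight (digit y)) * f (shift y))"
      unfolding multiplier_def by (simp only: mult_ac)
    also have "\<dots> = phase y * (multiplier 0 y * f (shift y))"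
      unfolding P by (simp add: multiplier_def)
    finally show ?thesis by (rule sym)
  qed
  then show ?thesis
    unfolding f S_G[OF f(1)] U_G[OF f(1)] U_G[OF sqint_S[OF f(1)]] S_G[OF sqint_phase_mult(1)[OF f(1)]]
    by (rule G_cong(2)[OF sqint_phase_mult(1)[OF sqint_S[OF f(1)]]])
qed

text \<open>Orthogonality of the characters of the cyclic group of order n. The summand is the d-th
  power of an n-th root of unity u, and u = 1 only for j = k because both exponents are below
  n.\<close>

lemma root_sum:
  assumes "j < n" "k < n"
  shows "(\<Sum>d<n. cnj (cis (2 * pi * d / n)) ^ j * cis (2 * pi * d / n) ^ k) = (if j = k then of_nat n else 0)"
proof -
  define u where "u = cnj (cis (2 * pi / n)) ^ j * cis (2 * pi / n) ^ k"
  have rt: "cis (2 * pi / n) ^ n = 1"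
    unfolding Complex.DeMoivre using n by simp
  have u1: "u = 1 \<longleftrightarrow> j = k"
  proof
    assume "u = 1"
    have "cis (2 * pi / n) ^ j * u = cis (2 * pi / n) ^ k"
    proof -
      have "cis (2 * pi / n) * cnj (cis (2 * pi / n)) = 1" by (simp add: cis_cnj cis_mult)
      then have "cis (2 * pi / n) ^ j * cnj (cis (2 * pi / n)) ^ j = 1"
        by (metis power_mult_distrib power_one)
      then show ?thesis unfolding u_def by (simp add: mult.assoc[symmetric])
    qed
    then have "cis (2 * pi * (j / n)) = cis (2 * pi * (k / n))"
      using \<open>u = 1\<close> by (simp add: Complex.DeMoivre mult_ac)
    then have "real j / n = real k / n"
      by (rule cis_2pi_inj) (use assms in auto)
    then show "j = k" using n by simp
  next
    assume "j = k"
    then have "u = (cnj (cis (2 * pi / n)) * cis (2 * pi / n)) ^ k"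
      unfolding u_def by (simp only: power_mult_distrib)
    then show "u = 1" by (simp add: cis_cnj cis_mult)
  qed
  have "u ^ n = cnj (cis (2 * pi / n) ^ n) ^ j * (cis (2 * pi / n) ^ n) ^ k"
    unfolding u_def by (simp only: power_mult_distrib complex_cnj_power flip: power_mult) (simp only: mult.commute)
  then have un: "u ^ n = 1" unfolding rt by simp
  have "cnj (cis (2 * pi * d / n)) ^ j * cis (2 * pi * d / n) ^ k = u ^ d" for d :: nat
  proof -
    have "cis (2 * pi * d / n) = cis (2 * pi / n) ^ d" unfolding Complex.DeMoivre by (simp add: mult.commute)
    then show ?thesis
      unfolding u_def by (simp only: power_mult_distrib complex_cnj_power flip: power_mult) (simp only: mult.commute)
  qed
  then show ?thesis using sum_root_of_unity[OF un] u1 by simp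
qed

text \<open>On branch d the phase splits into the root of unity belonging to d and a factor that
  does not depend on d. The weights cancel the Jacobians, so the sum over d acts on the roots of
  unity alone.\<close>

lemma S_orthogonal:
  assumes jk: "j < n" "k < n"
  shows "cinner (S j x) (S k y) = (if j = k then cinner x y else 0)"
proof -
  obtain f g where f: "sqint f" "x = G f" and g: "sqint g" "y = G g" by (metis G_cases)
  let ?\<kappa> = "\<lambda>y. cis (2 * pi * code y / n)"
  let ?h = "\<lambda>y. cnj (?\<kappa> y) ^ j * ?\<kappa> y ^ k * (f y * cnj (g y))"
  let ?F = "\<lambda>y. (multiplier j y * f (shift y)) * cnj (multiplier k y * g (shift y))"
  have iF: "integrable leb01 ?F"
    by (intro sqint_mult_integrable sqint_cnj sqint_S f g)
  have br: "?F (branch d y) = of_real (1 / (n * p d)) * (cnj (cis (2 * pi * d / n)) ^ j * cis (2 * pi * d / n) ^ k) * ?h y"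
    if d: "d < n" and y: "y \<in> {0..<1}" for d y
  proof -
    have w: "complex_of_real (weight d) * of_real (weight d) = of_real (1 / (n * p d))"
      using weight_square[OF d] p_pos[OF d] n
      by (simp add: power2_eq_square field_simps flip: of_real_mult)
    have "?F (branch d y) = (complex_of_real (weight d) * of_real (weight d)) *
        (cnj (cis (2 * pi * d / n)) ^ j * cis (2 * pi * d / n) ^ k) * ?h y"
      unfolding multiplier_def digit_branch[OF d y] shift_branch[OF d y] phase_branch[OF d y]
        complex_cnj_mult complex_cnj_power complex_cnj_cnj complex_cnj_complex_of_real power_mult_distrib
      by (simp only: mult_ac)
    then show ?thesis unfolding w .
  qed
  have "cinner (S j x) (S k y) = (\<integral>y. ?F y \<partial>leb01)"
    unfolding f g S_G[OF f(1)] S_G[OF g(1)] by (intro G_cinner sqint_S f g)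
  also have "\<dots> = (\<Sum>d<n. p d *\<^sub>R (\<integral>y. ?F (branch d y) \<partial>leb01))"
    by (rule integral_self_similar[OF iF])
  also have "\<dots> = (\<Sum>d<n. 1 / n * (cnj (cis (2 * pi * d / n)) ^ j * cis (2 * pi * d / n) ^ k) * (\<integral>y. ?h y \<partial>leb01))"
  proof (intro sum.cong refl)
    fix d assume "d \<in> {..<n}"
    then have d: "d < n" by simp
    let ?a = "cnj (cis (2 * pi * d / n)) ^ j * cis (2 * pi * d / n) ^ k"
    have "(\<integral>y. ?F (branch d y) \<partial>leb01) = (\<integral>y. of_real (1 / (n * p d)) * ?a * ?h y \<partial>leb01)"
      by (intro Bochner_Integration.integral_cong refl br[OF d]) simp
    also have "\<dots> = of_real (1 / (n * p d)) * ?a * (\<integral>y. ?h y \<partial>leb01)"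
      by (rule integral_mult_right_zero)
    finally show "p d *\<^sub>R (\<integral>y. ?F (branch d y) \<partial>leb01) = 1 / n * ?a * (\<integral>y. ?h y \<partial>leb01)"
      using p_pos[OF d] n by (simp add: scaleR_conv_of_real field_simps)
  qed
  also have "\<dots> = 1 / n * (\<Sum>d<n. cnj (cis (2 * pi * d / n)) ^ j * cis (2 * pi * d / n) ^ k) * (\<integral>y. ?h y \<partial>leb01)"
    by (simp only: sum_distrib_left sum_distrib_right)
  also have "\<dots> = (if j = k then \<integral>y. ?h y \<partial>leb01 else 0)"
    unfolding root_sum[OF jk] using n by simp
  also have "(if j = k then \<integral>y. ?h y \<partial>leb01 else 0) = (if j = k then cinner x y else 0)"
  proof (cases "j = k")
    case True
    have "?h y = f y * cnj (g y)" for y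
    proof -
      have "cnj (?\<kappa> y) ^ j * ?\<kappa> y ^ k = (cnj (?\<kappa> y) * ?\<kappa> y) ^ k"
        unfolding True by (simp only: power_mult_distrib)
      also have "\<dots> = 1" by (simp add: cis_cnj cis_mult)
      finally show ?thesis by simp
    qed
    then show ?thesis unfolding f g G_cinner[OF f(1) g(1)] by (simp only:)
  qed simp
  finally show ?thesis .
qed

lemma sqint_branch: assumes "sqint h" "d < n" shows "sqint (\<lambda>y. h (branch d y))"
  using assms measurable_compose[OF branch_measurable[OF assms(2)], of h borel]
    integrable_iff_branch[of "\<lambda>x. (cmod (h x))\<^sup>2"]
  by (auto simp: sqint_def)

text \<open>The adjoint of \<open>S k\<close>, written out on functions by splitting the integral
  over the branches.\<close>

definition component :: "nat \<Rightarrow> (real \<Rightarrow> complex) \<Rightarrow> real \<Rightarrow> complex" where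
  "component k h y = (\<Sum>d<n. of_real (p d * weight d) * (phase (branch d y) ^ k * h (branch d y)))"

lemma sqint_component: assumes "sqint h" shows "sqint (component k h)"
  unfolding component_def
proof (intro sqint_sum sqint_cmult)
  fix d assume "d \<in> {..<n}"
  then have d: "d < n" by simp
  have "sqint (\<lambda>y. phase y ^ k * h y)"
    by (rule sqint_bounded_mult[OF assms, where B=1]) (auto simp: norm_power)
  from sqint_branch[OF this d] show "sqint (\<lambda>y. phase (branch d y) ^ k * h (branch d y))" .
qed

text \<open>The ranges of the \<open>S k\<close> exhaust the space. The phases of the n preimages of
  \<open>shift y\<close> are the n-th roots of one number, so summing over k annihilates every
  preimage except y itself, where the weights multiply to 1.\<close>

lemma sum_S_component:
  assumes y: "y \<in> {0..<1}"
  shows "(\<Sum>k<n. multiplier k y * component k h (shift y)) = h y"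
proof -
  let ?u = "\<lambda>d. cnj (phase y) * phase (branch d (shift y))"
  have sy: "shift y \<in> {0..<1}" by (rule shift_in[OF y])
  have un: "?u d ^ n = 1" if d: "d < n" for d
  proof -
    have "phase (branch d (shift y)) ^ n = phase y ^ n"
      using phase_shift[OF branch_in(1)[OF d sy]] shift_branch[OF d sy] phase_shift[OF y] by simp
    then have "?u d ^ n = (cnj (phase y) * phase y) ^ n"
      by (simp only: power_mult_distrib)
    then show ?thesis by simp
  qed
  have u1: "?u d = 1 \<longleftrightarrow> d = digit y" if d: "d < n" for d
  proof
    assume "?u d = 1"
    then have "phase y * ?u d = phase y" by simp
    then have "phase (branch d (shift y)) = phase y" by (simp add: mult.assoc[symmetric])
    then have "branch d (shift y) = y" by (rule phase_inj[OF _ branch_in(1)[OF d sy] y])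
    then show "d = digit y" using digit_branch[OF d sy] by simp
  qed (simp add: branch_shift[OF y])
  have "(\<Sum>k<n. multiplier k y * component k h (shift y))
      = (\<Sum>k<n. \<Sum>d<n. of_real (weight (digit y) * p d * weight d) * h (branch d (shift y)) * ?u d ^ k)"
    unfolding component_def multiplier_def sum_distrib_left power_mult_distrib
    by (intro sum.cong refl) (simp only: of_real_mult mult_ac)
  also have "\<dots> = (\<Sum>d<n. \<Sum>k<n. of_real (weight (digit y) * p d * weight d) * h (branch d (shift y)) * ?u d ^ k)"
    by (rule sum.swap)
  also have "\<dots> = (\<Sum>d<n. if d = digit y then of_real (n * p d * (weight d)\<^sup>2) * h (branch d (shift y)) else 0)"
  proof (intro sum.cong refl)
    fix d assume "d \<in> {..<n}"
    then have d: "d < n" by simp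
    show "(\<Sum>k<n. of_real (weight (digit y) * p d * weight d) * h (branch d (shift y)) * ?u d ^ k)
      = (if d = digit y then of_real (n * p d * (weight d)\<^sup>2) * h (branch d (shift y)) else 0)"
      unfolding sum_distrib_left[symmetric] sum_root_of_unity[OF un[OF d]] u1[OF d]
      by (auto simp: power2_eq_square)
  qed
  also have "\<dots> = h y"
    using digit_less(1)[OF y] by (simp add: branch_shift[OF y] weight_square del: of_real_mult)
  finally show ?thesis .
qed

text \<open>V adds up the images of the components under the \<open>S k\<close>: isometric by their
  orthogonality, onto by \<open>sum_S_component\<close>. It turns the cyclic action of the matrix on
  components into the action of U on the \<open>S k\<close>.\<close>

lemma J_stable_U:
  assumes card: "CARD('n::{finite,linorder}) = n"
  shows "J_stable TYPE('n) U"
proof -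
  \<comment> \<open>Digits count from 0 while positions in the matrix count from 1, hence the
    \<open>Suc\<close>.\<close>
  define idx where "idx k = inv_into (UNIV :: 'n set) index_pos (Suc k)" for k
  have pos: "index_pos (idx k) = Suc k" if "k < n" for k
    using that bij_index_pos[where 'n='n] card unfolding idx_def
    by (intro f_inv_into_f) (auto simp: bij_betw_def)
  have "bij_betw Suc {..<n} {1..CARD('n)}"
    by (simp add: bij_betw_def card image_Suc_lessThan)
  then have "bij_betw (inv_into (UNIV :: 'n set) index_pos \<circ> Suc) {..<n} UNIV"
    by (rule bij_betw_trans) (rule bij_betw_inv_into[OF bij_index_pos])
  then have bij: "bij_betw idx {..<n} UNIV"
    by (simp add: idx_def[abs_def] comp_def)
  have sum_idx: "(\<Sum>i\<in>UNIV. F i) = (\<Sum>k<n. F (idx k))" for F :: "'n \<Rightarrow> 'c::comm_monoid_add"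
    using sum.reindex_bij_betw[OF bij, of F] by simp
  define V :: "'a ^ 'n::{finite,linorder} \<Rightarrow> 'a" where "V x = (\<Sum>k<n. S k (x $ idx k))" for x
  have V_add: "V (x + y) = V x + V y" for x y
    by (simp add: V_def S_add sum.distrib)
  have S_sum_scale: "c *\<^sub>C sum F A = (\<Sum>i\<in>A. c *\<^sub>C F i)" for c and F :: "nat \<Rightarrow> 'a" and A
    by (rule complex_vector.scale_sum_right)
  have V_scale: "V (c *\<^sub>C x) = c *\<^sub>C V x" for c x
    by (simp add: V_def S_scale scaleC_vec_def S_sum_scale)
  have V_iso: "cinner (V x) (V y) = cinner x y" for x y
  proof -
    have "cinner (V x) (V y) = (\<Sum>j<n. \<Sum>k<n. if j = k then cinner (x $ idx j) (y $ idx k) else 0)"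
      unfolding V_def cinner_sum_left cinner_sum_right
      by (intro sum.cong) (auto simp: S_orthogonal)
    also have "\<dots> = (\<Sum>j<n. cinner (x $ idx j) (y $ idx j))" by simp
    finally show ?thesis by (simp add: cinner_vec_def sum_idx)
  qed
  have V_surj: "surj V"
    unfolding surj_def
  proof
    fix x
    obtain h where h: "sqint h" "x = G h" by (rule G_cases)
    define z :: "'a ^ 'n::{finite,linorder}" where "z = (\<chi> i. G (component (index_pos i - 1) h))"
    have G_sum: "G (\<lambda>y. \<Sum>k<N. multiplier k y * component k h (shift y))
        = (\<Sum>k<N. S k (G (component k h)))" for N
    proof (induction N)
      case 0
      have "G (\<lambda>y. 0 * h y) = 0 *\<^sub>C G h" by (rule G_scale[OF h(1)])
      then show ?case by simp
    next
      case (Suc N)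
      then show ?case
        by (simp add: G_add sqint_sum sqint_S sqint_component h S_G)
    qed
    have "V z = (\<Sum>k<n. S k (G (component k h)))"
      unfolding V_def z_def by (intro sum.cong) (auto simp: pos)
    also have "\<dots> = G (\<lambda>y. \<Sum>k<n. multiplier k y * component k h (shift y))"
      by (rule G_sum[symmetric])
    also have "\<dots> = G h"
      by (rule G_cong(2)[OF _ sum_S_component]) (intro sqint_sum sqint_S sqint_component h)
    finally have "x = V z" using h by simp
    then show "\<exists>z. x = V z" by blast
  qed
  \<comment> \<open>The matrix moves components up by one place; the last place receives U of the
    first component.\<close>
  have J: "J_mat U x $ idx k = (if Suc k < n then x $ idx (Suc k) else U (x $ idx 0))"
    if k: "k < n" for x :: "'a ^ 'n::{finite,linorder}" and k
  proof -
    have "J_mat U x $ idx k = (\<Sum>j<n. (if j = Suc k then id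
        else if Suc k = n \<and> j = 0 then U else (\<lambda>x. 0)) (x $ idx j))"
      unfolding J_mat_def operator_matrix_def sum_idx vec_lambda_beta
      by (intro sum.cong refl) (simp add: pos k card)
    also have "\<dots> = (\<Sum>j<n. if j = (if Suc k < n then Suc k else 0)
        then (if Suc k < n then x $ idx (Suc k) else U (x $ idx 0)) else 0)"
      using k by (intro sum.cong refl) (simp split: if_split)
    also have "\<dots> = (if Suc k < n then x $ idx (Suc k) else U (x $ idx 0))"
      using n by (subst sum.delta) auto
    finally show ?thesis .
  qed
  have UV: "U (V x) = V (J_mat U x)" for x
  proof -
    \<comment> \<open>U lowers the index of every \<open>S k\<close> with k > 0 and sends
      \<open>S 0\<close> to the last one, so one sum is split at its first term and the other at its
      last.\<close>
    define N where "N = n - 1"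
    have N: "n = Suc N" using n by (simp add: N_def)
    have first: "sum F {..<n} = F 0 + (\<Sum>k<N. F (Suc k))" and last: "sum F {..<n} = (\<Sum>k<N. F k) + F N"
      for F :: "nat \<Rightarrow> 'a"
      unfolding N by (rule sum.lessThan_Suc_shift, rule sum.lessThan_Suc)
    have "U (V x) = U (S 0 (x $ idx 0)) + (\<Sum>k<N. U (S (Suc k) (x $ idx (Suc k))))"
      unfolding V_def U_sum by (rule first)
    also have "\<dots> = (\<Sum>k<N. S k (x $ idx (Suc k))) + S N (U (x $ idx 0))"
      by (simp add: U_S_0 U_S_Suc N_def)
    also have "\<dots> = V (J_mat U x)"
    proof -
      have "J_mat U x $ idx k = x $ idx (Suc k)" if "k < N" for k
      proof -
        have "k < n" "Suc k < n" using that by (auto simp: N_def)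
        then show ?thesis using J[of k x] by simp
      qed
      moreover have "J_mat U x $ idx N = U (x $ idx 0)"
        using J[of N x] n by (simp add: N_def)
      ultimately show ?thesis unfolding V_def last by simp
    qed
    finally show ?thesis .
  qed
  note V = cunitary_intro[OF V_add V_scale V_iso V_surj]
  have "J_mat U = inv V \<circ> U \<circ> V"
  proof
    fix x
    have "inv V (V (J_mat U x)) = J_mat U x" using V(3) by (simp add: fun_eq_iff)
    then show "J_mat U x = (inv V \<circ> U \<circ> V) x" by (simp add: UV)
  qed
  then show ?thesis
    unfolding J_stable_def unitarily_equivalent_def using V by blast
qed

end

section \<open>Cyclicity\<close>

lemma bounded_linear_scaleC: "bounded_linear (\<lambda>x::'a::complex_inner. c *\<^sub>C x)"
  by (rule bounded_linear_intro[where K="cmod c"])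
     (auto simp: scaleC_add_right norm_scaleC mult.commute scaleC_scaleR)

lemma csubspace_closure:
  fixes S :: "'a::complex_inner set"
  assumes "complex_vector.subspace S" shows "complex_vector.subspace (closure S)"
  unfolding complex_vector.subspace_def
proof (intro conjI ballI allI)
  show "0 \<in> closure S"
    using assms closure_subset by (auto simp: complex_vector.subspace_def)
next
  fix x y assume "x \<in> closure S" "y \<in> closure S"
  then obtain f g where fg: "\<And>n. f n \<in> S" "f \<longlonglongrightarrow> x" "\<And>n. g n \<in> S" "g \<longlonglongrightarrow> y"
    unfolding closure_sequential by metis
  then have "(\<lambda>n. f n + g n) \<longlonglongrightarrow> x + y" by (intro tendsto_add)
  moreover have "f n + g n \<in> S" for n using fg assms by (auto simp: complex_vector.subspace_def)
  ultimately show "x + y \<in> closure S" unfolding closure_sequential by metis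
next
  fix c x assume "x \<in> closure S"
  then obtain f where f: "\<And>n. f n \<in> S" "f \<longlonglongrightarrow> x"
    unfolding closure_sequential by metis
  then have "(\<lambda>n. c *\<^sub>C f n) \<longlonglongrightarrow> c *\<^sub>C x"
    by (intro bounded_linear.tendsto[OF bounded_linear_scaleC])
  moreover have "c *\<^sub>C f n \<in> S" for n using f assms by (auto simp: complex_vector.subspace_def)
  ultimately show "c *\<^sub>C x \<in> closure S" unfolding closure_sequential by metis
qed

text \<open>The dilation by r < 1 moves the essential singularity from 1 to 1/r, outside the closed
  disc, so that the power series converges absolutely on the circle.\<close>

definition inner_approx :: "real \<Rightarrow> real \<Rightarrow> complex \<Rightarrow> complex" where
  "inner_approx t r z = exp (of_real t * ((1 + of_real r * z) / (1 - of_real r * z) - 1))"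

lemma one_minus_scaled_bounds:
  assumes "cmod z = 1" "0 \<le> r" "r < 1"
  shows "1 - r \<le> cmod (1 - of_real r * z)" "cmod (1 - z) \<le> 2 * cmod (1 - of_real r * z)"
proof -
  show 1: "1 - r \<le> cmod (1 - of_real r * z)"
    using norm_triangle_ineq2[of 1 "of_real r * z"] assms by (simp add: norm_mult)
  have "1 - z = (1 - of_real r * z) + - ((1 - of_real r) * z)" by (simp add: algebra_simps)
  then have "cmod (1 - z) \<le> cmod (1 - of_real r * z) + cmod ((1 - of_real r) * z)"
    by (metis norm_triangle_ineq norm_minus_cancel)
  also have "cmod ((1 - of_real r) * z) = 1 - r"
  proof -
    have "cmod ((1 - complex_of_real r) * z) = cmod (complex_of_real (1 - r)) * cmod z"
      by (simp only: norm_mult of_real_diff of_real_1)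
    then show ?thesis using assms by (simp only: norm_of_real) simp
  qed
  finally show "cmod (1 - z) \<le> 2 * cmod (1 - of_real r * z)" using 1 by linarith
qed

text \<open>The real part of \<open>(1 + r z) / (1 - r z)\<close> is the Poisson kernel at the point
  1.\<close>

lemma norm_inner_approx:
  assumes z: "cmod z = 1" and r: "0 \<le> r" "r < 1"
  shows "cmod (inner_approx t r z) = exp (t * ((1 - r\<^sup>2) / (cmod (1 - of_real r * z))\<^sup>2 - 1))"
proof -
  let ?w = "1 - of_real r * z"
  have w: "cmod ?w > 0" using one_minus_scaled_bounds(1)[OF z r] r by linarith
  have zz: "(Re z)\<^sup>2 + (Im z)\<^sup>2 = 1" using z by (simp add: cmod_def)
  have "(1 + of_real r * z) / ?w = (1 + of_real r * z) * cnj ?w / of_real ((cmod ?w)\<^sup>2)"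
    using complex_div_cnj[of "1 + of_real r * z" ?w] by (simp only: of_real_power)
  then have "Re ((1 + of_real r * z) / ?w) = Re ((1 + of_real r * z) * cnj ?w) / (cmod ?w)\<^sup>2"
    by (simp only: Re_divide_of_real)
  also have "Re ((1 + of_real r * z) * cnj ?w) = 1 - r\<^sup>2 * ((Re z)\<^sup>2 + (Im z)\<^sup>2)"
    by (simp add: algebra_simps power2_eq_square)
  finally have "Re ((1 + of_real r * z) / ?w) = (1 - r\<^sup>2) / (cmod ?w)\<^sup>2" by (simp add: zz)
  then show ?thesis by (simp add: inner_approx_def norm_exp_eq_Re)
qed

text \<open>The bound is uniform in r, as dominated convergence will require, and its exponent has
  only a first-order singularity at 1.\<close>

lemma norm_inner_approx_le:
  assumes z: "cmod z = 1" "z \<noteq> 1" and r: "0 \<le> r" "r < 1" and t: "0 \<le> t"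
  shows "cmod (inner_approx t r z) \<le> exp (4 * t / cmod (1 - z))"
proof -
  let ?a = "cmod (1 - of_real r * z)"
  have a: "1 - r \<le> ?a" "cmod (1 - z) \<le> 2 * ?a" by (rule one_minus_scaled_bounds[OF z(1) r])+
  have z0: "0 < cmod (1 - z)" using z by simp
  then have a0: "0 < ?a" using a by linarith
  have "1 - r\<^sup>2 = (1 - r) * (1 + r)" by (simp add: power2_eq_square algebra_simps)
  also have "\<dots> \<le> ?a * 2" using a r by (intro mult_mono) auto
  finally have "(1 - r\<^sup>2) / ?a\<^sup>2 \<le> ?a * 2 / ?a\<^sup>2" by (rule divide_right_mono) simp
  also have "\<dots> = 2 / ?a" using a0 by (simp add: power2_eq_square)
  also have "\<dots> \<le> 4 / cmod (1 - z)"
    using a z0 a0 by (simp add: field_simps)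
  finally have "t * ((1 - r\<^sup>2) / ?a\<^sup>2 - 1) \<le> t * (4 / cmod (1 - z))"
    using t by (intro mult_left_mono) auto
  then show ?thesis unfolding norm_inner_approx[OF z(1) r] by (simp add: mult.commute)
qed

lemma inner_approx_power_series:
  assumes "0 \<le> r" "r < 1"
  shows "\<exists>a. a 0 = 1 \<and> summable (\<lambda>k. cmod (a k)) \<and> (\<forall>z. cmod z = 1 \<longrightarrow> (\<lambda>k. a k * z ^ k) sums inner_approx t r z)"
proof -
  \<comment> \<open>A radius strictly between 1 and 1/r, so that the disc contains the circle but
    not the singularity.\<close>
  define \<rho> where "\<rho> = 2 / (1 + r)"
  have \<rho>: "1 < \<rho>" "r * \<rho> < 1" using assms by (auto simp: \<rho>_def field_simps)
  have nz: "1 - of_real r * z \<noteq> 0" if "z \<in> ball 0 \<rho>" for z :: complex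
  proof
    assume "1 - of_real r * z = 0"
    then have "1 = cmod (of_real r * z)" by simp
    also have "\<dots> = r * cmod z" using assms by (simp add: norm_mult)
    also have "\<dots> \<le> r * \<rho>" using that assms by (intro mult_left_mono) auto
    finally show False using \<rho> by simp
  qed
  have hol: "inner_approx t r holomorphic_on ball 0 \<rho>"
    unfolding inner_approx_def using nz by (intro holomorphic_intros) auto
  define a where "a k = (deriv ^^ k) (inner_approx t r) 0 / fact k" for k
  have sums: "(\<lambda>k. a k * z ^ k) sums inner_approx t r z" if "z \<in> ball 0 \<rho>" for z
    using holomorphic_power_series[OF hol that] by (simp add: a_def)
  have "a 0 = 1" by (simp add: a_def inner_approx_def)
  moreover have "summable (\<lambda>k. cmod (a k))"
  proof -
    \<comment> \<open>Convergence at a point of modulus larger than 1 gives absolute convergence on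
      the unit circle.\<close>
    define s where "s = (1 + \<rho>) / 2"
    have "1 < s" "s < \<rho>" using \<rho> by (auto simp: s_def)
    then have "complex_of_real s \<in> ball 0 \<rho>" by simp
    from sums_summable[OF sums[OF this]] have "summable (\<lambda>k. norm (a k * 1 ^ k))"
      by (rule powser_insidea) (use \<open>1 < s\<close> in simp)
    then show ?thesis by simp
  qed
  moreover have "(\<lambda>k. a k * z ^ k) sums inner_approx t r z" if "cmod z = 1" for z
    using that \<rho> by (intro sums) simp
  ultimately show ?thesis by blast
qed

text \<open>The second-order singularity in the exponent outweighs the first-order one of
  \<open>inner_approx\<close>. Since division by zero gives zero, the value at 1 is 1, and the
  weight is positive everywhere.\<close>

definition cyclic_weight :: "complex \<Rightarrow> real" where
  "cyclic_weight z = exp (- (1 / (cmod (1 - z))\<^sup>2))"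

lemma cyclic_weight_bounds: "0 < cyclic_weight z" "cyclic_weight z \<le> 1"
  by (simp_all add: cyclic_weight_def)

text \<open>With s = \<open>1 / cmod (1 - z)\<close> the exponent is at most
  \<open>4 * t * s - s ^ 2\<close>, and completing the square bounds it independently of r and
  z.\<close>

lemma inner_approx_cyclic_weight_le:
  assumes "cmod z = 1" "z \<noteq> 1" "0 \<le> r" "r < 1" "0 \<le> t"
  shows "cmod (inner_approx t r z) * cyclic_weight z \<le> exp (4 * t\<^sup>2)"
proof -
  let ?s = "1 / cmod (1 - z)"
  have "cmod (inner_approx t r z) * cyclic_weight z \<le> exp (4 * t / cmod (1 - z)) * cyclic_weight z"
    using cyclic_weight_bounds(1)[of z] norm_inner_approx_le[OF assms] by (intro mult_right_mono) auto
  also have "\<dots> = exp (4 * t * ?s - ?s\<^sup>2)"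
    by (simp add: cyclic_weight_def power_divide flip: exp_add)
  also have "\<dots> \<le> exp (4 * t\<^sup>2)"
  proof -
    have "0 \<le> (2 * t - ?s)\<^sup>2" by simp
    then show ?thesis by (simp add: power2_diff power_mult_distrib)
  qed
  finally show ?thesis .
qed

text \<open>Off the point 1 the Poisson kernel tends to zero as r tends to 1, which leaves the
  exponent - t.\<close>

lemma inner_approx_tendsto:
  assumes "cmod z = 1" "z \<noteq> 1"
  shows "(\<lambda>m. cmod (inner_approx t (1 - 1 / (real m + 2)) z)) \<longlonglongrightarrow> exp (- t)"
proof -
  have "(\<lambda>m. 1 - 1 / real (m + 2)) \<longlonglongrightarrow> 1 - 0"
    by (intro tendsto_diff tendsto_const LIMSEQ_ignore_initial_segment lim_1_over_n)
  then have r: "(\<lambda>m. 1 - 1 / (real m + 2)) \<longlonglongrightarrow> 1" by (simp add: add.commute)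
  have z: "cmod (1 - of_real 1 * z) \<noteq> 0" using assms by simp
  have "(\<lambda>m. exp (t * ((1 - (1 - 1 / (real m + 2))\<^sup>2) / (cmod (1 - of_real (1 - 1 / (real m + 2)) * z))\<^sup>2 - 1)))
      \<longlonglongrightarrow> exp (t * ((1 - 1\<^sup>2) / (cmod (1 - of_real 1 * z))\<^sup>2 - 1))"
    by (intro tendsto_intros r) (use z in auto)
  then show ?thesis
    by (subst norm_inner_approx) (auto simp: assms)
qed

text \<open>The function \<open>g = inner_approx t r\<close> satisfies \<open>g 0 = 1\<close>, so \<open>cnj z * g z\<close> differs from \<open>cnj z\<close>
  by a limit of polynomials on the circle, while \<open>\<bar>g\<bar>\<close> tends to \<open>exp (- t)\<close> off \<open>1\<close> as \<open>r\<close> tends to \<open>1\<close>.\<close>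

lemma szego_step:
  fixes F :: "'b \<Rightarrow> complex"
  assumes [measurable]: "\<phi> \<in> borel_measurable M" and \<phi>: "\<And>x. x \<in> space M \<Longrightarrow> cmod (\<phi> x) = 1"
    and ne: "AE x in M. \<phi> x \<noteq> 1"
    and F: "integrable M F" and u: "integrable M u" and Fu: "\<And>x. x \<in> space M \<Longrightarrow> cmod (F x) \<le> cyclic_weight (\<phi> x) * u x"
    and coeff: "\<And>k::nat. (\<integral>x. \<phi> x ^ k * F x \<partial>M) = 0"
  shows "(\<integral>x. cnj (\<phi> x) * F x \<partial>M) = 0"
proof -
  have [measurable]: "F \<in> borel_measurable M" "u \<in> borel_measurable M" using F u by auto
  let ?I = "\<integral>x. cnj (\<phi> x) * F x \<partial>M"
  define r where "r m = 1 - 1 / (real m + 2)" for m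
  have r: "0 \<le> r m" "r m < 1" for m by (auto simp: r_def field_simps)
  have gm: "inner_approx t s \<in> borel_measurable borel" for t s
    unfolding inner_approx_def by measurable
  note [measurable] = gm
  have bnd: "AE x in M. cmod (inner_approx t (r m) (\<phi> x)) * cmod (F x) \<le> exp (4 * t\<^sup>2) * u x"
    if t: "0 \<le> t" for t m
    using ne AE_space
  proof eventually_elim
    case (elim x)
    have u0: "0 \<le> u x"
      using Fu[OF elim(2)] cyclic_weight_bounds(1)[of "\<phi> x"]
      by (meson norm_ge_zero order_trans zero_le_mult_iff not_less)
    have "cmod (inner_approx t (r m) (\<phi> x)) * cmod (F x) \<le> cmod (inner_approx t (r m) (\<phi> x)) * (cyclic_weight (\<phi> x) * u x)"
      using Fu[OF elim(2)] by (intro mult_left_mono) auto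
    also have "\<dots> = (cmod (inner_approx t (r m) (\<phi> x)) * cyclic_weight (\<phi> x)) * u x" by simp
    also have "\<dots> \<le> exp (4 * t\<^sup>2) * u x"
      using u0 by (intro mult_right_mono inner_approx_cyclic_weight_le \<phi> elim r t)
    finally show ?case .
  qed
  have ig: "integrable M (\<lambda>x. cmod (inner_approx t (r m) (\<phi> x)) * cmod (F x))" if t: "0 \<le> t" for t m
    by (rule Bochner_Integration.integrable_bound[OF integrable_mult_right[OF u, of "exp (4 * t\<^sup>2)"]])
       (use bnd[OF t, of m] in \<open>auto elim!: eventually_mono\<close>)
  have cphi: "cmod (cnj (\<phi> x) * \<phi> x ^ k * F x) = cmod (F x)" if "x \<in> space M" for x k
    using \<phi>[OF that] by (simp add: norm_mult norm_power)
  \<comment> \<open>In the expansion of g the k-th term with k > 0 contributes the coefficient of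
    index k - 1, which vanishes; the term k = 0 has coefficient 1 and reproduces the
    integral.\<close>
  have I_eq: "?I = (\<integral>x. cnj (\<phi> x) * inner_approx t (r m) (\<phi> x) * F x \<partial>M)" for t m
  proof -
    obtain a where a: "a 0 = 1" "summable (\<lambda>k. cmod (a k))"
      "\<And>z. cmod z = 1 \<Longrightarrow> (\<lambda>k. a k * z ^ k) sums inner_approx t (r m) z"
      using inner_approx_power_series[OF r] by blast
    let ?f = "\<lambda>k x. a k * (cnj (\<phi> x) * \<phi> x ^ k * F x)"
    have i: "integrable M (\<lambda>x. cnj (\<phi> x) * \<phi> x ^ k * F x)" for k
      by (rule Bochner_Integration.integrable_bound[OF F]) (auto simp: cphi)
    have nf: "norm (?f k x) = cmod (a k) * cmod (F x)" if "x \<in> space M" for k x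
      unfolding norm_mult[of "a k"] cphi[OF that] ..
    have "(\<lambda>k. \<integral>x. ?f k x \<partial>M) sums (\<integral>x. (\<Sum>k. ?f k x) \<partial>M)"
    proof (rule sums_integral)
      show "integrable M (?f k)" for k by (intro integrable_mult_right i)
      show "AE x in M. summable (\<lambda>k. norm (?f k x))"
        by (rule AE_I2) (simp only: nf summable_mult2 a)
      have "(\<integral>x. norm (?f k x) \<partial>M) = cmod (a k) * (\<integral>x. cmod (F x) \<partial>M)" for k
        by (subst integral_mult_right_zero[symmetric]) (rule Bochner_Integration.integral_cong, auto simp only: nf)
      then show "summable (\<lambda>k. \<integral>x. norm (?f k x) \<partial>M)"
        by (simp only: summable_mult2 a)
    qed
    moreover have "(\<Sum>k. ?f k x) = cnj (\<phi> x) * inner_approx t (r m) (\<phi> x) * F x" if x: "x \<in> space M" for x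
    proof -
      have "(\<lambda>k. cnj (\<phi> x) * (a k * \<phi> x ^ k) * F x) sums (cnj (\<phi> x) * inner_approx t (r m) (\<phi> x) * F x)"
        by (intro sums_mult2 sums_mult a \<phi> x)
      moreover have "cnj (\<phi> x) * (a k * \<phi> x ^ k) * F x = ?f k x" for k by (simp only: mult_ac)
      ultimately show ?thesis by (simp only: sums_unique[symmetric])
    qed
    then have "(\<integral>x. (\<Sum>k. ?f k x) \<partial>M) = (\<integral>x. cnj (\<phi> x) * inner_approx t (r m) (\<phi> x) * F x \<partial>M)"
      by (intro Bochner_Integration.integral_cong) auto
    moreover have "(\<lambda>k. \<integral>x. ?f k x \<partial>M) = (\<lambda>k. if k = 0 then ?I else 0)"
    proof
      fix k
      show "(\<integral>x. ?f k x \<partial>M) = (if k = 0 then ?I else 0)"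
      proof (cases k)
        case (Suc j)
        have "(\<integral>x. cnj (\<phi> x) * \<phi> x ^ k * F x \<partial>M) = (\<integral>x. \<phi> x ^ j * F x \<partial>M)"
        proof (rule Bochner_Integration.integral_cong[OF refl])
          fix x assume "x \<in> space M"
          then have "cnj (\<phi> x) * \<phi> x = 1"
            using \<phi> complex_norm_square[of "\<phi> x"] by (simp add: mult.commute)
          then show "cnj (\<phi> x) * \<phi> x ^ k * F x = \<phi> x ^ j * F x"
            unfolding Suc power_Suc by (simp flip: mult.assoc)
        qed
        then show ?thesis by (simp add: Suc coeff)
      qed (simp add: a)
    qed
    ultimately have "(\<lambda>k. if k = 0 then ?I else 0) sums (\<integral>x. cnj (\<phi> x) * inner_approx t (r m) (\<phi> x) * F x \<partial>M)"
      by (simp only:)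
    moreover have "(\<lambda>k. if k = 0 then ?I else 0) sums ?I"
      by (rule sums_single)
    ultimately show ?thesis by (simp only: sums_unique2)
  qed
  \<comment> \<open>Letting r tend to 1 for fixed t; the bound by the cyclic weight provides the
    dominating function.\<close>
  have le: "cmod ?I \<le> exp (- t) * (\<integral>x. cmod (F x) \<partial>M)" if t: "0 \<le> t" for t
  proof -
    have "(\<lambda>m. \<integral>x. cmod (inner_approx t (r m) (\<phi> x)) * cmod (F x) \<partial>M) \<longlonglongrightarrow> (\<integral>x. exp (- t) * cmod (F x) \<partial>M)"
    proof (rule integral_dominated_convergence[where w="\<lambda>x. exp (4 * t\<^sup>2) * u x"])
      show "AE x in M. (\<lambda>m. cmod (inner_approx t (r m) (\<phi> x)) * cmod (F x)) \<longlonglongrightarrow> exp (- t) * cmod (F x)"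
        using ne AE_space
        by eventually_elim (unfold r_def, intro tendsto_mult tendsto_const inner_approx_tendsto \<phi>)
      show "AE x in M. norm (cmod (inner_approx t (r m) (\<phi> x)) * cmod (F x)) \<le> exp (4 * t\<^sup>2) * u x" for m
        using bnd[OF t, of m] by simp
    qed (use u in auto)
    moreover have "cmod ?I \<le> (\<integral>x. cmod (inner_approx t (r m) (\<phi> x)) * cmod (F x) \<partial>M)" for m
    proof -
      have "cmod ?I \<le> (\<integral>x. cmod (cnj (\<phi> x) * inner_approx t (r m) (\<phi> x) * F x) \<partial>M)"
        unfolding I_eq[of t m] by (rule integral_norm_bound)
      also have "\<dots> = (\<integral>x. cmod (inner_approx t (r m) (\<phi> x)) * cmod (F x) \<partial>M)"
        by (intro Bochner_Integration.integral_cong) (auto simp: norm_mult \<phi>)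
      finally show ?thesis .
    qed
    ultimately have "cmod ?I \<le> (\<integral>x. exp (- t) * cmod (F x) \<partial>M)"
      by (intro LIMSEQ_le_const) auto
    then show ?thesis by simp
  qed
  \<comment> \<open>Running t through the natural numbers forces the integral to be zero.\<close>
  have "(\<lambda>k. exp (- 1) ^ k * (\<integral>x. cmod (F x) \<partial>M)) \<longlonglongrightarrow> 0 * (\<integral>x. cmod (F x) \<partial>M)"
    by (intro tendsto_mult LIMSEQ_realpow_zero tendsto_const) auto
  moreover have "cmod ?I \<le> exp (- 1) ^ k * (\<integral>x. cmod (F x) \<partial>M)" for k :: nat
    using le[of "real k"] by (simp add: exp_of_nat_mult[symmetric])
  ultimately have "cmod ?I \<le> 0 * (\<integral>x. cmod (F x) \<partial>M)"
    by (intro LIMSEQ_le_const) auto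
  then show ?thesis by simp
qed

context digit_model
begin

lemma phase_neq_1: "AE y in leb01. phase y \<noteq> 1"
proof -
  have "AE y in leb01. y \<in> {0..<1} \<and> y \<noteq> 0"
    using AE_leb01_neq[of 0] AE_space[of leb01] by eventually_elim simp
  then show ?thesis
  proof eventually_elim
    case (elim y)
    then have "code 0 < code y" by (intro strict_mono_onD[OF code_strict_mono]) auto
    then have "code y \<noteq> 0" using code_nonneg[of 0] by simp
    show ?case
    proof
      assume "phase y = 1"
      then have "cis (2 * pi * code y) = cis (2 * pi * 0)" by (simp add: phase_def)
      then have "code y = 0" by (rule cis_2pi_inj) (use elim code_in[of y] in auto)
      then show False using \<open>code y \<noteq> 0\<close> by simp
    qed
  qed
qed

text \<open>Multiplication by a power of \<open>cnj (phase y)\<close> leaves the modulus of F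
  unchanged, so the domination persists and \<open>szego_step\<close> can be iterated, one negative
  index at a time. Once all coefficients vanish, Fourier uniqueness applies.\<close>

lemma cyclic_fourier_unique:
  assumes F: "integrable leb01 F" and u: "integrable leb01 u"
    and Fu: "\<And>y. y \<in> {0..<1} \<Longrightarrow> cmod (F y) \<le> cyclic_weight (phase y) * u y"
    and coeff: "\<And>k::nat. (\<integral>y. phase y ^ k * F y \<partial>leb01) = 0"
  shows "AE y in leb01. F y = 0"
proof -
  have [measurable]: "F \<in> borel_measurable leb01" using F by auto
  have "\<forall>k::nat. (\<integral>y. phase y ^ k * (cnj (phase y) ^ j * F y) \<partial>leb01) = 0" for j
  proof (induction j)
    case (Suc j)
    let ?F = "\<lambda>y. cnj (phase y) ^ j * F y"
    have i: "integrable leb01 ?F"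
      by (rule Bochner_Integration.integrable_bound[OF F]) (auto simp: norm_mult norm_power)
    have st: "(\<integral>y. cnj (phase y) * ?F y \<partial>leb01) = 0"
      by (rule szego_step[OF _ _ phase_neq_1 i u]) (use Suc Fu in \<open>auto simp: norm_mult norm_power\<close>)
    show ?case
    proof
      fix k :: nat
      show "(\<integral>y. phase y ^ k * (cnj (phase y) ^ Suc j * F y) \<partial>leb01) = 0"
      proof (cases k)
        case 0
        then show ?thesis using st by (simp add: mult.assoc)
      next
        case (Suc k')
        have "phase y ^ k * (cnj (phase y) ^ Suc j * F y) = (phase y * cnj (phase y)) * (phase y ^ k' * ?F y)" for y
          unfolding Suc power_Suc by (simp only: mult_ac)
        then show ?thesis using Suc.IH by (simp only: phase_mult_cnj mult_1_left)
      qed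
    qed
  qed (use coeff in simp)
  note all = this
  show ?thesis
  proof (rule strict_mono_fourier_unique[OF code_strict_mono code_in F])
    show "(\<integral>x. cis (2 * pi * code x) ^ k * F x \<partial>leb01) = 0" for k
      using coeff[of k] by (simp add: phase_def)
    show "(\<integral>x. cnj (cis (2 * pi * code x)) ^ k * F x \<partial>leb01) = 0" for k
      using all[of k] by (auto simp: phase_def dest: spec[of _ 0])
  qed
qed

lemma U_funpow_G: "sqint f \<Longrightarrow> (U ^^ k) (G f) = G (\<lambda>y. phase y ^ k * f y) \<and> sqint (\<lambda>y. phase y ^ k * f y)"
proof (induction k)
  case (Suc k)
  then show ?case using sqint_phase_mult(1)[of "\<lambda>y. phase y ^ k * f y"]
    by (simp add: U_G mult.assoc)
qed simp

end

section \<open>Spectral measure and inequivalence\<close>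

context l2_representation
begin

lemma G_zero: "G (\<lambda>y. 0) = 0"
proof -
  have z: "sqint (\<lambda>y. 0)" by (simp add: sqint_def)
  show ?thesis using G_diff[OF z z] by simp
qed

lemma G_sum:
  assumes "\<And>i. i \<in> A \<Longrightarrow> sqint (f i)"
  shows "G (\<lambda>y. \<Sum>i\<in>A. f i y) = (\<Sum>i\<in>A. G (f i))"
  using assms
proof (induction A rule: infinite_finite_induct)
  case (insert i A)
  then show ?case by (simp add: G_add sqint_sum)
qed (simp_all add: G_zero)

lemma G_eq_zero_iff: "sqint f \<Longrightarrow> G f = 0 \<longleftrightarrow> (AE y in leb01. f y = 0)"
  using G_eq_iff[of f "\<lambda>y. 0"] by (simp add: G_zero sqint_def)

lemma not_AE_False: "\<not> (AE y in leb01. False)"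
proof
  assume "AE y in leb01. False"
  then have "emeasure leb01 (space leb01) = 0"
    by (subst (asm) AE_iff_measurable[OF sets.top]) auto
  then show False
    using measure_leb01 by (simp add: measure_def)
qed

end

context digit_model
begin

text \<open>The locale works over an inner product space without completeness, so the projection
  theorem enters as a hypothesis, to be discharged for Hilbert spaces.\<close>

lemma cyclic_operator_U:
  assumes complete: "\<And>K (x :: 'a). complex_vector.subspace K \<Longrightarrow> closed K \<Longrightarrow> x \<notin> K \<Longrightarrow>
    \<exists>h. h \<noteq> 0 \<and> (\<forall>k\<in>K. cinner k h = 0)"
  shows "cyclic_operator U"
  unfolding cyclic_operator_def
proof (intro exI conjI)
  let ?w = "\<lambda>y. complex_of_real (cyclic_weight (phase y))"
  have wm: "cyclic_weight \<in> borel_measurable borel" unfolding cyclic_weight_def by measurable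
  note [measurable] = wm
  have w1: "cmod (?w y) \<le> 1" for y using cyclic_weight_bounds[of "phase y"] by simp
  have w: "sqint ?w" by (rule sqint_bounded[where B=1]) (use w1 in auto)
  have w0: "?w y \<noteq> 0" for y using cyclic_weight_bounds(1)[of "phase y"] by simp
  show "G ?w \<noteq> 0" using w0 not_AE_False by (simp add: G_eq_zero_iff[OF w])
  define K where "K = closure (cspan (range (\<lambda>k. (U ^^ k) (G ?w))))"
  have K: "complex_vector.subspace K" "closed K"
    by (simp_all add: K_def csubspace_closure complex_vector.subspace_span)
  have inK: "(U ^^ k) (G ?w) \<in> K" for k
    unfolding K_def by (intro subsetD[OF closure_subset] complex_vector.span_base) auto
  have "x \<in> K" for x
  proof (rule ccontr)
    assume "x \<notin> K"
    then obtain h where h: "h \<noteq> 0" "\<And>k. k \<in> K \<Longrightarrow> cinner k h = 0"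
      using complete[OF K] by blast
    obtain u where u: "sqint u" "h = G u" by (rule G_cases)
    \<comment> \<open>The coefficients of this function are the inner products of the orbit with h.
      As the weight has no zeros, F = 0 forces u = 0.\<close>
    let ?F = "\<lambda>y. ?w y * cnj (u y)"
    have "AE y in leb01. ?F y = 0"
    proof (rule cyclic_fourier_unique)
      show "integrable leb01 ?F" by (intro sqint_mult_integrable w sqint_cnj u)
      show "integrable leb01 (\<lambda>y. cmod (u y))" using sqint_integrable[OF u(1)] by auto
      show "cmod (?F y) \<le> cyclic_weight (phase y) * cmod (u y)" for y
        using cyclic_weight_bounds(1)[of "phase y"] by (simp add: norm_mult)
      show "(\<integral>y. phase y ^ k * ?F y \<partial>leb01) = 0" for k
      proof -
        have "(\<integral>y. (phase y ^ k * ?w y) * cnj (u y) \<partial>leb01) = cinner ((U ^^ k) (G ?w)) h"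
          using U_funpow_G[OF w, of k] u by (simp add: G_cinner)
        then show ?thesis using h(2)[OF inK] by (simp only: mult.assoc)
      qed
    qed
    then have "AE y in leb01. u y = 0" by eventually_elim (use w0 in auto)
    then show False using h u G_eq_zero_iff[OF u(1)] by simp
  qed
  then show "closure (cspan (range (\<lambda>k. (U ^^ k) (G ?w)))) = UNIV" unfolding K_def by blast
qed

section \<open>The spectral measure of U and the absence of atoms\<close>

lemma sets_circle_borel: "A \<in> sets circle_borel \<Longrightarrow> A \<in> sets borel \<and> A \<subseteq> sphere 0 1"
  unfolding circle_borel_def by (subst (asm) sets_restrict_space_iff) auto

lemma space_circle_borel: "space circle_borel = sphere 0 1"
  by (simp add: circle_borel_def space_restrict_space)

lemma phase_measurable_circle: "phase \<in> leb01 \<rightarrow>\<^sub>M circle_borel"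
  unfolding circle_borel_def by (rule measurable_restrict_space2) (auto simp: dist_norm)

definition E :: "complex set \<Rightarrow> 'a \<Rightarrow> 'a" where
  "E A = weighted_comp (\<lambda>y. indicator A (phase y)) (\<lambda>y. y)"

lemma bounded_multiplier_indicator:
  assumes "A \<in> sets borel" shows "bounded_multiplier (\<lambda>y. indicator A (phase y))"
  unfolding bounded_multiplier_def
proof
  show "(\<lambda>y. indicator A (phase y) :: complex) \<in> borel_measurable leb01"
    using assms by measurable
qed (auto intro!: exI[of _ 1] split: split_indicator)

lemma E_G: "A \<in> sets borel \<Longrightarrow> sqint f \<Longrightarrow> E A (G f) = G (\<lambda>y. indicator A (phase y) * f y)"
  unfolding E_def by (rule weighted_comp_G[OF measure_preserving_id bounded_multiplier_indicator])

lemma sqint_indicator: "A \<in> sets borel \<Longrightarrow> sqint f \<Longrightarrow> sqint (\<lambda>y. indicator A (phase y) * f y)"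
  by (rule sqint_weighted_comp[OF measure_preserving_id bounded_multiplier_indicator])

lemma E_comp:
  assumes "A \<in> sets borel" "B \<in> sets borel" shows "E (A \<inter> B) = E A \<circ> E B"
proof
  fix x
  obtain f where f: "sqint f" "x = G f" by (rule G_cases)
  show "E (A \<inter> B) x = (E A \<circ> E B) x"
    unfolding f comp_apply E_G[OF assms(2) f(1)] E_G[OF assms(1) sqint_indicator[OF assms(2) f(1)]]
      E_G[OF sets.Int[OF assms] f(1)]
    by (simp add: indicator_inter_arith mult.assoc)
qed

lemma E_selfadjoint:
  assumes "A \<in> sets borel" shows "is_cadjoint (E A) (E A)"
  unfolding is_cadjoint_def
proof (intro allI)
  fix x y
  obtain f g where f: "sqint f" "x = G f" and g: "sqint g" "y = G g" by (metis G_cases)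
  show "cinner (E A x) y = cinner x (E A y)"
    unfolding f g E_G[OF assms f(1)] E_G[OF assms g(1)]
      G_cinner[OF sqint_indicator[OF assms f(1)] g(1)] G_cinner[OF f(1) sqint_indicator[OF assms g(1)]]
    by (intro Bochner_Integration.integral_cong) (auto split: split_indicator)
qed

text \<open>Each remainder of the series is multiplication by the indicator of a tail of the union.
  It is bounded by 1 and tends to zero pointwise, so dominated convergence with
  \<open>(cmod (f y)) ^ 2\<close> gives strong convergence.\<close>

lemma E_sums:
  assumes A: "\<And>k. A k \<in> sets borel" and disj: "disjoint_family A"
  shows "(\<lambda>k. E (A k) x) sums E (\<Union>k. A k) x"
proof -
  obtain f where f: "sqint f" "x = G f" by (rule G_cases)
  have un: "(\<Union>k. A k) \<in> sets borel" using A by auto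
  let ?d = "\<lambda>N z. indicator (\<Union>k. A k) z - (\<Sum>k<N. indicator (A k) z :: real)"
  have ind: "(\<lambda>k. indicator (A k) z :: real) sums indicator (\<Union>k. A k) z" for z
    using disj by (intro indicator_sums) (auto simp: disjoint_family_on_def)
  have d: "0 \<le> ?d N z" "?d N z \<le> 1" for N z
  proof -
    have "(\<Sum>k<N. indicator (A k) z :: real) \<le> (\<Sum>k. indicator (A k) z)"
      by (rule sum_le_suminf[OF sums_summable[OF ind]]) auto
    then show "0 \<le> ?d N z" by (simp add: sums_unique[OF ind, symmetric])
    have "0 \<le> (\<Sum>k<N. indicator (A k) z :: real)" by (intro sum_nonneg) auto
    then show "?d N z \<le> 1" by (simp add: indicator_def)
  qed
  have [measurable]: "f \<in> borel_measurable leb01" by (rule sqint_measurable[OF f(1)])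
  have [measurable]: "A k \<in> sets borel" for k by (rule A)
  have dm: "(\<lambda>y. ?d N (phase y)) \<in> borel_measurable leb01" for N
    using un by measurable
  have dsq: "sqint (\<lambda>y. complex_of_real (?d N (phase y)) * f y)" for N
    by (rule sqint_bounded_mult[OF f(1), where B=1]) (use dm d in \<open>auto simp del: of_real_diff of_real_sum\<close>)
  have eq: "E (\<Union>k. A k) x - (\<Sum>k<N. E (A k) x) = G (\<lambda>y. complex_of_real (?d N (phase y)) * f y)" for N
  proof -
    have "(\<Sum>k<N. E (A k) x) = G (\<lambda>y. \<Sum>k<N. indicator (A k) (phase y) * f y)"
      unfolding f E_G[OF A f(1)] by (rule G_sum[symmetric]) (intro sqint_indicator A f)
    then have "E (\<Union>k. A k) x - (\<Sum>k<N. E (A k) x)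
        = G (\<lambda>y. indicator (\<Union>k. A k) (phase y) * f y - (\<Sum>k<N. indicator (A k) (phase y) * f y))"
      using G_diff[OF sqint_indicator[OF un f(1)] sqint_sum[of "{..<N}" "\<lambda>k y. indicator (A k) (phase y) * f y"]]
      by (simp add: f E_G[OF un f(1)] sqint_indicator A)
    also have "(\<lambda>y. indicator (\<Union>k. A k) (phase y) * f y - (\<Sum>k<N. indicator (A k) (phase y) * f y))
        = (\<lambda>y. complex_of_real (?d N (phase y)) * f y)"
      by (simp add: of_real_indicator left_diff_distrib sum_distrib_right)
    finally show ?thesis .
  qed
  have "(\<lambda>N. (norm (E (\<Union>k. A k) x - (\<Sum>k<N. E (A k) x)))\<^sup>2) \<longlonglongrightarrow> 0"
  proof -
    have "(\<lambda>N. \<integral>y. (cmod (complex_of_real (?d N (phase y)) * f y))\<^sup>2 \<partial>leb01) \<longlonglongrightarrow> (\<integral>y. 0 \<partial>leb01)"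
    proof (rule integral_dominated_convergence[where w="\<lambda>y. (cmod (f y))\<^sup>2"])
      show "integrable leb01 (\<lambda>y. (cmod (f y))\<^sup>2)" using f by (simp add: sqint_def)
      show "(\<lambda>y. (cmod (complex_of_real (?d N (phase y)) * f y))\<^sup>2) \<in> borel_measurable leb01" for N
        using dsq[of N] unfolding sqint_def by (intro borel_measurable_integrable) blast
      show "AE y in leb01. (\<lambda>N. (cmod (complex_of_real (?d N (phase y)) * f y))\<^sup>2) \<longlonglongrightarrow> 0"
      proof (rule AE_I2)
        fix y
        have "(\<lambda>N. ?d N (phase y)) \<longlonglongrightarrow> indicator (\<Union>k. A k) (phase y) - indicator (\<Union>k. A k) (phase y)"
          using ind[of "phase y"] unfolding sums_def by (intro tendsto_intros)
        then have "(\<lambda>N. (cmod (complex_of_real (?d N (phase y)) * f y))\<^sup>2) \<longlonglongrightarrow> (cmod (complex_of_real 0 * f y))\<^sup>2"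
          by (intro tendsto_intros) simp
        then show "(\<lambda>N. (cmod (complex_of_real (?d N (phase y)) * f y))\<^sup>2) \<longlonglongrightarrow> 0" by simp
      qed
      show "AE y in leb01. norm ((cmod (complex_of_real (?d N (phase y)) * f y))\<^sup>2) \<le> (cmod (f y))\<^sup>2" for N
      proof (rule AE_I2)
        fix y
        have "cmod (complex_of_real (?d N (phase y)) * f y) \<le> 1 * cmod (f y)"
          unfolding norm_mult norm_of_real using d[of "phase y" N] by (intro mult_right_mono) auto
        then show "norm ((cmod (complex_of_real (?d N (phase y)) * f y))\<^sup>2) \<le> (cmod (f y))\<^sup>2"
          by (simp add: power_mono del: of_real_diff of_real_sum)
      qed
    qed simp
    then show ?thesis unfolding eq G_norm[OF dsq] by simp
  qed
  then have "(\<lambda>N. E (\<Union>k. A k) x - (\<Sum>k<N. E (A k) x)) \<longlonglongrightarrow> 0"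
    by (simp add: tendsto_norm_zero_iff)
  then have "(\<lambda>N. E (\<Union>k. A k) x - (E (\<Union>k. A k) x - (\<Sum>k<N. E (A k) x))) \<longlonglongrightarrow> E (\<Union>k. A k) x - 0"
    by (intro tendsto_diff tendsto_const)
  then show ?thesis by (simp add: sums_def)
qed

lemma spectral_measure_E: "spectral_measure circle_borel E"
  unfolding spectral_measure_def
proof (intro conjI ballI allI impI)
  fix A assume "A \<in> sets circle_borel"
  then have A: "A \<in> sets borel" using sets_circle_borel by blast
  show "orthogonal_projection (E A)"
    unfolding orthogonal_projection_def
    using E_comp[OF A A] E_selfadjoint[OF A]
      bounded_clinear_weighted_comp[OF measure_preserving_id bounded_multiplier_indicator[OF A]]
    by (simp add: E_def)
next
  show "E {} = (\<lambda>x. 0)"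
  proof
    fix x
    obtain f where f: "sqint f" "x = G f" by (rule G_cases)
    show "E {} x = 0" unfolding f by (simp add: E_G f G_zero)
  qed
  show "E (space circle_borel) = id"
  proof
    fix x
    obtain f where f: "sqint f" "x = G f" by (rule G_cases)
    have "phase y \<in> sphere 0 1" for y by (simp add: dist_norm)
    moreover have "sphere 0 (1::real) \<in> sets (borel :: complex measure)" by auto
    ultimately show "E (space circle_borel) x = id x"
      unfolding f space_circle_borel by (simp add: E_G f)
  qed
next
  fix A B assume "A \<in> sets circle_borel" "B \<in> sets circle_borel"
  then show "E (A \<inter> B) = E A \<circ> E B" using E_comp sets_circle_borel by blast
next
  fix A :: "nat \<Rightarrow> complex set" and x
  assume "range A \<subseteq> sets circle_borel" "disjoint_family A"
  then show "(\<lambda>k. E (A k) x) sums E (\<Union>k. A k) x"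
    using sets_circle_borel by (intro E_sums) blast+
qed

text \<open>In this form the spectral integral becomes an integral over [0,1) by change of
  variables.\<close>

lemma scalar_spectral_measure_E:
  assumes f: "sqint f"
  shows "scalar_spectral_measure circle_borel E (G f)
    = distr (density leb01 (\<lambda>y. ennreal ((cmod (f y))\<^sup>2))) circle_borel phase"
    (is "_ = ?N")
proof -
  have [measurable]: "f \<in> borel_measurable leb01" by (rule sqint_measurable[OF f])
  note [measurable] = phase_measurable_circle
  have "?N = measure_of (space ?N) (sets ?N) (emeasure ?N)"
    by (rule measure_of_of_measure[symmetric])
  also have "\<dots> = measure_of (space circle_borel) (sets circle_borel) (emeasure ?N)" by simp
  also have "\<dots> = measure_of (space circle_borel) (sets circle_borel) (\<lambda>A. ennreal (Re (cinner (E A (G f)) (G f))))"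
  proof (rule measure_of_eq[OF sets.space_closed])
    fix A assume "A \<in> sigma_sets (space circle_borel) (sets circle_borel)"
    then have A: "A \<in> sets circle_borel" by (simp add: sets.sigma_sets_eq)
    then have Ab: "A \<in> sets borel" using sets_circle_borel by blast
    have i: "integrable leb01 (\<lambda>y. (cmod (f y))\<^sup>2 * indicator A (phase y))"
      by (rule Bochner_Integration.integrable_bound[where f="\<lambda>y. (cmod (f y))\<^sup>2"])
         (use f Ab in \<open>auto simp: sqint_def split: split_indicator\<close>)
    have "emeasure ?N A = (\<integral>\<^sup>+y. ennreal ((cmod (f y))\<^sup>2) * indicator (phase -` A \<inter> space leb01) y \<partial>leb01)"
      using A by (subst emeasure_distr) (auto intro!: emeasure_density)
    also have "\<dots> = (\<integral>\<^sup>+y. ennreal ((cmod (f y))\<^sup>2 * indicator A (phase y)) \<partial>leb01)"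
      by (intro nn_integral_cong) (auto split: split_indicator)
    also have "\<dots> = ennreal (\<integral>y. (cmod (f y))\<^sup>2 * indicator A (phase y) \<partial>leb01)"
      by (rule nn_integral_eq_integral[OF i]) auto
    also have "(\<integral>y. (cmod (f y))\<^sup>2 * indicator A (phase y) \<partial>leb01) = Re (cinner (E A (G f)) (G f))"
    proof -
      have "cinner (E A (G f)) (G f) = (\<integral>y. complex_of_real ((cmod (f y))\<^sup>2 * indicator A (phase y)) \<partial>leb01)"
        unfolding E_G[OF Ab f] G_cinner[OF sqint_indicator[OF Ab f] f]
        by (intro Bochner_Integration.integral_cong)
           (auto simp: complex_norm_square split: split_indicator simp del: of_real_power)
      also have "\<dots> = complex_of_real (\<integral>y. (cmod (f y))\<^sup>2 * indicator A (phase y) \<partial>leb01)"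
        by (rule integral_complex_of_real)
      finally show ?thesis by simp
    qed
    finally show "emeasure ?N A = ennreal (Re (cinner (E A (G f)) (G f)))" .
  qed
  finally show ?thesis by (simp add: scalar_spectral_measure_def)
qed

lemma has_spectral_measure_U: "has_spectral_measure U E"
  unfolding has_spectral_measure_def
proof (intro conjI allI spectral_measure_E)
  fix x
  obtain f where f: "sqint f" "x = G f" by (rule G_cases)
  have "(\<lambda>z. z) \<in> borel_measurable circle_borel"
    unfolding circle_borel_def by (rule measurable_restrict_space1) simp
  then have "(LINT z|scalar_spectral_measure circle_borel E x. z) = (\<integral>y. (cmod (f y))\<^sup>2 *\<^sub>R phase y \<partial>leb01)"
    unfolding f scalar_spectral_measure_E[OF f(1)]
    using f by (intro integral_distr_density phase_measurable_circle) (auto simp: sqint_def)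
  also have "\<dots> = (\<integral>y. phase y * f y * cnj (f y) \<partial>leb01)"
    by (intro Bochner_Integration.integral_cong)
       (auto simp: scaleR_conv_of_real complex_norm_square mult_ac simp del: of_real_power)
  also have "\<dots> = cinner (U x) x"
    unfolding f U_G[OF f(1)] by (rule G_cinner[OF sqint_phase_mult(1)[OF f(1)] f(1), symmetric])
  finally show "cinner (U x) x = (LINT z|scalar_spectral_measure circle_borel E x. z)" by simp
qed

text \<open>The vector of the constant function 1 detects the mass of the preimage of A, which is
  what tells an atom from a splittable set.\<close>

lemma norm_E_one:
  assumes "A \<in> sets borel"
  shows "(norm (E A (G (\<lambda>y. 1))))\<^sup>2 = (\<integral>y. indicator A (phase y) \<partial>leb01)"
proof -
  have one: "sqint (\<lambda>y. 1)" by (simp add: sqint_def)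
  show ?thesis
    unfolding E_G[OF assms one] G_norm[OF sqint_indicator[OF assms one]]
    by (intro Bochner_Integration.integral_cong) (auto split: split_indicator)
qed

lemma E_nonzero_imp:
  assumes A: "A \<in> sets borel" and ne: "E A \<noteq> (\<lambda>x. 0)"
  shows "0 < (\<integral>y. indicator A (phase y) \<partial>leb01 :: real)"
proof (rule ccontr)
  assume "\<not> 0 < (\<integral>y. indicator A (phase y) \<partial>leb01 :: real)"
  moreover have "0 \<le> (\<integral>y. indicator A (phase y) \<partial>leb01 :: real)"
    by (rule Bochner_Integration.integral_nonneg) simp
  ultimately have "(\<integral>y. indicator A (phase y) \<partial>leb01 :: real) = 0" by linarith
  moreover have "integrable leb01 (\<lambda>y. indicator A (phase y) :: real)"
    using A by (intro integrable_bounded_unit[where B=1]) (auto split: split_indicator)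
  ultimately have "AE y in leb01. indicator A (phase y) = (0::real)"
    by (subst (asm) integral_nonneg_eq_0_iff_AE) auto
  then have "AE y in leb01. phase y \<notin> A"
    by eventually_elim (auto split: split_indicator_asm)
  have "E A x = 0" for x
  proof -
    obtain f where f: "sqint f" "x = G f" by (rule G_cases)
    have "AE y in leb01. indicator A (phase y) * f y = 0"
      using \<open>AE y in leb01. phase y \<notin> A\<close> by eventually_elim simp
    then show ?thesis
      unfolding f E_G[OF A f(1)] by (simp add: G_eq_zero_iff[OF sqint_indicator[OF A f(1)]])
  qed
  then show False using ne by blast
qed

text \<open>The mass of the part of the preimage up to s is 1-Lipschitz in s, starts at zero and
  ends at the total, so it takes the value one half of it.\<close>

lemma exists_half_part:
  assumes A: "A \<in> sets borel" and pos: "0 < (\<integral>y. indicator A (phase y) \<partial>leb01 :: real)"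
  shows "\<exists>s. 0 \<le> s \<and> s < 1 \<and> (\<integral>y. indicator A (phase y) * indicator {..s} y \<partial>leb01)
    = (\<integral>y. indicator A (phase y) \<partial>leb01 :: real) / 2"
proof -
  let ?F = "\<lambda>s. \<integral>y. indicator A (phase y) * indicator {..s} y \<partial>leb01 :: real"
  let ?a = "\<integral>y. indicator A (phase y) \<partial>leb01 :: real"
  have i: "integrable leb01 (\<lambda>y. indicator A (phase y) * indicator {..s} y :: real)" for s
    using A by (intro integrable_bounded_unit[where B=1]) (auto split: split_indicator)
  have le: "\<bar>?F s' - ?F s\<bar> \<le> s' - s" if "s \<le> s'" "0 \<le> s" "s' \<le> 1" for s s'
  proof -
    have iv: "(\<integral>y. indicator {s<..s'} y \<partial>leb01 :: real) \<le> s' - s"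
    proof -
      have "(\<integral>y. indicator {s<..s'} y \<partial>leb01 :: real) = (\<integral>x. indicator ({0..<1} \<inter> {s<..s'}) x \<partial>lborel)"
        unfolding integral_leb01 by (simp add: indicator_inter_arith)
      also have "\<dots> = measure lborel ({0..<1} \<inter> {s<..s'})" by simp
      also have "\<dots> \<le> measure lborel {s<..s'}"
        using that by (intro measure_mono_fmeasurable) (auto simp: fmeasurable_def)
      finally show ?thesis using that by simp
    qed
    have "?F s' - ?F s = (\<integral>y. indicator A (phase y) * indicator {..s'} y - indicator A (phase y) * indicator {..s} y \<partial>leb01)"
      by (rule Bochner_Integration.integral_diff[OF i i, symmetric])
    also have "\<dots> = (\<integral>y. indicator A (phase y) * indicator {s<..s'} y \<partial>leb01)"
      using that by (intro Bochner_Integration.integral_cong) (auto split: split_indicator)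
    finally have eq: "?F s' - ?F s = (\<integral>y. indicator A (phase y) * indicator {s<..s'} y \<partial>leb01)" .
    have "0 \<le> (\<integral>y. indicator A (phase y) * indicator {s<..s'} y \<partial>leb01 :: real)"
      by (rule Bochner_Integration.integral_nonneg) simp
    moreover have "(\<integral>y. indicator A (phase y) * indicator {s<..s'} y \<partial>leb01 :: real) \<le> (\<integral>y. indicator {s<..s'} y \<partial>leb01)"
      using A by (intro integral_mono integrable_bounded_unit[where B=1]) (auto split: split_indicator)
    ultimately show ?thesis unfolding eq using iv by simp
  qed
  have "1-lipschitz_on {0..1} ?F"
  proof (rule lipschitz_onI)
    fix s s' :: real assume "s \<in> {0..1}" "s' \<in> {0..1}"
    then show "dist (?F s) (?F s') \<le> 1 * dist s s'"
      using le[of s s'] le[of s' s] unfolding dist_real_def by (cases "s \<le> s'") auto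
  qed simp
  then have cont: "continuous_on {0..1} ?F" by (rule lipschitz_on_continuous_on)
  have F0: "?F 0 = 0"
  proof -
    have "AE y in leb01. indicator A (phase y) * indicator {..0} y = (0::real)"
      using AE_leb01_neq[of 0] AE_space[of leb01] by eventually_elim auto
    then show ?thesis by (rule integral_eq_zero_AE)
  qed
  have F1: "?F 1 = ?a" by (intro Bochner_Integration.integral_cong) auto
  have "\<exists>s. 0 \<le> s \<and> s \<le> 1 \<and> ?F s = ?a / 2"
    using IVT'[of ?F 0 "?a / 2" 1] cont pos unfolding F0 F1 by auto
  then obtain s where s: "0 \<le> s" "s \<le> 1" "?F s = ?a / 2" by blast
  moreover have "s \<noteq> 1" using s F1 pos by auto
  ultimately show ?thesis by (intro exI[of _ s]) simp
qed

lemma non_atomic_U: "non_atomic U"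
  unfolding non_atomic_def
proof (intro exI[of _ E] conjI notI)
  show "has_spectral_measure U E" by (rule has_spectral_measure_U)
next
  assume "\<exists>A. spectral_atom circle_borel E A"
  then obtain A where A: "A \<in> sets circle_borel" "E A \<noteq> (\<lambda>x. 0)"
    and atom: "\<And>B. B \<in> sets circle_borel \<Longrightarrow> B \<subseteq> A \<Longrightarrow> E B = (\<lambda>x. 0) \<or> E B = E A"
    by (auto simp: spectral_atom_def)
  have Ab: "A \<in> sets borel" using A sets_circle_borel by blast
  let ?a = "\<integral>y. indicator A (phase y) \<partial>leb01 :: real"
  have pos: "0 < ?a" by (rule E_nonzero_imp[OF Ab A(2)])
  obtain s where s: "s \<in> {0..<1}"
    and half: "(\<integral>y. indicator A (phase y) * indicator {..s} y \<partial>leb01) = ?a / 2"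
    using exists_half_part[OF Ab pos] by auto
  \<comment> \<open>The arc up to \<open>code s\<close> cuts out exactly the points y \<le> s, so B
    carries half of the mass and is neither null nor all of A.\<close>
  define B where "B = A \<inter> circle_arc (code s)"
  have Bb: "B \<in> sets borel" using Ab closed_arc by (auto simp: B_def)
  have "B \<in> sets circle_borel"
    unfolding circle_borel_def using sets_circle_borel[OF A(1)] Bb
    by (subst sets_restrict_space_iff) (auto simp: B_def)
  then have or: "E B = (\<lambda>x. 0) \<or> E B = E A" by (rule atom) (simp add: B_def)
  have "(\<integral>y. indicator B (phase y) \<partial>leb01 :: real) = (\<integral>y. indicator A (phase y) * indicator {..s} y \<partial>leb01)"
  proof (rule Bochner_Integration.integral_cong[OF refl])
    fix y assume "y \<in> space leb01"
    then have y: "y \<in> {0..<1}" by simp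
    have "phase y \<in> circle_arc (code s) \<longleftrightarrow> code y \<le> code s"
      unfolding phase_def using code_in[OF y] code_in[OF s] by (intro cis_in_arc_iff) auto
    also have "\<dots> \<longleftrightarrow> y \<le> s" using y s by (rule strict_mono_on_less_eq[OF code_strict_mono])
    finally show "indicator B (phase y) = (indicator A (phase y) * indicator {..s} y :: real)"
      by (simp add: B_def indicator_def)
  qed
  then have B: "(norm (E B (G (\<lambda>y. 1))))\<^sup>2 = ?a / 2" by (simp add: norm_E_one[OF Bb] half)
  from or show False
  proof
    assume "E B = (\<lambda>x. 0)"
    then show False using B pos by simp
  next
    assume "E B = E A"
    then show False using B pos by (simp add: norm_E_one[OF Ab])
  qed
qed

end

section \<open>Distinguishing the operators by digit frequency\<close>

text \<open>\<open>zero_arc n\<close> is the half-open circle_arc of arguments in \<open>[0, 2 * pi / n)\<close>, so that \<open>z ^ (n ^ k)\<close> lies in it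
  iff the \<open>k\<close>-th base \<open>n\<close> digit of \<open>z\<close> is \<open>0\<close>. The limit superior says that the frequencies converge
  to \<open>t\<close>, in a form that is visibly measurable.\<close>

definition zero_arc :: "nat \<Rightarrow> complex set" where
  "zero_arc n = (\<Union>i. circle_arc (1 / real n - 1 / real (Suc i)))"

definition zero_frequency :: "nat \<Rightarrow> nat \<Rightarrow> complex \<Rightarrow> real" where
  "zero_frequency n m z = (\<Sum>k<2^m. indicator (zero_arc n) (z ^ (n ^ k))) / 2 ^ m"

definition frequency_set :: "nat \<Rightarrow> real \<Rightarrow> complex set" where
  "frequency_set n t = {z. limsup (\<lambda>m. ereal \<bar>zero_frequency n m z - t\<bar>) = 0}"

lemma zero_arc_borel [measurable]: "zero_arc n \<in> sets borel"
  unfolding zero_arc_def using closed_arc by (intro sets.countable_UN) auto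

lemma frequency_set_borel: "frequency_set n t \<in> sets borel"
proof -
  have [measurable]: "zero_frequency n m \<in> borel_measurable borel" for m
    unfolding zero_frequency_def by measurable
  have "{z \<in> space borel. limsup (\<lambda>m. ereal \<bar>zero_frequency n m z - t\<bar>) = 0} \<in> sets borel"
    by measurable
  then show ?thesis by (simp add: frequency_set_def)
qed

lemma frequency_set_iff:
  assumes "(\<lambda>m. zero_frequency n m z) \<longlonglongrightarrow> t"
  shows "z \<in> frequency_set n t' \<longleftrightarrow> t = t'"
proof -
  have "(\<lambda>m. ereal \<bar>zero_frequency n m z - t'\<bar>) \<longlonglongrightarrow> ereal \<bar>t - t'\<bar>"
    by (intro tendsto_intros assms)
  then have "limsup (\<lambda>m. ereal \<bar>zero_frequency n m z - t'\<bar>) = ereal \<bar>t - t'\<bar>"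
    by (rule lim_imp_Limsup[OF trivial_limit_sequentially])
  then show ?thesis by (simp add: frequency_set_def zero_ereal_def)
qed

context digit_system
begin

text \<open>The remaining digits contribute \<open>code (shift y)\<close>, which lies in [0,1), so
  the first digit is zero exactly when \<open>real n * code y\<close> is below 1. The arc is
  half-open to exclude the argument where digit 1 begins.\<close>

lemma phase_in_zero_arc_iff:
  assumes y: "y \<in> {0..<1}"
  shows "phase y \<in> zero_arc n \<longleftrightarrow> digit y = 0"
proof -
  have n0: "0 < real n" using n by simp
  have arc_iff: "phase y \<in> circle_arc (1 / real n - 1 / real (Suc i)) \<longleftrightarrow> code y \<le> 1 / real n - 1 / real (Suc i)" for i
    unfolding phase_def
  proof (rule cis_in_arc_iff[OF code_in[OF y]])
    have "1 / real n \<le> 1 / 2" using n by (intro divide_left_mono) auto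
    moreover have "0 < 1 / real (Suc i)" by simp
    ultimately show "1 / real n - 1 / real (Suc i) < 1" by linarith
  qed
  have "phase y \<in> zero_arc n \<longleftrightarrow> (\<exists>i. code y \<le> 1 / real n - 1 / real (Suc i))"
    unfolding zero_arc_def UN_iff arc_iff by blast
  also have "\<dots> \<longleftrightarrow> code y < 1 / real n"
  proof
    assume "\<exists>i. code y \<le> 1 / real n - 1 / real (Suc i)"
    then obtain i where "code y \<le> 1 / real n - 1 / real (Suc i)" by blast
    moreover have "0 < 1 / real (Suc i)" by simp
    ultimately show "code y < 1 / real n" by linarith
  next
    assume "code y < 1 / real n"
    then obtain i where "inverse (real (Suc i)) < 1 / real n - code y"
      using reals_Archimedean[of "1 / real n - code y"] by auto
    then show "\<exists>i. code y \<le> 1 / real n - 1 / real (Suc i)"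
      by (intro exI[of _ i]) (simp add: inverse_eq_divide)
  qed
  also have "\<dots> \<longleftrightarrow> real n * code y < 1" using n0 by (simp add: field_simps)
  also have "\<dots> \<longleftrightarrow> digit y = 0"
    unfolding code_shift'[OF y] using code_in[OF shift_in[OF y]] by auto
  finally show ?thesis .
qed

text \<open>The digits of y can be read off the point \<open>phase y\<close> by taking n-th powers,
  without knowing p. A set of points fixed in advance therefore has full measure for one value of
  \<open>p 0\<close> and measure zero for all others.\<close>

lemma AE_frequency_set: "AE y in leb01. phase y \<in> frequency_set n t \<longleftrightarrow> p 0 = t"
  using AE_digit_frequency AE_space
proof eventually_elim
  case (elim y)
  then have y: "y \<in> {0..<1}" by simp
  have "zero_frequency n m (phase y) = (\<Sum>k<2^m. of_bool (digit ((shift ^^ k) y) = 0)) / 2 ^ m" for m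
  proof -
    have "indicator (zero_arc n) (phase y ^ (n ^ k)) = (of_bool (digit ((shift ^^ k) y) = 0) :: real)" for k
      using phase_in_zero_arc_iff[OF shift_funpow_in[OF y, of k]]
      by (simp add: phase_funpow_shift[OF y] indicator_def)
    then show ?thesis by (simp add: zero_frequency_def)
  qed
  then show ?case using elim by (intro frequency_set_iff) simp
qed

end

text \<open>An adjoint is unique, so the one in the definition of equivalence coincides with the
  inverse of V and can be cancelled.\<close>

lemma unitarily_equivalent_intertwiner:
  fixes X :: "'a::complex_inner \<Rightarrow> 'a" and Y :: "'b::complex_inner \<Rightarrow> 'b"
  assumes "X \<simeq>\<^sub>u Y"
  obtains V :: "'b \<Rightarrow> 'a" where "\<And>x y. cinner (V x) (V y) = cinner x y" "\<And>x. V (Y x) = X (V x)"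
proof -
  obtain V W where V: "cunitary V" "is_cadjoint W V" and Y: "Y = W \<circ> X \<circ> V"
    using assms by (auto simp: unitarily_equivalent_def)
  obtain W' where W': "is_cadjoint W' V" "W' \<circ> V = id" "V \<circ> W' = id"
    using V(1) by (auto simp: cunitary_def)
  have "W y = W' y" for y
  proof -
    have "cinner x (W y - W' y) = 0" for x
      using V(2) W'(1) unfolding is_cadjoint_def by (metis cinner_diff_right diff_self)
    then have "cinner (W y - W' y) (W y - W' y) = 0" .
    then show ?thesis by (simp add: cinner_self)
  qed
  then have VW: "V (W y) = y" for y using W'(3) by (metis comp_apply id_apply)
  have WV: "W' (V x) = x" for x using W'(2) by (metis comp_apply id_apply)
  show ?thesis
  proof
    show "cinner (V x) (V y) = cinner x y" for x y
      using W'(1) WV unfolding is_cadjoint_def by metis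
    show "V (Y x) = X (V x)" for x by (simp add: Y VW)
  qed
qed

text \<open>An intertwiner maps the vector of 1 to some \<open>G g\<close>, and comparing moments
  shows that the circle measure for q is the image of \<open>(cmod (g y)) ^ 2\<close> under the
  phase for p. The frequency set of \<open>q 0\<close> has mass 1 for the former and 0 for the
  latter.\<close>

lemma not_unitarily_equivalent:
  fixes G :: "(real \<Rightarrow> complex) \<Rightarrow> 'a::complex_inner"
  assumes P: "digit_model n p G" and Q: "digit_model n q G" and ne: "p 0 \<noteq> q 0"
  shows "\<not> digit_model.U n p G \<simeq>\<^sub>u digit_model.U n q G"
proof
  interpret P: digit_model n p G by (rule P)
  interpret Q: digit_model n q G by (rule Q)
  assume "P.U \<simeq>\<^sub>u Q.U"
  then obtain V where iso: "\<And>x y. cinner (V x) (V y) = cinner x y" and VU: "\<And>x. V (Q.U x) = P.U (V x)"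
    by (metis unitarily_equivalent_intertwiner)
  have VUk: "V ((Q.U ^^ k) x) = (P.U ^^ k) (V x)" for k x
    by (induction k) (auto simp: VU)
  have one: "sqint (\<lambda>y. 1)" by (simp add: sqint_def)
  obtain g where g: "sqint g" "V (G (\<lambda>y. 1)) = G g" by (rule P.G_cases)
  let ?g2 = "\<lambda>y. (cmod (g y))\<^sup>2"
  have g2: "integrable leb01 ?g2" using g by (simp add: sqint_def)
  have moments: "(\<integral>y. Q.phase y ^ k \<partial>leb01) = (\<integral>y. ?g2 y *\<^sub>R P.phase y ^ k \<partial>leb01)" for k
  proof -
    have "(\<integral>y. Q.phase y ^ k \<partial>leb01) = cinner ((Q.U ^^ k) (G (\<lambda>y. 1))) (G (\<lambda>y. 1))"
      using Q.U_funpow_G[OF one, of k] one by (simp add: P.G_cinner)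
    also have "\<dots> = cinner ((P.U ^^ k) (G g)) (G g)"
      unfolding iso[symmetric, of "(Q.U ^^ k) (G (\<lambda>y. 1))"] VUk g(2) ..
    also have "\<dots> = (\<integral>y. P.phase y ^ k * g y * cnj (g y) \<partial>leb01)"
      using P.U_funpow_G[OF g(1), of k] g(1) by (simp add: P.G_cinner)
    also have "\<dots> = (\<integral>y. ?g2 y *\<^sub>R P.phase y ^ k \<partial>leb01)"
      by (intro Bochner_Integration.integral_cong)
         (auto simp: scaleR_conv_of_real complex_norm_square mult_ac simp del: of_real_power)
    finally show ?thesis .
  qed
  let ?M = "distr (density leb01 (\<lambda>y. ennreal 1)) borel Q.phase"
  let ?N = "distr (density leb01 (\<lambda>y. ennreal (?g2 y))) borel P.phase"
  have "?M = ?N"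
  proof (rule circle_measure_eqI)
    show "finite_measure ?M" "AE z in ?M. cmod z = 1"
      by (rule distr_density_circle[where g="\<lambda>_. 1"]; simp)+
    show "finite_measure ?N" "AE z in ?N. cmod z = 1"
      by (rule distr_density_circle[OF _ _ g2]; simp)+
    show "(\<integral>z. z ^ k \<partial>?M) = (\<integral>z. z ^ k \<partial>?N)" for k
      using moments[of k] g2 by (subst (1 2) integral_distr_density) auto
  qed auto
  then have "(\<integral>z. (indicator (frequency_set n (q 0)) z :: real) \<partial>?M) = (\<integral>z. indicator (frequency_set n (q 0)) z \<partial>?N)"
    by (rule arg_cong)
  also have "(\<integral>z. (indicator (frequency_set n (q 0)) z :: real) \<partial>?M)
      = (\<integral>y. 1 *\<^sub>R indicator (frequency_set n (q 0)) (Q.phase y) \<partial>leb01)"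
    using frequency_set_borel by (intro integral_distr_density) auto
  also have "\<dots> = (\<integral>y. (1::real) \<partial>leb01)"
    using Q.AE_frequency_set[of "q 0"] frequency_set_borel
    by (intro integral_cong_AE) (auto elim!: eventually_mono)
  also have "(\<integral>z. (indicator (frequency_set n (q 0)) z :: real) \<partial>?N)
      = (\<integral>y. ?g2 y *\<^sub>R indicator (frequency_set n (q 0)) (P.phase y) \<partial>leb01)"
    using frequency_set_borel g2 by (intro integral_distr_density) auto
  also have "\<dots> = (\<integral>y. 0 \<partial>leb01)"
    using P.AE_frequency_set[of "q 0"] frequency_set_borel g ne
    by (intro integral_cong_AE) (auto elim!: eventually_mono simp: sqint_def)
  finally show False by simp
qed

theorem theorem3p23:
  assumes "separable_space (euclidean :: 'a::complex_hilbert topology)"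
    and "infinite_cdim TYPE('a)"
    and "CARD('n::{finite,linorder}) \<ge> 3"
  shows "\<exists>(\<Omega> :: nat set set) (U :: nat set \<Rightarrow> 'a \<Rightarrow> 'a).
           \<Omega> \<approx> (UNIV :: nat set set) \<and>
           (\<forall>\<alpha>\<in>\<Omega>. cunitary (U \<alpha>) \<and> cyclic_operator (U \<alpha>) \<and> non_atomic (U \<alpha>) \<and>
                  J_stable TYPE('n) (U \<alpha>)) \<and>
           (\<forall>\<alpha>\<in>\<Omega>. \<forall>\<beta>\<in>\<Omega>. \<alpha> \<noteq> \<beta> \<longrightarrow> \<not> U \<alpha> \<simeq>\<^sub>u U \<beta>)"
proof -
  obtain G :: "(real \<Rightarrow> complex) \<Rightarrow> 'a" where G: "l2_model G"
    using exists_l2_model[OF assms(1,2)] by blast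
  \<comment> \<open>The index set consists of all sets of natural numbers, which inject into the
    unit interval.\<close>
  obtain f :: "nat set \<Rightarrow> real" where f: "inj f" "range f \<subseteq> {0..<1}"
    using nat_sets_lepoll_reals01 by (auto simp: lepoll_def)
  define n where "n = CARD('n)"
  have n: "3 \<le> n" using assms(3) by (simp add: n_def)
  \<comment> \<open>This squeezes the parameters into [1/3, 2/3), so that the digit 0 and the other
    digits all get positive weight.\<close>
  define t where "t \<alpha> = (f \<alpha> + 1) / 3" for \<alpha>
  have t: "0 < t \<alpha>" "t \<alpha> < 1" for \<alpha>
    using f(2) by (auto simp: t_def dest!: subsetD[of _ _ "f \<alpha>"])
  \<comment> \<open>Only the weight of the digit 0 has to separate the operators; the rest is shared
    equally by the other n - 1 digits.\<close>
  define p where "p \<alpha> d = (if d = 0 then t \<alpha> else (1 - t \<alpha>) / (real n - 1))" for \<alpha> and d :: nat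
  have dm: "digit_model n (p \<alpha>) G" for \<alpha>
  proof (unfold_locales)
    show "2 \<le> n" using n by simp
    show "0 < p \<alpha> d" for d using t[of \<alpha>] n by (auto simp: p_def)
    obtain N where N: "n = Suc N" "0 < N" using n by (cases n) auto
    have "(\<Sum>d<n. p \<alpha> d) = t \<alpha> + (\<Sum>d<N. (1 - t \<alpha>) / real N)"
      unfolding N(1) sum.lessThan_Suc_shift by (simp add: p_def N(1))
    then show "(\<Sum>d<n. p \<alpha> d) = 1" using N(2) by simp
    show "l2_model G" by (rule G)
  qed
  show ?thesis
  proof (intro exI conjI ballI impI)
    show "(UNIV :: nat set set) \<approx> (UNIV :: nat set set)" by (rule eqpoll_refl)
    fix \<alpha> :: "nat set"
    interpret digit_model n "p \<alpha>" G by (rule dm)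
    show "cunitary (digit_model.U n (p \<alpha>) G)" by (rule cunitary_U)
    show "cyclic_operator (digit_model.U n (p \<alpha>) G)"
      by (rule cyclic_operator_U) (rule exists_orthogonal_to_closed_subspace)
    show "non_atomic (digit_model.U n (p \<alpha>) G)" by (rule non_atomic_U)
    show "J_stable TYPE('n) (digit_model.U n (p \<alpha>) G)" by (rule J_stable_U) (simp add: n_def)
  next
    fix \<alpha> \<beta> :: "nat set" assume "\<alpha> \<noteq> \<beta>"
    then have "f \<alpha> \<noteq> f \<beta>" using f(1) by (simp add: inj_eq)
    then have "p \<alpha> 0 \<noteq> p \<beta> 0" by (simp add: p_def t_def)
    then show "\<not> digit_model.U n (p \<alpha>) G \<simeq>\<^sub>u digit_model.U n (p \<beta>) G"
      by (rule not_unitarily_equivalent[OF dm dm])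
  qed
qed

end
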